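(* Let $K\subseteq\{1,\dots,n+p\}$ be a candidate attack set with the same cardinality as the actual attack set. Consider the conditioned system (defined in the context, for the signature $(B_K,D_K)$) associated with the descriptor system $E\dot x=Ax+Bu$, $y=Cx+Du$. Assume that the actual attack set is identifiable, that the initial state $x(0)$ is known, that $(E,A)$ is regular, that $x(0)$ is consistent, and that the input is smooth. Consider the attack identification filter for the attack signature $(B_K,D_K)$ $$\tilde E_{22}\dot w_2(t)=\bigl(\tilde A_{22}+\tilde G(I-\tilde C_1\tilde C_1^\dagger)\tilde C_2\bigr)w_2(t)-\tilde G\bar y(t),$$ $$r_K(t)=(I-\tilde C_1\tilde C_1^\dagger)\tilde C_2w_2(t)-\bar y(t),\qquad \bar y(t)=(I-\tilde C_1\tilde C_1^\dagger)y(t),$$ where $y(t)$ is the output of the conditioned system, $w_2(0)=x_2(0)$, and $\tilde G$ is such that $(\tilde E_{22},\tilde A_{22}+\tilde G(I-\tilde C_1\tilde C_1^\dagger)\tilde C_2)$ is Hurwitz. Then $r_K(t)=0$ for all times $t\in\mathbb R_{\ge0}$ if and only if $K$ coincides with the attack set.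
   Context: Setting: the descriptor system is $E\dot x(t)=Ax(t)+Bu(t)$, $y(t)=Cx(t)+Du(t)$, with $x(t)\in\mathbb R^n$, $y(t)\in\mathbb R^p$, $E,A\in\mathbb R^{n\times n}$ ($E$ possibly singular), $C\in\mathbb R^{p\times n}$, $B=[I_n\;\,0]\in\mathbb R^{n\times(n+p)}$, $D=[0\;\,I_p]\in\mathbb R^{p\times(n+p)}$, and unknown input $u(t)\in\mathbb R^{n+p}$. For an attack set $R\subseteq\{1,\dots,n+p\}$, $B_R,D_R$ are the submatrices of $B,D$ with columns in $R$ (the attack signature), and $u_R(t)\in\mathbb R^{|R|}$ (the attack mode) is the subvector of $u(t)$ indexed by $R$. In the presence of attackers indexed by $R$ (the attack set is then $R$), exactly the entries of $u$ indexed by $R$ are nonzero over time (each is not identically zero, the others vanish identically), so $Bu=B_Ru_R$, $Du=D_Ru_R$. Regular: $\det(sE-A)$ does not vanish identically. Consistent: $Ax(0)+Bu(0)$ is orthogonal to $\mathrm{Ker}(E^{\mathsf T})$. A pair $(F,M)$ is Hurwitz if all its finite generalized eigenvalues have negative real part. $\dagger$ denotes the Moore–Penrose pseudoinverse and $E^{-1}\mathcal S$ the preimage of a subspace $\mathcal S$ under $E$. $y(x_0,u,t)$ denotes the output generated from initial state $x_0$ under the attack signal $u$. An attack set $K'$ is unidentifiable if there exist an attack set $R$ with $|R|\le|K'|$ and $R\ne K'$, initial conditions $x_{K'},x_R\in\mathbb R^n$, and attack modes $u_{K'},u_R$ such that $y(x_{K'},u_{K'},t)=y(x_R,u_R,t)$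 for all $t\ge0$; otherwise $K'$ is identifiable. Conditioned system for the candidate $K$. Put $\hat A=A-B_KD_K^\dagger C$, $\hat B_K=B_K(I-D_K^\dagger D_K)$, $\hat C=(I-D_KD_K^\dagger)C$. Let $\mathcal S^*$ be the smallest subspace of $\mathbb R^n$ satisfying $$\mathcal S^*=[\hat A\;\;\hat B_K]\Bigl(\bigl(E^{-1}\mathcal S^*\times\mathbb R^{|K|}\bigr)\cap\mathrm{Ker}[\hat C\;\;0]\Bigr),$$ and let $L$ be an output injection matrix with $[\hat A+L\hat C\;\;\hat B_K]\bigl(E^{-1}\mathcal S^*\times\mathbb R^{|K|}\bigr)\subseteq\mathcal S^*$. Let $P=[\mathrm{Basis}(\mathcal S^* )\;\;\mathrm{Basis}((\mathcal S^* )^\perp)]$ and $Q=[\mathrm{Basis}(E^{-1}\mathcal S^* )\;\;\mathrm{Basis}((E^{-1}\mathcal S^* )^\perp)]$ be unitary (orthonormal bases). Then one can write $$P^{\mathsf T}EQ=\begin{bmatrix}\tilde E_{11}&\tilde E_{12}\\ 0&\tilde E_{22}\end{bmatrix},\quad P^{\mathsf T}(\hat A+L\hat C)Q=\begin{bmatrix}\tilde A_{11}&\tilde A_{12}\\ 0&\tilde A_{22}\end{bmatrix},\quad P^{\mathsf T}\hat B_K=\begin{bmatrix}\tilde B_K\\ 0\end{bmatrix},\quad \hat CQ=[\tilde C_1\;\;\tilde C_2].$$ With $[x_1^{\mathsf T}\;x_2^{\mathsf T}]^{\mathsf T}=Q^{-1}x$, the conditioned system under the attack set $K$ is $$\begin{bmatrix}\tilde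 E_{11}&\tilde E_{12}\\ 0&\tilde E_{22}\end{bmatrix}\begin{bmatrix}\dot x_1\\ \dot x_2\end{bmatrix}=\begin{bmatrix}\tilde A_{11}&\tilde A_{12}\\ 0&\tilde A_{22}\end{bmatrix}\begin{bmatrix}x_1\\ x_2\end{bmatrix}+\begin{bmatrix}\tilde B_K\\ 0\end{bmatrix}u_K,\qquad y=\tilde C_1x_1+\tilde C_2x_2.$$ If the actual attack set is $R$, the input term $[\tilde B_K^{\mathsf T}\;0]^{\mathsf T}u_K$ is replaced by $P^{\mathsf T}\bigl(B_R-B_KD_K^\dagger D_R+L(I-D_KD_K^\dagger)D_R\bigr)u_R$ and the term $(I-D_KD_K^\dagger)D_Ru_R$ is added to the output; for $R=K$ this reduces to the display above. Terms depending only on the known measured output (those compensating the output injections $B_KD_K^\dagger$ and $L$) are known inputs and are omitted, as in the paper, without affecting generality. *)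

theory Defs
  imports
    Complex_Main
    "Jordan_Normal_Form.Matrix_Kernel"
    "Jordan_Normal_Form.DL_Submatrix"
begin

text \<open>
  Vectors and matrices carry their dimensions in the carrier sets, since the block sizes
  below depend on the dimensions of subspaces and may be zero.  All index sets are 0-based:
  the attack sets are subsets of \<^term>\<open>{..<n + p}\<close>.
\<close>

section \<open>Linear algebra\<close>

definition hcat :: "real mat \<Rightarrow> real mat \<Rightarrow> real mat" where
  "hcat M N = four_block_mat M N (0\<^sub>m 0 (dim_col M)) (0\<^sub>m 0 (dim_col N))"

definition col_sub :: "real mat \<Rightarrow> nat set \<Rightarrow> real mat" where
  "col_sub M K = submatrix M UNIV K"

definition sub_vec :: "real vec \<Rightarrow> nat set \<Rightarrow> real vec" where
  "sub_vec v K = vec (card {j. j < dim_vec v \<and> j \<in> K}) (\<lambda>i. v $ pick K i)"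

definition is_pinv :: "real mat \<Rightarrow> real mat \<Rightarrow> bool" where
  "is_pinv M X \<longleftrightarrow>
     X \<in> carrier_mat (dim_col M) (dim_row M) \<and>
     M * X * M = M \<and> X * M * X = X \<and>
     transpose_mat (M * X) = M * X \<and> transpose_mat (X * M) = X * M"

definition pinv :: "real mat \<Rightarrow> real mat" where
  "pinv M = (THE X. is_pinv M X)"

definition is_subspace :: "nat \<Rightarrow> real vec set \<Rightarrow> bool" where
  "is_subspace n S \<longleftrightarrow> VectorSpace.subspace class_ring S (module_vec TYPE(real) n)"

definition orth_compl :: "nat \<Rightarrow> real vec set \<Rightarrow> real vec set" where
  "orth_compl n S = {v \<in> carrier_vec n. \<forall>s\<in>S. v \<bullet> s = 0}"

definition preimage :: "real mat \<Rightarrow> real vec set \<Rightarrow> real vec set" where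
  "preimage E S = {x \<in> carrier_vec (dim_col E). E *\<^sub>v x \<in> S}"

text \<open>The Cartesian product of two sets of vectors, as stacked vectors.\<close>

definition stack :: "real vec set \<Rightarrow> real vec set \<Rightarrow> real vec set" where
  "stack X Y = {x @\<^sub>v y | x y. x \<in> X \<and> y \<in> Y}"

definition orthonormal_basis :: "nat \<Rightarrow> real vec set \<Rightarrow> real vec list \<Rightarrow> bool" where
  "orthonormal_basis n S bs \<longleftrightarrow>
     set bs \<subseteq> carrier_vec n \<and>
     (\<forall>i < length bs. \<forall>j < length bs. bs ! i \<bullet> bs ! j = (if i = j then 1 else 0)) \<and>
     LinearCombinations.module.span class_ring (module_vec TYPE(real) n) (set bs) = S"

text \<open>
  The matrix \<open>[Basis S  Basis S\<^sup>\<bottom>]\<close>, with \<open>k = dim S\<close>; it is unitary because both bases are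
  orthonormal.
\<close>

definition adapted_basis_mat :: "nat \<Rightarrow> real vec set \<Rightarrow> nat \<Rightarrow> real mat \<Rightarrow> bool" where
  "adapted_basis_mat n S k P \<longleftrightarrow>
     (\<exists>bs cs. orthonormal_basis n S bs \<and> orthonormal_basis n (orth_compl n S) cs \<and>
        length bs = k \<and> P = mat_of_cols n (bs @ cs))"

section \<open>Matrix pencils\<close>

definition cmat :: "real mat \<Rightarrow> complex mat" where
  "cmat M = map_mat complex_of_real M"

definition regular_pencil :: "real mat \<Rightarrow> real mat \<Rightarrow> bool" where
  "regular_pencil E A \<longleftrightarrow> (\<exists>s. det (s \<cdot>\<^sub>m cmat E - cmat A) \<noteq> 0)"

text \<open>
  Generalized eigenvalues are defined through eigenvectors, because the pencil of the
  filter need not be square.  For a square pencil \<open>(F, M)\<close> these are the roots of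
  \<open>det (s F - M)\<close>; in particular, every \<open>s\<close> is an eigenvalue of a singular pencil.
\<close>

definition gen_eigenvalue :: "real mat \<Rightarrow> real mat \<Rightarrow> complex \<Rightarrow> bool" where
  "gen_eigenvalue F M s \<longleftrightarrow>
     (\<exists>v \<in> carrier_vec (dim_col F). v \<noteq> 0\<^sub>v (dim_col F) \<and> cmat M *\<^sub>v v = s \<cdot>\<^sub>v (cmat F *\<^sub>v v))"

definition hurwitz_pencil :: "real mat \<Rightarrow> real mat \<Rightarrow> bool" where
  "hurwitz_pencil F M \<longleftrightarrow> (\<forall>s. gen_eigenvalue F M s \<longrightarrow> Re s < 0)"

section \<open>Signals and trajectories on the half line\<close>

text \<open>Signals are functions of a real variable; only their values at \<open>t \<ge> 0\<close> matter, and
  derivatives at 0 are one-sided.\<close>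

definition smooth_signal :: "nat \<Rightarrow> (real \<Rightarrow> real vec) \<Rightarrow> bool" where
  "smooth_signal m u \<longleftrightarrow>
     (\<forall>t \<ge> 0. u t \<in> carrier_vec m) \<and>
     (\<forall>i < m. \<exists>d :: nat \<Rightarrow> real \<Rightarrow> real.
        (\<forall>t \<ge> 0. d 0 t = u t $ i) \<and>
        (\<forall>k. \<forall>t \<ge> 0. (d k has_real_derivative d (Suc k) t) (at t within {0..})))"

definition has_signal_deriv :: "nat \<Rightarrow> (real \<Rightarrow> real vec) \<Rightarrow> (real \<Rightarrow> real vec) \<Rightarrow> bool" where
  "has_signal_deriv m x x' \<longleftrightarrow>
     (\<forall>t \<ge> 0. x t \<in> carrier_vec m \<and> x' t \<in> carrier_vec m \<and>
        (\<forall>i < m. ((\<lambda>\<tau>. x \<tau> $ i) has_real_derivative x' t $ i) (at t within {0..})))"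

text \<open>\<open>x\<close> solves \<open>F x' = M x + f\<close>, where \<open>F\<close> and \<open>M\<close> may be rectangular.\<close>

definition descriptor_solution ::
  "real mat \<Rightarrow> real mat \<Rightarrow> (real \<Rightarrow> real vec) \<Rightarrow> (real \<Rightarrow> real vec) \<Rightarrow> bool" where
  "descriptor_solution F M f x \<longleftrightarrow>
     (\<exists>x'. has_signal_deriv (dim_col F) x x' \<and> (\<forall>t \<ge> 0. F *\<^sub>v x' t = M *\<^sub>v x t + f t))"

section \<open>The plant, attacks and identifiability\<close>

definition B_mat :: "nat \<Rightarrow> nat \<Rightarrow> real mat" where
  "B_mat n p = hcat (1\<^sub>m n) (0\<^sub>m n p)"

definition D_mat :: "nat \<Rightarrow> nat \<Rightarrow> real mat" where
  "D_mat n p = hcat (0\<^sub>m p n) (1\<^sub>m p)"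

text \<open>Attackers indexed by \<open>R\<close>: exactly the entries of \<open>u\<close> in \<open>R\<close> are not identically zero.\<close>

definition attacked_exactly_on :: "nat \<Rightarrow> nat set \<Rightarrow> (real \<Rightarrow> real vec) \<Rightarrow> bool" where
  "attacked_exactly_on m R u \<longleftrightarrow> (\<forall>i < m. i \<in> R \<longleftrightarrow> (\<exists>t \<ge> 0. u t $ i \<noteq> 0))"

definition consistent_state ::
  "nat \<Rightarrow> nat \<Rightarrow> real mat \<Rightarrow> real mat \<Rightarrow> real vec \<Rightarrow> real vec \<Rightarrow> bool" where
  "consistent_state n p E A x0 u0 \<longleftrightarrow>
     A *\<^sub>v x0 + B_mat n p *\<^sub>v u0 \<in> orth_compl n (mat_kernel (transpose_mat E))"

text \<open>\<open>y = y(x0, u, \<cdot>)\<close>\<close>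

definition generates_output ::
  "nat \<Rightarrow> nat \<Rightarrow> real mat \<Rightarrow> real mat \<Rightarrow> real mat \<Rightarrow>
   real vec \<Rightarrow> (real \<Rightarrow> real vec) \<Rightarrow> (real \<Rightarrow> real vec) \<Rightarrow> bool" where
  "generates_output n p E A C x0 u y \<longleftrightarrow>
     (\<exists>x. descriptor_solution E A (\<lambda>t. B_mat n p *\<^sub>v u t) x \<and> x 0 = x0 \<and>
          (\<forall>t \<ge> 0. y t = C *\<^sub>v x t + D_mat n p *\<^sub>v u t))"

text \<open>Attack signals are smooth, which is the standing class of inputs.\<close>

definition unidentifiable ::
  "nat \<Rightarrow> nat \<Rightarrow> real mat \<Rightarrow> real mat \<Rightarrow> real mat \<Rightarrow> nat set \<Rightarrow> bool" where
  "unidentifiable n p E A C K \<longleftrightarrow>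
     (\<exists>R \<subseteq> {..<n + p}. card R \<le> card K \<and> R \<noteq> K \<and>
        (\<exists>xK \<in> carrier_vec n. \<exists>xR \<in> carrier_vec n. \<exists>uK uR yK yR.
           smooth_signal (n + p) uK \<and> attacked_exactly_on (n + p) K uK \<and>
           smooth_signal (n + p) uR \<and> attacked_exactly_on (n + p) R uR \<and>
           generates_output n p E A C xK uK yK \<and>
           generates_output n p E A C xR uR yR \<and>
           (\<forall>t \<ge> 0. yK t = yR t)))"

definition identifiable ::
  "nat \<Rightarrow> nat \<Rightarrow> real mat \<Rightarrow> real mat \<Rightarrow> real mat \<Rightarrow> nat set \<Rightarrow> bool" where
  "identifiable n p E A C K \<longleftrightarrow> \<not> unidentifiable n p E A C K"

section \<open>Data of the conditioned system\<close>

abbreviation B_sig :: "nat \<Rightarrow> nat \<Rightarrow> nat set \<Rightarrow> real mat" where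
  "B_sig n p K \<equiv> col_sub (B_mat n p) K"

abbreviation D_sig :: "nat \<Rightarrow> nat \<Rightarrow> nat set \<Rightarrow> real mat" where
  "D_sig n p K \<equiv> col_sub (D_mat n p) K"

definition A_hat :: "nat \<Rightarrow> nat \<Rightarrow> real mat \<Rightarrow> real mat \<Rightarrow> nat set \<Rightarrow> real mat" where
  "A_hat n p A C K = A - B_sig n p K * pinv (D_sig n p K) * C"

definition B_hat :: "nat \<Rightarrow> nat \<Rightarrow> nat set \<Rightarrow> real mat" where
  "B_hat n p K = B_sig n p K * (1\<^sub>m (card K) - pinv (D_sig n p K) * D_sig n p K)"

text \<open>\<open>I - D\<^sub>K D\<^sub>K\<^sup>\<dagger>\<close>\<close>

definition D_res :: "nat \<Rightarrow> nat \<Rightarrow> nat set \<Rightarrow> real mat" where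
  "D_res n p K = 1\<^sub>m p - D_sig n p K * pinv (D_sig n p K)"

definition C_hat :: "nat \<Rightarrow> nat \<Rightarrow> real mat \<Rightarrow> nat set \<Rightarrow> real mat" where
  "C_hat n p C K = D_res n p K * C"

definition S_equation ::
  "nat \<Rightarrow> nat \<Rightarrow> real mat \<Rightarrow> real mat \<Rightarrow> real mat \<Rightarrow> nat set \<Rightarrow> real vec set \<Rightarrow> bool" where
  "S_equation n p E A C K S \<longleftrightarrow>
     S = (\<lambda>z. hcat (A_hat n p A C K) (B_hat n p K) *\<^sub>v z) `
           (stack (preimage E S) (carrier_vec (card K)) \<inter>
            mat_kernel (hcat (C_hat n p C K) (0\<^sub>m p (card K))))"

definition is_S_star ::
  "nat \<Rightarrow> nat \<Rightarrow> real mat \<Rightarrow> real mat \<Rightarrow> real mat \<Rightarrow> nat set \<Rightarrow> real vec set \<Rightarrow> bool" where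
  "is_S_star n p E A C K S \<longleftrightarrow>
     is_subspace n S \<and> S_equation n p E A C K S \<and>
     (\<forall>T. is_subspace n T \<and> S_equation n p E A C K T \<longrightarrow> S \<subseteq> T)"

definition is_output_injection ::
  "nat \<Rightarrow> nat \<Rightarrow> real mat \<Rightarrow> real mat \<Rightarrow> real mat \<Rightarrow> nat set \<Rightarrow> real vec set \<Rightarrow> real mat \<Rightarrow> bool" where
  "is_output_injection n p E A C K S L \<longleftrightarrow>
     L \<in> carrier_mat n p \<and>
     (\<lambda>z. hcat (A_hat n p A C K + L * C_hat n p C K) (B_hat n p K) *\<^sub>v z) `
        stack (preimage E S) (carrier_vec (card K)) \<subseteq> S"

text \<open>
  The input matrix of the conditioned system for the candidate \<open>K\<close> when the attack set is
  \<open>R\<close>, before the change of coordinates; it equals \<^term>\<open>B_hat n p K\<close> if \<open>R = K\<close>.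
\<close>

definition cond_input :: "nat \<Rightarrow> nat \<Rightarrow> nat set \<Rightarrow> real mat \<Rightarrow> nat set \<Rightarrow> real mat" where
  "cond_input n p K L R =
     B_sig n p R - B_sig n p K * pinv (D_sig n p K) * D_sig n p R
       + L * D_res n p K * D_sig n p R"

end

theory Submission
  imports "HOL-Analysis.Henstock_Kurzweil_Integration" "Jordan_Normal_Form.Schur_Decomposition" Defs
begin

text \<open>
Write \<open>u\<^sub>R\<close> for the attack mode, \<open>B\<^sub>K, D\<^sub>K\<close> for the attack signature of \<open>K\<close> and
\<open>e = w\<^sub>2 - x\<^sub>2\<close> for the estimation error of the filter.

Suppose \<open>K = R\<close>.  The attack then enters the conditioned system only through the range of
\<open>B_hat n p K\<close>, which is contained in \<open>S\<close>.  So the second component of the state satisfies the autonomous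
equation \<open>E22 x\<^sub>2' = A22 x\<^sub>2\<close>, and the projection \<open>Pr\<close> removes the first component from the output.  The
filter is an observer of this subsystem, and its error satisfies \<open>E22 e' = (A22 + G Pr C2) e\<close> and
\<open>e(0) = 0\<close>.  The pencil of the filter has no eigenvalue at the point 1, so the equation has no
solution but zero (\<open>dae_homogeneous_zero\<close>), and the residual \<open>Pr C2 e\<close> vanishes.

Suppose conversely that the residual vanishes although \<open>K \<noteq> R\<close>.  An attack supported in \<open>K\<close> is constructed that
produces the same output as \<open>u\<^sub>R\<close>, contrary to the identifiability of \<open>R\<close>.  By linearity only a difference
\<open>d\<close> of two trajectories is needed: a solution of \<open>E d' = A d + B\<^sub>K v' - B\<^sub>R u\<^sub>R\<close> with
\<open>C d + D\<^sub>K v' - D\<^sub>R u\<^sub>R = 0\<close> can be added to any trajectory of the plant under \<open>u\<^sub>R\<close>, and such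
a trajectory exists because the pencil of the plant is regular (\<open>plant_difference_imp_unidentifiable\<close>).  As the difference has
no output, all output injections drop out of its equation, and it can be sought in the conditioned system
(\<open>conditioned_equation_imp_plant_equation\<close>).

The second component of \<open>d\<close> is \<open>e\<close>.  The trajectories \<open>x\<^sub>1, x\<^sub>2, w\<^sub>2\<close> need not be smooth, but
a vanishing residual gives \<open>e\<close> a differential-algebraic equation with the injective pencil of the filter and a smooth
forcing, so \<open>e\<close> is smooth (\<open>dae_solution_smooth\<close>).  The first component is chosen to make the output fit.
The resulting signal satisfies the state equation up to a smooth error with values in \<open>S\<close>, and this error can be
removed without changing the output (\<open>S_valued_forcing_absorbed\<close>).  Indeed, minimality of \<open>S\<close> means that
each of its vectors is obtained from zero by finitely many steps \<open>s \<mapsto> A x + B v\<close> with \<open>E x = s\<close> and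
\<open>C x = 0\<close>, for the matrices of the conditioned system; a forcing \<open>g(t) (A x + B v)\<close> is cancelled by the
state \<open>- g(t) x\<close> and the input \<open>- g(t) v\<close> at the price of the forcing \<open>g'(t) s\<close>, which lies one step
closer to zero.

The equations \<open>F x' = M x + f\<close> that occur here are reduced to scalar ones.  If \<open>N (s F - M) = I\<close>, then \<open>T = N F\<close>
satisfies \<open>T x' = (s T - I) x + N f\<close>.  In coordinates in which \<open>T\<close> is upper triangular, each row is a scalar
differential equation if the diagonal entry of \<open>T\<close> is nonzero and an algebraic equation otherwise.
\<close>

(* From here on the dollar and bullet signs denote the operations on vectors with explicit dimension. *)
unbundle no vec_syntax and no inner_syntax

section \<open>Matrices and vectors with explicit dimensions\<close>

text \<open>
Premises about dimensions, unlike membership in carrier sets, contain no variable that is absent from the conclusion.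
So the simplifier can discharge them, and products with vectors can be expanded by rewriting.
\<close>

lemma mat_assoc:
  "dim_col A = dim_row B \<Longrightarrow> dim_col B = dim_row C \<Longrightarrow> A * B * C = A * (B * C)"
  for A B C :: "'a::semiring_0 mat"
  by (rule assoc_mult_mat[of A "dim_row A" "dim_row B" B "dim_row C" C "dim_col C"]) auto

lemma mat_vec_assoc:
  "dim_col A = dim_row B \<Longrightarrow> dim_col B = dim_vec v \<Longrightarrow> A * B *\<^sub>v v = A *\<^sub>v (B *\<^sub>v v)"
  for A B :: "'a::semiring_0 mat"
  by (rule assoc_mult_mat_vec[of A "dim_row A" "dim_row B" B "dim_vec v"]) auto

lemma transpose_mat_mult:
  "dim_col A = dim_row B \<Longrightarrow> transpose_mat (A * B) = transpose_mat B * transpose_mat A"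
  for A B :: "'a::comm_semiring_0 mat"
  by (rule transpose_mult[of A "dim_row A" "dim_row B" B "dim_col B"]) auto

lemma mult_vec_add:
  "dim_vec v = dim_col M \<Longrightarrow> dim_vec w = dim_col M \<Longrightarrow> M *\<^sub>v (v + w) = M *\<^sub>v v + M *\<^sub>v w"
  for M :: "'a::ring mat"
  by (rule mult_add_distrib_mat_vec[of M "dim_row M" "dim_col M"]) (rule carrier_matI[OF refl refl], (rule carrier_vecI, assumption)+)

lemma mult_vec_diff:
  "dim_vec v = dim_col M \<Longrightarrow> dim_vec w = dim_col M \<Longrightarrow> M *\<^sub>v (v - w) = M *\<^sub>v v - M *\<^sub>v w"
  for M :: "'a::ring mat"
  by (rule mult_minus_distrib_mat_vec[of M "dim_row M" "dim_col M"]) (rule carrier_matI[OF refl refl], (rule carrier_vecI, assumption)+)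

lemma mult_vec_smult:
  "dim_vec v = dim_col M \<Longrightarrow> M *\<^sub>v (c \<cdot>\<^sub>v v) = c \<cdot>\<^sub>v (M *\<^sub>v v)"
  for M :: "'a::field mat"
  by (rule mult_mat_vec[of M "dim_row M" "dim_col M"]) (rule carrier_matI[OF refl refl], (rule carrier_vecI, assumption)+)

lemma mat_add_mult_vec:
  "dim_row M = dim_row M' \<Longrightarrow> dim_col M = dim_vec v \<Longrightarrow> dim_col M' = dim_vec v \<Longrightarrow>
    (M + M') *\<^sub>v v = M *\<^sub>v v + M' *\<^sub>v v"
  for M :: "'a::ring mat"
  by (rule add_mult_distrib_mat_vec[of M "dim_row M" "dim_col M"]) auto

lemma mat_diff_mult_vec:
  "dim_row M = dim_row M' \<Longrightarrow> dim_col M = dim_vec v \<Longrightarrow> dim_col M' = dim_vec v \<Longrightarrow>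
    (M - M') *\<^sub>v v = M *\<^sub>v v - M' *\<^sub>v v"
  for M :: "'a::ring mat"
  by (rule minus_mult_distrib_mat_vec[of M "dim_row M" "dim_col M"]) auto

lemma mult_vec_component:
  "dim_vec v = dim_col M \<Longrightarrow> i < dim_row M \<Longrightarrow> (M *\<^sub>v v) $ i = (\<Sum>j<dim_col M. M $$ (i, j) * v $ j)"
  by (simp add: scalar_prod_def atLeast0LessThan)

lemma one_mat_mult_vec: "dim_vec v = n \<Longrightarrow> 1\<^sub>m n *\<^sub>v v = v"
  for v :: "'a::semiring_1 vec"
  by (rule one_mult_mat_vec) (rule carrier_vecI)

lemma zero_mat_mult_vec: "dim_vec v = q \<Longrightarrow> 0\<^sub>m p q *\<^sub>v v = 0\<^sub>v p"
  for v :: "real vec"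
  by (rule eq_vecI) (auto simp: mult_vec_component simp del: index_mult_mat_vec)

lemma mult_zero_vec_eq: "dim_col M = n \<Longrightarrow> M *\<^sub>v 0\<^sub>v n = 0\<^sub>v (dim_row M)"
  for M :: "real mat"
  by (rule eq_vecI) (auto simp: mult_vec_component simp del: index_mult_mat_vec)

lemma smult_zero_vec_eq: "c \<cdot>\<^sub>v 0\<^sub>v n = 0\<^sub>v n"
  for c :: real
  by (rule eq_vecI) auto

lemma zero_vec_simps:
  fixes v :: "real vec"
  assumes "dim_vec v = n"
  shows "0\<^sub>v n + v = v" "v + 0\<^sub>v n = v" "v - 0\<^sub>v n = v" "v - v = 0\<^sub>v n"
  by (rule eq_vecI; use assms in simp)+

lemma minus_vec_eq_add_uminus:
  fixes v w :: "real vec"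
  shows "dim_vec v = dim_vec w \<Longrightarrow> v - w = v + - w"
  by (rule eq_vecI) auto

section \<open>Generalized inverses\<close>

lemma vec_minus_eq_zero_iff:
  fixes v w :: "'a::ab_group_add vec"
  assumes "v \<in> carrier_vec n" "w \<in> carrier_vec n"
  shows "v - w = 0\<^sub>v n \<longleftrightarrow> v = w"
proof
  assume 0: "v - w = 0\<^sub>v n"
  show "v = w"
  proof (rule eq_vecI)
    fix i assume "i < dim_vec w"
    then have i: "i < n" using assms by simp
    then have "(v - w) $ i = 0" using 0 by simp
    then show "v $ i = w $ i" using i assms by simp
  qed (use assms in simp)
qed (use assms in auto)

lemma mult_unit_vec:
  fixes M :: "'a::comm_semiring_1 mat"
  assumes "M \<in> carrier_mat r m" "j < m"
  shows "M *\<^sub>v unit_vec m j = col M j"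
  by (rule eq_vecI) (use assms in auto)

lemma outer_product_mult_vec:
  fixes w y v :: "'a::comm_semiring_0 vec"
  assumes "w \<in> carrier_vec m" "y \<in> carrier_vec r" "v \<in> carrier_vec r"
  shows "mat m r (\<lambda>(a, b). w $ a * y $ b) *\<^sub>v v = (y \<bullet> v) \<cdot>\<^sub>v w"
proof (rule eq_vecI)
  fix i assume "i < dim_vec ((y \<bullet> v) \<cdot>\<^sub>v w)"
  then have i: "i < m" using assms by simp
  have "(mat m r (\<lambda>(a, b). w $ a * y $ b) *\<^sub>v v) $ i = (\<Sum>b = 0..<r. w $ i * y $ b * v $ b)"
    using i assms by (simp add: scalar_prod_def)
  also have "\<dots> = w $ i * (\<Sum>b = 0..<r. y $ b * v $ b)"
    by (simp add: sum_distrib_left mult.assoc)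
  also have "\<dots> = ((y \<bullet> v) \<cdot>\<^sub>v w) $ i"
    using i assms by (simp add: scalar_prod_def mult.commute)
  finally show "(mat m r (\<lambda>(a, b). w $ a * y $ b) *\<^sub>v v) $ i = ((y \<bullet> v) \<cdot>\<^sub>v w) $ i" .
qed (use assms in auto)

text \<open>
The inverse is built column by column, each step being a rank-one update.
\<close>

lemma exists_generalized_inverse:
  fixes M :: "'a::field mat"
  assumes M: "M \<in> carrier_mat r m"
  shows "\<exists>X \<in> carrier_mat m r. M * X * M = M"
proof -
  have "\<exists>X \<in> carrier_mat m r. \<forall>j<k. M *\<^sub>v (X *\<^sub>v col M j) = col M j" if "k \<le> m" for k
    using that
  proof (induct k)
    case 0
    show ?case by (rule bexI[of _ "0\<^sub>m m r"]) auto
  next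
    case (Suc k)
    then obtain X where X: "X \<in> carrier_mat m r"
      and IH: "\<And>j. j < k \<Longrightarrow> M *\<^sub>v (X *\<^sub>v col M j) = col M j" by auto
    define c where "c = col M k"
    define \<rho> where "\<rho> = c - M *\<^sub>v (X *\<^sub>v c)"
    have c: "c \<in> carrier_vec r" using M by (simp add: c_def carrier_vecI)
    then have \<rho>: "\<rho> \<in> carrier_vec r" using M X by (simp add: \<rho>_def)
    show ?case
    proof (cases "\<rho> = 0\<^sub>v r")
      case True
      then have "M *\<^sub>v (X *\<^sub>v c) = c"
        using c M X vec_minus_eq_zero_iff[of c r "M *\<^sub>v (X *\<^sub>v c)"] unfolding \<rho>_def by auto
      then show ?thesis using IH X less_Suc_eq c_def by (intro bexI[of _ X]) auto
    next
      case False
      then obtain i where i: "i < r" "\<rho> $ i \<noteq> 0"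
        using \<rho> by (metis carrier_vecD eq_vecI index_zero_vec)
      \<comment> \<open>\<open>y\<close> is a functional that vanishes on the columns before \<open>k\<close> and takes the value 1 on \<open>c\<close>, so
        adding \<open>w y\<^sup>T\<close> repairs column \<open>k\<close> and leaves the earlier ones alone\<close>
      define y where "y = (1 / \<rho> $ i) \<cdot>\<^sub>v row (1\<^sub>m r - M * X) i"
      define w where "w = unit_vec m k - X *\<^sub>v c"
      define X' where "X' = X + mat m r (\<lambda>(a, b). w $ a * y $ b)"
      have MX: "M * X \<in> carrier_mat r r" using M X by simp
      have y: "y \<in> carrier_vec r" using M X by (simp add: y_def carrier_vecI)
      have w: "w \<in> carrier_vec m" using X c by (simp add: w_def)
      have X': "X' \<in> carrier_mat m r" using X by (simp add: X'_def)
      have y_apply: "y \<bullet> v = (v - M *\<^sub>v (X *\<^sub>v v)) $ i / \<rho> $ i" if v: "v \<in> carrier_vec r" for v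
      proof -
        have "row (1\<^sub>m r - M * X) i \<bullet> v = ((1\<^sub>m r - M * X) *\<^sub>v v) $ i"
          using i MX M by simp
        also have "(1\<^sub>m r - M * X) *\<^sub>v v = v - M *\<^sub>v (X *\<^sub>v v)"
          using v M X MX by (simp add: minus_mult_distrib_mat_vec[of _ r r])
        finally show ?thesis
          unfolding y_def by (subst smult_scalar_prod_distrib[of _ r]) (use v M X in \<open>auto intro: carrier_vecI\<close>)
      qed
      have Mw: "M *\<^sub>v w = \<rho>"
      using M X c Suc.prems unfolding w_def \<rho>_def
      by (subst mult_minus_distrib_mat_vec[of _ r m]) (auto simp: c_def mult_unit_vec[OF M])
      have step: "M *\<^sub>v (X' *\<^sub>v v) = M *\<^sub>v (X *\<^sub>v v) + (y \<bullet> v) \<cdot>\<^sub>v \<rho>" if v: "v \<in> carrier_vec r" for v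
      proof -
        have "X' *\<^sub>v v = X *\<^sub>v v + (y \<bullet> v) \<cdot>\<^sub>v w"
          unfolding X'_def using outer_product_mult_vec[OF w y v] X v
          by (simp add: add_mult_distrib_mat_vec[of _ m r])
        then show ?thesis using M X v w Mw
          by (simp add: mult_add_distrib_mat_vec[of _ r m] mult_mat_vec)
      qed
      have "M *\<^sub>v (X' *\<^sub>v col M j) = col M j" if j: "j < Suc k" for j
      proof (cases "j = k")
        case True
        have "y \<bullet> c = 1" using y_apply[OF c] i by (simp add: \<rho>_def)
        then have "M *\<^sub>v (X' *\<^sub>v c) = M *\<^sub>v (X *\<^sub>v c) + (c - M *\<^sub>v (X *\<^sub>v c))"
          using step[OF c] \<rho> by (simp add: \<rho>_def)
        also have "\<dots> = c" using c M X by auto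
        finally show ?thesis using True by (simp add: c_def)
      next
        case False
        then have jk: "j < k" using j by simp
        have cj: "col M j \<in> carrier_vec r" using M by (simp add: carrier_vecI)
        have "y \<bullet> col M j = 0" using y_apply[OF cj] i cj M IH[OF jk] by simp
        then show ?thesis unfolding step[OF cj] IH[OF jk]
          by (intro eq_vecI) (use \<rho> cj M in auto)
      qed
      then show ?thesis using X' by blast
    qed
  qed
  from this[of m] obtain X where X: "X \<in> carrier_mat m r"
    and cols: "\<And>j. j < m \<Longrightarrow> M *\<^sub>v (X *\<^sub>v col M j) = col M j" by auto
  have "M * X * M = M"
  proof (rule mat_col_eqI)
    fix j assume "j < dim_col M"
    then have j: "j < m" using M by simp
    show "col (M * X * M) j = col M j"
      using cols[OF j] j M X by (subst col_mult2[of _ r r _ m]) (auto simp: mat_vec_assoc)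
  qed (use M X in auto)
  then show ?thesis using X by blast
qed

lemma left_inverse_if_injective:
  fixes J :: "'a::field mat"
  assumes J: "J \<in> carrier_mat r m"
    and inj: "\<And>v. v \<in> carrier_vec m \<Longrightarrow> J *\<^sub>v v = 0\<^sub>v r \<Longrightarrow> v = 0\<^sub>v m"
  shows "\<exists>N \<in> carrier_mat m r. N * J = 1\<^sub>m m"
proof -
  obtain N where N: "N \<in> carrier_mat m r" and JNJ: "J * N * J = J"
    using exists_generalized_inverse[OF J] by blast
  have "N * J = 1\<^sub>m m"
  proof (rule mat_col_eqI)
    fix j assume "j < dim_col (1\<^sub>m m :: 'a mat)"
    then have j: "j < m" by simp
    have "J *\<^sub>v (N *\<^sub>v (J *\<^sub>v unit_vec m j)) = J *\<^sub>v unit_vec m j"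
      using arg_cong[OF JNJ, of "\<lambda>Z. Z *\<^sub>v unit_vec m j"] J N by (simp add: mat_vec_assoc)
    then have "J *\<^sub>v (N *\<^sub>v (J *\<^sub>v unit_vec m j) - unit_vec m j) = 0\<^sub>v r"
      using J N by (subst mult_minus_distrib_mat_vec[of _ r m]) auto
    then have 0: "N *\<^sub>v (J *\<^sub>v unit_vec m j) - unit_vec m j = 0\<^sub>v m"
      by (intro inj) (use J N in auto)
    then have "N *\<^sub>v (J *\<^sub>v unit_vec m j) = unit_vec m j"
      using J N vec_minus_eq_zero_iff[of "N *\<^sub>v (J *\<^sub>v unit_vec m j)" m "unit_vec m j"] by auto
    then show "col (N * J) j = col (1\<^sub>m m) j"
      using j mult_unit_vec[OF J j] by (subst col_mult2[OF N J j]) auto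
  qed (use J N in auto)
  then show ?thesis using N by blast
qed

section \<open>The Moore--Penrose pseudoinverse\<close>

lemma gram_eq_zero_imp_zero:
  fixes Z :: "real mat"
  assumes Z: "Z \<in> carrier_mat r m" and 0: "transpose_mat Z * Z = 0\<^sub>m m m"
  shows "Z = 0\<^sub>m r m"
proof (rule eq_matI)
  fix i j assume "i < dim_row (0\<^sub>m r m :: real mat)" "j < dim_col (0\<^sub>m r m :: real mat)"
  then have ij: "i < r" "j < m" by auto
  have "(transpose_mat Z * Z) $$ (j, j) = (\<Sum>a = 0..<r. Z $$ (a, j) * Z $$ (a, j))"
    using Z ij by (simp add: scalar_prod_def)
  then have "(\<Sum>a = 0..<r. Z $$ (a, j) * Z $$ (a, j)) = 0" using 0 ij by simp
  then have "\<forall>a \<in> {0..<r}. Z $$ (a, j) * Z $$ (a, j) = 0"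
    by (subst (asm) sum_nonneg_eq_0_iff) auto
  then show "Z $$ (i, j) = 0\<^sub>m r m $$ (i, j)" using ij by auto
qed (use Z in auto)

text \<open>
The reason is that \<open>M\<^sup>T M Y = 0\<close> forces \<open>(M Y)\<^sup>T (M Y) = 0\<close>.
\<close>

lemma gram_cancel:
  fixes M Y Z :: "real mat"
  assumes M: "M \<in> carrier_mat r m" and Y: "Y \<in> carrier_mat m c" and Z: "Z \<in> carrier_mat m c"
    and eq: "transpose_mat M * (M * Y) = transpose_mat M * (M * Z)"
  shows "M * Y = M * Z"
proof -
  let ?D = "M * (Y - Z)"
  have D: "?D \<in> carrier_mat r c" and YZ: "Y - Z \<in> carrier_mat m c" using M Y Z by auto
  have Deq: "?D = M * Y - M * Z" using M Y Z by (simp add: mult_minus_distrib_mat)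
  have "transpose_mat M * ?D = transpose_mat M * (M * Y) - transpose_mat M * (M * Z)"
    unfolding Deq by (rule mult_minus_distrib_mat[of _ m r _ c]) (use M Y Z in auto)
  also have "\<dots> = 0\<^sub>m m c" unfolding eq using M Z by auto
  finally have MD: "transpose_mat M * ?D = 0\<^sub>m m c" .
  have "transpose_mat ?D * ?D = transpose_mat (Y - Z) * (transpose_mat M * ?D)"
    using M YZ D by (simp add: transpose_mult[of M r m] assoc_mult_mat[of _ c m _ r _ c])
  also have "\<dots> = 0\<^sub>m c c" unfolding MD using Y Z by auto
  finally have "?D = 0\<^sub>m r c" using gram_eq_zero_imp_zero[OF D] by simp
  then have 0: "M * Y - M * Z = 0\<^sub>m r c" using Deq by simp
  show ?thesis
  proof (rule eq_matI)
    fix i j assume "i < dim_row (M * Z)" "j < dim_col (M * Z)"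
    then have ij: "i < r" "j < c" using M Z by auto
    have "(M * Y - M * Z) $$ (i, j) = 0" using 0 ij by simp
    then show "(M * Y) $$ (i, j) = (M * Z) $$ (i, j)" using ij M Y Z by simp
  qed (use M Y Z in auto)
qed

text \<open>
If \<open>g\<close> is a generalized inverse of \<open>M\<^sup>T M\<close>, then \<open>M (g M\<^sup>T)\<close> is the orthogonal projector onto
the range of \<open>M\<close>.  It is symmetric even if \<open>g\<close> is not, since \<open>g\<^sup>T\<close> is another generalized inverse of
\<open>M\<^sup>T M\<close>.
\<close>

lemma exists_symmetric_generalized_inverse:
  fixes M :: "real mat"
  assumes M: "M \<in> carrier_mat r m"
  shows "\<exists>X \<in> carrier_mat m r. M * X * M = M \<and> transpose_mat (M * X) = M * X"
proof -
  let ?T = "transpose_mat M"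
  note dims = carrier_matD[OF M]
  obtain g where g: "g \<in> carrier_mat m m" and MgM: "?T * M * g * (?T * M) = ?T * M"
    using exists_generalized_inverse[of "?T * M" m m] M by auto
  note dims = dims carrier_matD[OF g]
  have cancel: "M * (h * (?T * M)) = M" if h: "h \<in> carrier_mat m m"
      and eq: "?T * M * h * (?T * M) = ?T * M" for h
  proof -
    have "?T * (M * (h * (?T * M))) = ?T * (M * 1\<^sub>m m)"
      using eq h M by (simp add: mat_assoc)
    then have "M * (h * (?T * M)) = M * 1\<^sub>m m"
      by (intro gram_cancel[OF M]) (use h M in auto)
    then show ?thesis using M by simp
  qed
  have Mg: "M * (g * (?T * M)) = M" by (rule cancel[OF g MgM])
  have "?T * M * transpose_mat g * (?T * M) = ?T * M"
    using arg_cong[OF MgM, of transpose_mat] by (simp add: dims transpose_mat_mult mat_assoc)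
  then have Mgt: "M * (transpose_mat g * (?T * M)) = M" by (intro cancel) (use g in auto)
  have TMg: "?T * (M * (g * ?T)) = ?T"
    using arg_cong[OF Mgt, of transpose_mat] by (simp add: dims transpose_mat_mult mat_assoc)
  let ?X = "g * ?T"
  have "M * ?X * M = M" using Mg by (simp add: dims mat_assoc)
  moreover have "transpose_mat (M * ?X) = M * ?X"
  proof -
    have sym: "transpose_mat (M * ?X) * (M * ?X) = transpose_mat (M * ?X)"
      using TMg by (simp add: dims transpose_mat_mult mat_assoc)
    show ?thesis
      using arg_cong[OF sym, of transpose_mat] sym by (simp add: dims transpose_mat_mult mat_assoc)
  qed
  ultimately show ?thesis using g M by (intro bexI[of _ ?X]) auto
qed

text \<open>
If \<open>X\<close> and \<open>Z\<close> are generalized inverses of \<open>M\<close> and \<open>M\<^sup>T\<close> for which \<open>M X\<close> and \<open>M\<^sup>T Z\<close>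
are symmetric, then the pseudoinverse is \<open>Z\<^sup>T M X\<close>.
\<close>

lemma is_pinv_exists: "\<exists>X. is_pinv M X"
proof -
  define r m where "r = dim_row M" and "m = dim_col M"
  have M: "M \<in> carrier_mat r m" by (simp add: r_def m_def)
  obtain X where X: "X \<in> carrier_mat m r" and MXM: "M * X * M = M" and sX: "transpose_mat (M * X) = M * X"
    using exists_symmetric_generalized_inverse[OF M] by blast
  obtain Z where Z: "Z \<in> carrier_mat r m"
    and TZT: "transpose_mat M * Z * transpose_mat M = transpose_mat M"
    and sZ: "transpose_mat (transpose_mat M * Z) = transpose_mat M * Z"
    using exists_symmetric_generalized_inverse[of "transpose_mat M" m r] M by auto
  define Y where "Y = transpose_mat Z"
  have Y: "Y \<in> carrier_mat m r" using Z by (simp add: Y_def)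
  note dims = carrier_matD[OF M] carrier_matD[OF X] carrier_matD[OF Y] carrier_matD[OF Z]
  have MYM: "M * (Y * M) = M"
    using arg_cong[OF TZT, of transpose_mat] by (simp add: dims transpose_mat_mult mat_assoc Y_def)
  have sY: "transpose_mat (Y * M) = Y * M"
    using sZ by (simp add: dims transpose_mat_mult mat_assoc Y_def)
  let ?P = "Y * M * X"
  have MP: "M * ?P = M * X"
    using arg_cong[OF MYM, of "\<lambda>A. A * X"] by (simp add: dims mat_assoc)
  have PM: "?P * M = Y * M"
    using MXM by (simp add: dims mat_assoc)
  have "is_pinv M ?P"
    unfolding is_pinv_def
  proof (intro conjI)
    show "?P \<in> carrier_mat (dim_col M) (dim_row M)" using M X Y by simp
    show "M * ?P * M = M" unfolding MP by (rule MXM)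
    show "?P * M * ?P = ?P" unfolding PM using MP by (simp add: dims mat_assoc)
    show "transpose_mat (M * ?P) = M * ?P" unfolding MP by (rule sX)
    show "transpose_mat (?P * M) = ?P * M" unfolding PM by (rule sY)
  qed
  then show ?thesis by blast
qed

lemma is_pinv_unique:
  assumes X: "is_pinv M X" and Y: "is_pinv M Y"
  shows "X = Y"
proof -
  have dims: "dim_row X = dim_col M" "dim_col X = dim_row M" "dim_row Y = dim_col M" "dim_col Y = dim_row M"
    and MXM: "M * X * M = M" and XMX: "X * M * X = X" and sMX: "transpose_mat (M * X) = M * X"
    and sXM: "transpose_mat (X * M) = X * M"
    and MYM: "M * Y * M = M" and YMY: "Y * M * Y = Y" and sMY: "transpose_mat (M * Y) = M * Y"
    and sYM: "transpose_mat (Y * M) = Y * M"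
    using X Y by (auto simp: is_pinv_def)
  \<comment> \<open>\<open>M X\<close> and \<open>M Y\<close> are both the orthogonal projector onto the range of \<open>M\<close>\<close>
  have "M * X = (M * Y) * (M * X)"
    using arg_cong[OF MYM, of "\<lambda>A. A * X"] by (simp add: dims mat_assoc)
  also have "\<dots> = transpose_mat (M * X * (M * Y))"
    using transpose_mat_mult[of "M * X" "M * Y"] sMX sMY by (simp add: dims)
  also have "M * X * (M * Y) = M * Y"
    using arg_cong[OF MXM, of "\<lambda>A. A * Y"] by (simp add: dims mat_assoc)
  finally have a: "M * X = M * Y" using sMY by simp
  have "X * M = (X * M) * (Y * M)"
    using MYM by (simp add: dims mat_assoc)
  also have "\<dots> = transpose_mat (Y * M * (X * M))"
    using transpose_mat_mult[of "Y * M" "X * M"] sXM sYM by (simp add: dims)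
  also have "Y * M * (X * M) = Y * M"
    using MXM by (simp add: dims mat_assoc)
  finally have b: "X * M = Y * M" using sYM by simp
  have "X = Y * M * X" using XMX b by simp
  also have "\<dots> = Y * (M * Y)" using a by (simp add: dims mat_assoc)
  also have "\<dots> = Y" using YMY by (simp add: dims mat_assoc)
  finally show ?thesis .
qed

lemma is_pinv_pinv: "is_pinv M (pinv M)"
proof -
  obtain X where "is_pinv M X" using is_pinv_exists by blast
  then show ?thesis unfolding pinv_def by (metis is_pinv_unique theI)
qed

lemma
  assumes "M \<in> carrier_mat r m"
  shows pinv_carrier: "pinv M \<in> carrier_mat m r"
    and mult_pinv_mult: "M * pinv M * M = M"
  using is_pinv_pinv[of M] assms by (auto simp: is_pinv_def)

section \<open>Smooth functions on the half line\<close>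

definition half_line_deriv :: "(real \<Rightarrow> 'a::real_normed_vector) \<Rightarrow> (real \<Rightarrow> 'a) \<Rightarrow> bool" where
  "half_line_deriv f f' \<longleftrightarrow> (\<forall>t \<ge> 0. (f has_vector_derivative f' t) (at t within {0..}))"

text \<open>
The notion of smoothness in \<^const>\<open>smooth_signal\<close>, for values in any normed space: the triangular systems below
have complex coefficients.
\<close>

definition smooth_fun :: "(real \<Rightarrow> 'a::real_normed_vector) \<Rightarrow> bool" where
  "smooth_fun f \<longleftrightarrow> (\<exists>d. (\<forall>t \<ge> 0. d 0 t = f t) \<and> (\<forall>k. half_line_deriv (d k) (d (Suc k))))"

lemma half_line_deriv_cong:
  assumes "half_line_deriv f f'" "\<And>t. t \<ge> 0 \<Longrightarrow> g t = f t" "\<And>t. t \<ge> 0 \<Longrightarrow> g' t = f' t"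
  shows "half_line_deriv g g'"
  using assms unfolding half_line_deriv_def
  by (auto intro!: has_vector_derivative_transform[of _ "{0..}" g f])

text \<open>
This holds at \<open>t = 0\<close> too, since no point of the half line is isolated in it.
\<close>

lemma half_line_deriv_unique:
  assumes "half_line_deriv f f'" "half_line_deriv f f''" "t \<ge> 0"
  shows "f' t = f'' t"
proof -
  have "{0..} \<noteq> {a}" for a :: real
  proof
    assume "{0..} = {a}"
    then have "0 \<in> {a}" "1 \<in> {a}" by (metis atLeast_iff order_refl zero_le_one)+
    then show False by simp
  qed
  then have "t islimpt {0..}" using assms(3) by (intro connected_imp_perfect) auto
  then have "at t within {0..} \<noteq> bot" by (simp add: trivial_limit_within)
  then show ?thesis using assms vector_derivative_unique_within unfolding half_line_deriv_def by blast
qed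

lemma half_line_deriv_bounded_linear:
  assumes "bounded_linear h" "half_line_deriv f f'"
  shows "half_line_deriv (\<lambda>t. h (f t)) (\<lambda>t. h (f' t))"
  using assms unfolding half_line_deriv_def by (auto intro: bounded_linear.has_vector_derivative)

lemma half_line_deriv_add:
  assumes "half_line_deriv f f'" "half_line_deriv g g'"
  shows "half_line_deriv (\<lambda>t. f t + g t) (\<lambda>t. f' t + g' t)"
  using assms unfolding half_line_deriv_def by (auto intro: has_vector_derivative_add)

lemma half_line_deriv_const: "half_line_deriv (\<lambda>t. c) (\<lambda>t. 0)"
  unfolding half_line_deriv_def by auto

lemma half_line_deriv_sum:
  assumes "\<And>i. i \<in> I \<Longrightarrow> half_line_deriv (f i) (f' i)"
  shows "half_line_deriv (\<lambda>t. \<Sum>i\<in>I. f i t) (\<lambda>t. \<Sum>i\<in>I. f' i t)"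
  using assms unfolding half_line_deriv_def by (auto intro: has_vector_derivative_sum)

lemma smooth_fun_cong:
  assumes "smooth_fun f" "\<And>t. t \<ge> 0 \<Longrightarrow> g t = f t"
  shows "smooth_fun g"
  using assms unfolding smooth_fun_def by metis

lemma smooth_fun_imp_deriv:
  assumes "smooth_fun f"
  shows "\<exists>f'. smooth_fun f' \<and> half_line_deriv f f'"
proof -
  obtain d where d0: "\<And>t. t \<ge> 0 \<Longrightarrow> d 0 t = f t" and d: "\<And>k. half_line_deriv (d k) (d (Suc k))"
    using assms unfolding smooth_fun_def by metis
  have "smooth_fun (d 1)"
    unfolding smooth_fun_def by (rule exI[of _ "\<lambda>k. d (Suc k)"]) (use d in auto)
  moreover have "half_line_deriv f (d 1)"
    using half_line_deriv_cong[OF d[of 0]] d0 by simp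
  ultimately show ?thesis by blast
qed

lemma smooth_fun_deriv:
  assumes "smooth_fun f" "half_line_deriv f f'"
  shows "smooth_fun f'"
  using assms smooth_fun_imp_deriv smooth_fun_cong half_line_deriv_unique by metis

lemma smooth_fun_bounded_linear:
  assumes h: "bounded_linear h" and f: "smooth_fun f"
  shows "smooth_fun (\<lambda>t. h (f t))"
proof -
  obtain d where d0: "\<And>t. t \<ge> 0 \<Longrightarrow> d 0 t = f t" and d: "\<And>k. half_line_deriv (d k) (d (Suc k))"
    using f unfolding smooth_fun_def by metis
  show ?thesis unfolding smooth_fun_def
    by (rule exI[of _ "\<lambda>k t. h (d k t)"]) (use d0 half_line_deriv_bounded_linear[OF h d] in auto)
qed

lemma smooth_fun_add:
  assumes f: "smooth_fun f" and g: "smooth_fun g"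
  shows "smooth_fun (\<lambda>t. f t + g t)"
proof -
  obtain d where d: "\<And>t. t \<ge> 0 \<Longrightarrow> d 0 t = f t" "\<And>k. half_line_deriv (d k) (d (Suc k))"
    using f unfolding smooth_fun_def by metis
  obtain e where e: "\<And>t. t \<ge> 0 \<Longrightarrow> e 0 t = g t" "\<And>k. half_line_deriv (e k) (e (Suc k))"
    using g unfolding smooth_fun_def by metis
  show ?thesis unfolding smooth_fun_def
    by (rule exI[of _ "\<lambda>k t. d k t + e k t"]) (use d(1) e(1) half_line_deriv_add[OF d(2) e(2)] in auto)
qed

lemma smooth_fun_zero: "smooth_fun (\<lambda>t. 0)"
  unfolding smooth_fun_def by (rule exI[of _ "\<lambda>k t. 0"]) (auto simp: half_line_deriv_const)

lemma smooth_fun_sum: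
  assumes "\<And>i. i \<in> I \<Longrightarrow> smooth_fun (f i)"
  shows "smooth_fun (\<lambda>t. \<Sum>i\<in>I. f i t)"
  using assms
proof (induct I rule: infinite_finite_induct)
  case (insert i I)
  then show ?case using smooth_fun_add[of "f i" "\<lambda>t. \<Sum>i\<in>I. f i t"] by simp
qed (simp_all add: smooth_fun_zero)

lemma smooth_fun_mult_left: "smooth_fun f \<Longrightarrow> smooth_fun (\<lambda>t. c * f t)"
  for f :: "real \<Rightarrow> 'a::real_normed_algebra"
  by (rule smooth_fun_bounded_linear[OF bounded_linear_mult_right])

lemma half_line_deriv_mult_left: "half_line_deriv f f' \<Longrightarrow> half_line_deriv (\<lambda>t. c * f t) (\<lambda>t. c * f' t)"
  for f :: "real \<Rightarrow> 'a::real_normed_algebra"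
  by (rule half_line_deriv_bounded_linear[OF bounded_linear_mult_right])

section \<open>Scalar differential and algebraic equations\<close>

lemma linear_ode_solution_smooth:
  fixes z :: "real \<Rightarrow> complex"
  assumes z: "half_line_deriv z (\<lambda>t. a * z t + h t)" and h: "smooth_fun h"
  shows "smooth_fun z"
proof -
  obtain e where e: "\<And>t. t \<ge> 0 \<Longrightarrow> e 0 t = h t" "\<And>k. half_line_deriv (e k) (e (Suc k))"
    using h unfolding smooth_fun_def by metis
  \<comment> \<open>differentiating \<open>z' = a z + h\<close> repeatedly produces the higher derivatives of \<open>z\<close>\<close>
  define d where "d = rec_nat z (\<lambda>k f t. a * f t + e k t)"
  have d0: "d 0 = z" and dS: "d (Suc k) = (\<lambda>t. a * d k t + e k t)" for k
    by (simp_all add: d_def)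
  have "half_line_deriv (d k) (d (Suc k))" for k
  proof (induct k)
    case 0
    show ?case using half_line_deriv_cong[OF z, of z "d (Suc 0)"] e(1) by (simp add: d0 dS)
  next
    case (Suc k)
    show ?case using half_line_deriv_add[OF half_line_deriv_mult_left[OF Suc] e(2)]
      by (simp add: dS)
  qed
  then show ?thesis unfolding smooth_fun_def using d0 by metis
qed

lemma linear_ode_homogeneous_zero:
  fixes z :: "real \<Rightarrow> complex"
  assumes z: "half_line_deriv z (\<lambda>t. a * z t)" and z0: "z 0 = 0" and t: "t \<ge> 0"
  shows "z t = 0"
proof -
  \<comment> \<open>\<open>exp (- a t) z t\<close> is constant\<close>
  have "((\<lambda>t. exp (t *\<^sub>R (- a)) * z t) has_vector_derivative 0) (at t within {0..})" if "t \<in> {0..}" for t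
  proof -
    have zt: "(z has_vector_derivative a * z t) (at t within {0..})"
      using z that by (simp add: half_line_deriv_def)
    show ?thesis
      using has_vector_derivative_mult[OF exp_scaleR_has_vector_derivative_right zt, of "- a"]
      by (simp add: algebra_simps)
  qed
  then obtain c where c: "\<And>t. t \<in> {0..} \<Longrightarrow> exp (t *\<^sub>R (- a)) * z t = c"
    by (rule has_vector_derivative_zero_constant[rotated]) auto
  have "exp (t *\<^sub>R (- a)) * z t = 0" using c[of 0] c[of t] z0 t by simp
  then show ?thesis by simp
qed

lemma linear_ode_solution_exists:
  fixes h :: "real \<Rightarrow> complex"
  assumes h: "smooth_fun h"
  shows "\<exists>z. half_line_deriv z (\<lambda>t. a * z t + h t)"
proof -
  obtain h' where "half_line_deriv h h'" using smooth_fun_imp_deriv[OF h] by blast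
  then have cont_h: "continuous_on {0..} h"
    unfolding half_line_deriv_def continuous_on_eq_continuous_within
    by (auto intro: has_vector_derivative_continuous)
  \<comment> \<open>variation of constants\<close>
  define f where "f = (\<lambda>t. exp (t *\<^sub>R (- a)) * h t)"
  have "continuous_on {0..} f"
    unfolding f_def by (intro continuous_intros cont_h)
  then have cont_f: "continuous_on {0..b} f" for b
    by (rule continuous_on_subset) auto
  define F where "F = (\<lambda>t. integral {0..t} f)"
  have F: "(F has_vector_derivative f t) (at t within {0..})" if t: "t \<ge> 0" for t
  proof -
    have "(F has_vector_derivative f t) (at t within {0..t + 1})"
      unfolding F_def by (rule integral_has_vector_derivative[OF cont_f]) (use t in auto)
    moreover have "at t within {0..t + 1} = at t within {0..}"
      by (rule at_within_nhd[of _ "{..<t + 1}"]) auto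
    ultimately show ?thesis by simp
  qed
  define z where "z = (\<lambda>t. exp (t *\<^sub>R a) * F t)"
  have "(z has_vector_derivative a * z t + h t) (at t within {0..})" if t: "t \<ge> 0" for t
  proof -
    have "exp (t *\<^sub>R a) * f t = h t"
      unfolding f_def by (simp add: exp_minus field_simps)
    then show ?thesis
      using has_vector_derivative_mult[OF exp_scaleR_has_vector_derivative_right F[OF t], of a]
      unfolding z_def by (simp add: algebra_simps)
  qed
  then show ?thesis unfolding half_line_deriv_def by blast
qed

text \<open>
The three lemmas on \<open>c z' = (s c - 1) z + h\<close> treat one diagonal entry \<open>c\<close> of a triangular system.  For
\<open>c = 0\<close> the equation reads \<open>z = h\<close>, and otherwise it is an ordinary differential equation.
\<close>

lemma scalar_dae_solution_smooth:
  fixes z :: "real \<Rightarrow> complex"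
  assumes z: "half_line_deriv z z'" and h: "smooth_fun h"
    and eq: "\<And>t. t \<ge> 0 \<Longrightarrow> c * z' t = (s * c - 1) * z t + h t"
  shows "smooth_fun z"
proof (cases "c = 0")
  case True
  then show ?thesis using eq by (intro smooth_fun_cong[OF h]) (auto simp: algebra_simps)
next
  case False
  have "half_line_deriv z (\<lambda>t. (s * c - 1) / c * z t + 1 / c * h t)"
    using eq False by (intro half_line_deriv_cong[OF z refl]) (auto simp: field_simps)
  then show ?thesis by (rule linear_ode_solution_smooth) (rule smooth_fun_mult_left[OF h])
qed

lemma scalar_dae_homogeneous_zero:
  fixes z :: "real \<Rightarrow> complex"
  assumes z: "half_line_deriv z z'" and z0: "z 0 = 0"
    and eq: "\<And>t. t \<ge> 0 \<Longrightarrow> c * z' t = (s * c - 1) * z t" and t: "t \<ge> 0"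
  shows "z t = 0"
proof (cases "c = 0")
  case True
  then show ?thesis using eq[OF t] by simp
next
  case False
  have "half_line_deriv z (\<lambda>t. (s * c - 1) / c * z t)"
    using eq False by (intro half_line_deriv_cong[OF z refl]) (auto simp: field_simps)
  then show ?thesis by (rule linear_ode_homogeneous_zero) (rule z0, rule t)
qed

lemma scalar_dae_solution_exists:
  fixes h :: "real \<Rightarrow> complex"
  assumes h: "smooth_fun h"
  shows "\<exists>z z'. half_line_deriv z z' \<and> smooth_fun z \<and> (\<forall>t \<ge> 0. c * z' t = (s * c - 1) * z t + h t)"
proof (cases "c = 0")
  case True
  then show ?thesis using h smooth_fun_imp_deriv[OF h] by auto
next
  case False
  obtain z where z: "half_line_deriv z (\<lambda>t. (s * c - 1) / c * z t + 1 / c * h t)"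
    using linear_ode_solution_exists[OF smooth_fun_mult_left[OF h]] by blast
  have "smooth_fun z" by (rule linear_ode_solution_smooth[OF z]) (rule smooth_fun_mult_left[OF h])
  moreover have "\<forall>t \<ge> 0. c * ((s * c - 1) / c * z t + 1 / c * h t) = (s * c - 1) * z t + h t"
    using False by (simp add: field_simps)
  ultimately show ?thesis using z by blast
qed

section \<open>Triangular differential-algebraic systems\<close>

text \<open>
Row \<open>i\<close> of \<open>U z' = s U z - z + g\<close>, as a scalar equation for \<open>z i\<close> whose right-hand side depends on the later
components only.  The next three lemmas proceed by backward induction on \<open>i\<close>.
\<close>

lemma triangular_row_iff:
  fixes z z' :: "nat \<Rightarrow> complex"
  assumes "i < m"
  shows "(\<Sum>j = i..<m. U i j * z' j) = s * (\<Sum>j = i..<m. U i j * z j) - z i + g \<longleftrightarrow>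
    U i i * z' i = (s * U i i - 1) * z i + (g + (\<Sum>j = Suc i..<m. U i j * (s * z j - z' j)))"
proof -
  have 1: "(\<Sum>j = i..<m. U i j * x j) = U i i * x i + (\<Sum>j = Suc i..<m. U i j * x j)" for x :: "nat \<Rightarrow> complex"
    using assms by (rule sum.atLeast_Suc_lessThan)
  have 2: "(\<Sum>j = Suc i..<m. U i j * (s * z j - z' j))
      = s * (\<Sum>j = Suc i..<m. U i j * z j) - (\<Sum>j = Suc i..<m. U i j * z' j)"
    by (simp add: right_diff_distrib sum_subtractf sum_distrib_left mult.left_commute)
  show ?thesis unfolding 1 2 by (auto simp: algebra_simps)
qed

lemma triangular_dae_solution_smooth:
  fixes z :: "nat \<Rightarrow> real \<Rightarrow> complex"
  assumes z: "\<And>i. i < m \<Longrightarrow> half_line_deriv (z i) (z' i)"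
    and g: "\<And>i. i < m \<Longrightarrow> smooth_fun (g i)"
    and eq: "\<And>i t. i < m \<Longrightarrow> t \<ge> 0 \<Longrightarrow>
      (\<Sum>j = i..<m. U i j * z' j t) = s * (\<Sum>j = i..<m. U i j * z j t) - z i t + g i t"
    and i: "i < m"
  shows "smooth_fun (z i)"
  using i
proof (induct "m - i" arbitrary: i rule: less_induct)
  case less
  have later: "smooth_fun (z j)" "smooth_fun (z' j)" if "j \<in> {Suc i..<m}" for j
  proof -
    show "smooth_fun (z j)" using less that by auto
    then show "smooth_fun (z' j)" using smooth_fun_deriv z that by auto
  qed
  show ?case
  proof (rule scalar_dae_solution_smooth[OF z[OF less.prems]])
    show "U i i * z' i t = (s * U i i - 1) * z i t
        + (g i t + (\<Sum>j = Suc i..<m. U i j * (s * z j t + (-1) * z' j t)))" if "t \<ge> 0" for t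
      using triangular_row_iff[OF less.prems, of U "\<lambda>j. z' j t" s "\<lambda>j. z j t" "g i t"]
        eq[OF less.prems that] by simp
    show "smooth_fun (\<lambda>t. g i t + (\<Sum>j = Suc i..<m. U i j * (s * z j t + (-1) * z' j t)))"
      by (intro smooth_fun_add smooth_fun_sum smooth_fun_mult_left g less.prems later)
  qed
qed

lemma triangular_dae_homogeneous_zero:
  fixes z :: "nat \<Rightarrow> real \<Rightarrow> complex"
  assumes z: "\<And>i. i < m \<Longrightarrow> half_line_deriv (z i) (z' i)"
    and z0: "\<And>i. i < m \<Longrightarrow> z i 0 = 0"
    and eq: "\<And>i t. i < m \<Longrightarrow> t \<ge> 0 \<Longrightarrow>
      (\<Sum>j = i..<m. U i j * z' j t) = s * (\<Sum>j = i..<m. U i j * z j t) - z i t"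
    and i: "i < m" and t: "t \<ge> 0"
  shows "z i t = 0"
  using i t
proof (induct "m - i" arbitrary: i t rule: less_induct)
  case less
  have later: "z j t = 0" "z' j t = 0" if j: "j \<in> {Suc i..<m}" and t: "t \<ge> 0" for j t
  proof -
    have zero: "z j t = 0" if "t \<ge> 0" for t using less j that by auto
    then show "z j t = 0" using t .
    have "half_line_deriv (z j) (\<lambda>t. 0)"
      by (rule half_line_deriv_cong[OF half_line_deriv_const[of 0] zero refl])
    then show "z' j t = 0" using half_line_deriv_unique z j t by fastforce
  qed
  show ?case
  proof (rule scalar_dae_homogeneous_zero[OF z[OF less.prems(1)] z0[OF less.prems(1)]])
    show "U i i * z' i t = (s * U i i - 1) * z i t" if "t \<ge> 0" for t
      using triangular_row_iff[OF less.prems(1), of U "\<lambda>j. z' j t" s "\<lambda>j. z j t" 0]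
        eq[OF less.prems(1) that] later[OF _ that] by simp
  qed (rule less.prems)
qed

lemma triangular_dae_solution_exists:
  fixes g :: "nat \<Rightarrow> real \<Rightarrow> complex"
  assumes g: "\<And>i. i < m \<Longrightarrow> smooth_fun (g i)"
  shows "\<exists>z z'. (\<forall>i<m. smooth_fun (z i) \<and> half_line_deriv (z i) (z' i) \<and>
      (\<forall>t \<ge> 0. (\<Sum>j = i..<m. U i j * z' j t) = s * (\<Sum>j = i..<m. U i j * z j t) - z i t + g i t))"
proof -
  have "\<exists>z z'. (\<forall>i<m. k \<le> i \<longrightarrow> smooth_fun (z i) \<and> half_line_deriv (z i) (z' i) \<and>
      (\<forall>t \<ge> 0. (\<Sum>j = i..<m. U i j * z' j t) = s * (\<Sum>j = i..<m. U i j * z j t) - z i t + g i t))"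
    if "k \<le> m" for k
    using that
  proof (induct k rule: inc_induct)
    case base
    then show ?case by auto
  next
    case (step k)
    then obtain z z' where
      sm: "\<And>i. i < m \<Longrightarrow> Suc k \<le> i \<Longrightarrow> smooth_fun (z i)"
      and der: "\<And>i. i < m \<Longrightarrow> Suc k \<le> i \<Longrightarrow> half_line_deriv (z i) (z' i)"
      and eq: "\<And>i t. i < m \<Longrightarrow> Suc k \<le> i \<Longrightarrow> t \<ge> 0 \<Longrightarrow>
        (\<Sum>j = i..<m. U i j * z' j t) = s * (\<Sum>j = i..<m. U i j * z j t) - z i t + g i t"
      by blast
    define h where "h = (\<lambda>t. g k t + (\<Sum>j = Suc k..<m. U k j * (s * z j t + (-1) * z' j t)))"
    have "smooth_fun h"
      unfolding h_def using step.hyps sm smooth_fun_deriv[OF sm der]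
      by (intro smooth_fun_add smooth_fun_sum smooth_fun_mult_left g) auto
    then obtain w w' where w: "half_line_deriv w w'" "smooth_fun w"
      and weq: "\<And>t. t \<ge> 0 \<Longrightarrow> U k k * w' t = (s * U k k - 1) * w t + h t"
      using scalar_dae_solution_exists by metis
    let ?z = "z(k := w)" and ?z' = "z'(k := w')"
    have "(\<Sum>j = i..<m. U i j * ?z' j t) = s * (\<Sum>j = i..<m. U i j * ?z j t) - ?z i t + g i t"
      if i: "i < m" "k \<le> i" and t: "t \<ge> 0" for i t
    proof (cases "i = k")
      case True
      have "(\<Sum>j = Suc k..<m. U k j * (s * ?z j t - ?z' j t))
          = (\<Sum>j = Suc k..<m. U k j * (s * z j t + (-1) * z' j t))"
        by (rule sum.cong) auto
      then show ?thesis
        using triangular_row_iff[of k m U "\<lambda>j. ?z' j t" s "\<lambda>j. ?z j t" "g k t"] weq[OF t] True step.hyps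
        by (simp add: h_def)
    next
      case False
      then have "(\<Sum>j = i..<m. U i j * ?z' j t) = (\<Sum>j = i..<m. U i j * z' j t)"
        "(\<Sum>j = i..<m. U i j * ?z j t) = (\<Sum>j = i..<m. U i j * z j t)"
        using i by (auto intro!: sum.cong)
      then show ?thesis using eq[of i t] i t False by simp
    qed
    then show ?case using sm der w by (intro exI[of _ ?z] exI[of _ ?z']) (auto simp: Suc_le_eq)
  qed
  from this[of 0] show ?thesis by simp
qed

section \<open>Vector signals\<close>

lemma smooth_signal_iff:
  "smooth_signal m u \<longleftrightarrow> (\<forall>t \<ge> 0. u t \<in> carrier_vec m) \<and> (\<forall>i < m. smooth_fun (\<lambda>t. u t $ i))"
  unfolding smooth_signal_def smooth_fun_def half_line_deriv_def
    has_real_derivative_iff_has_vector_derivative by (rule refl)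

lemma has_signal_deriv_iff:
  "has_signal_deriv m x x' \<longleftrightarrow> (\<forall>t \<ge> 0. x t \<in> carrier_vec m \<and> x' t \<in> carrier_vec m) \<and>
     (\<forall>i < m. half_line_deriv (\<lambda>t. x t $ i) (\<lambda>t. x' t $ i))"
  unfolding has_signal_deriv_def half_line_deriv_def
    has_real_derivative_iff_has_vector_derivative by auto

lemma smooth_signal_carrier: "smooth_signal m u \<Longrightarrow> t \<ge> 0 \<Longrightarrow> u t \<in> carrier_vec m"
  by (simp add: smooth_signal_def)

lemma has_signal_deriv_carrier:
  assumes "has_signal_deriv m x x'" "t \<ge> 0"
  shows "x t \<in> carrier_vec m" "x' t \<in> carrier_vec m"
  using assms by (auto simp: has_signal_deriv_def)

lemma smooth_signal_dim: "smooth_signal m u \<Longrightarrow> t \<ge> 0 \<Longrightarrow> dim_vec (u t) = m"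
  by (rule carrier_vecD[OF smooth_signal_carrier])

lemma has_signal_deriv_dim:
  assumes "has_signal_deriv m x x'" "t \<ge> 0"
  shows "dim_vec (x t) = m" "dim_vec (x' t) = m"
  by (rule carrier_vecD, rule has_signal_deriv_carrier[OF assms])+

lemma smooth_signal_cong:
  assumes "smooth_signal m u" "\<And>t. t \<ge> 0 \<Longrightarrow> v t = u t"
  shows "smooth_signal m v"
  unfolding smooth_signal_iff
proof (intro conjI allI impI)
  fix i assume "i < m"
  then have "smooth_fun (\<lambda>t. u t $ i)" using assms by (simp add: smooth_signal_iff)
  then show "smooth_fun (\<lambda>t. v t $ i)" by (rule smooth_fun_cong) (simp add: assms)
qed (use assms in \<open>auto simp: smooth_signal_iff\<close>)

lemma has_signal_deriv_cong:
  assumes "has_signal_deriv m x x'" "\<And>t. t \<ge> 0 \<Longrightarrow> y t = x t" "\<And>t. t \<ge> 0 \<Longrightarrow> y' t = x' t"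
  shows "has_signal_deriv m y y'"
  unfolding has_signal_deriv_iff
proof (intro conjI allI impI)
  fix i assume "i < m"
  then have "half_line_deriv (\<lambda>t. x t $ i) (\<lambda>t. x' t $ i)" using assms by (simp add: has_signal_deriv_iff)
  then show "half_line_deriv (\<lambda>t. y t $ i) (\<lambda>t. y' t $ i)" by (rule half_line_deriv_cong) (simp_all add: assms)
qed (use assms in \<open>auto simp: has_signal_deriv_iff\<close>)

lemma smooth_signal_imp_deriv:
  assumes u: "smooth_signal m u"
  shows "\<exists>u'. smooth_signal m u' \<and> has_signal_deriv m u u'"
proof -
  have "\<forall>i. \<exists>f. i < m \<longrightarrow> smooth_fun f \<and> half_line_deriv (\<lambda>t. u t $ i) f"
    using u smooth_fun_imp_deriv by (auto simp: smooth_signal_iff)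
  then obtain f where f: "\<And>i. i < m \<Longrightarrow> smooth_fun (f i)"
    "\<And>i. i < m \<Longrightarrow> half_line_deriv (\<lambda>t. u t $ i) (f i)"
    by metis
  show ?thesis
    by (rule exI[of _ "\<lambda>t. vec m (\<lambda>i. f i t)"])
      (use u f in \<open>auto simp: smooth_signal_iff has_signal_deriv_iff\<close>)
qed

lemma smooth_signal_mult:
  assumes M: "M \<in> carrier_mat r m" and u: "smooth_signal m u"
  shows "smooth_signal r (\<lambda>t. M *\<^sub>v u t)"
  unfolding smooth_signal_iff
proof (intro conjI allI impI)
  fix i assume i: "i < r"
  have "smooth_fun (\<lambda>t. \<Sum>j<m. M $$ (i, j) * u t $ j)"
    using u by (intro smooth_fun_sum smooth_fun_mult_left) (auto simp: smooth_signal_iff)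
  then show "smooth_fun (\<lambda>t. (M *\<^sub>v u t) $ i)"
    by (rule smooth_fun_cong)
      (use i M smooth_signal_dim[OF u] in \<open>simp add: mult_vec_component del: index_mult_mat_vec\<close>)
qed (use M in \<open>auto intro!: carrier_vecI\<close>)

lemma has_signal_deriv_mult:
  assumes M: "M \<in> carrier_mat r m" and x: "has_signal_deriv m x x'"
  shows "has_signal_deriv r (\<lambda>t. M *\<^sub>v x t) (\<lambda>t. M *\<^sub>v x' t)"
  unfolding has_signal_deriv_iff
proof (intro conjI allI impI)
  fix i assume i: "i < r"
  have "half_line_deriv (\<lambda>t. \<Sum>j<m. M $$ (i, j) * x t $ j) (\<lambda>t. \<Sum>j<m. M $$ (i, j) * x' t $ j)"
    using x by (intro half_line_deriv_sum half_line_deriv_mult_left) (auto simp: has_signal_deriv_iff)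
  then show "half_line_deriv (\<lambda>t. (M *\<^sub>v x t) $ i) (\<lambda>t. (M *\<^sub>v x' t) $ i)"
    by (rule half_line_deriv_cong)
      (use i M has_signal_deriv_dim[OF x] in \<open>simp_all add: mult_vec_component del: index_mult_mat_vec\<close>)
qed (use M in \<open>auto intro!: carrier_vecI\<close>)

lemma smooth_signal_add:
  assumes "smooth_signal m u" "smooth_signal m v"
  shows "smooth_signal m (\<lambda>t. u t + v t)"
  unfolding smooth_signal_iff
proof (intro conjI allI impI)
  fix i assume i: "i < m"
  show "smooth_fun (\<lambda>t. (u t + v t) $ i)"
    by (rule smooth_fun_cong[OF smooth_fun_add[of "\<lambda>t. u t $ i" "\<lambda>t. v t $ i"]])
      (use assms i in \<open>auto simp: smooth_signal_iff\<close>)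
qed (use assms in \<open>auto simp: smooth_signal_iff\<close>)

lemma has_signal_deriv_add:
  assumes "has_signal_deriv m x x'" "has_signal_deriv m y y'"
  shows "has_signal_deriv m (\<lambda>t. x t + y t) (\<lambda>t. x' t + y' t)"
  unfolding has_signal_deriv_iff
proof (intro conjI allI impI)
  fix i assume i: "i < m"
  show "half_line_deriv (\<lambda>t. (x t + y t) $ i) (\<lambda>t. (x' t + y' t) $ i)"
    by (rule half_line_deriv_cong[OF half_line_deriv_add[of "\<lambda>t. x t $ i" "\<lambda>t. x' t $ i" "\<lambda>t. y t $ i" "\<lambda>t. y' t $ i"]])
      (use assms i in \<open>auto simp: has_signal_deriv_iff\<close>)
qed (use assms in \<open>auto simp: has_signal_deriv_iff\<close>)

lemma smooth_signal_scale:
  assumes g: "smooth_fun g" and v: "v \<in> carrier_vec m"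
  shows "smooth_signal m (\<lambda>t. g t \<cdot>\<^sub>v v)"
  unfolding smooth_signal_iff
proof (intro conjI allI impI)
  fix i assume i: "i < m"
  show "smooth_fun (\<lambda>t. (g t \<cdot>\<^sub>v v) $ i)"
    by (rule smooth_fun_cong[OF smooth_fun_mult_left[OF g, of "v $ i"]])
      (use v i in auto)
qed (use v in auto)

lemma has_signal_deriv_scale:
  assumes g: "half_line_deriv g g'" and v: "v \<in> carrier_vec m"
  shows "has_signal_deriv m (\<lambda>t. g t \<cdot>\<^sub>v v) (\<lambda>t. g' t \<cdot>\<^sub>v v)"
  unfolding has_signal_deriv_iff
proof (intro conjI allI impI)
  fix i assume i: "i < m"
  show "half_line_deriv (\<lambda>t. (g t \<cdot>\<^sub>v v) $ i) (\<lambda>t. (g' t \<cdot>\<^sub>v v) $ i)"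
    by (rule half_line_deriv_cong[OF half_line_deriv_mult_left[OF g, of "v $ i"]])
      (use v i in auto)
qed (use v in auto)

lemma smooth_signal_uminus:
  assumes u: "smooth_signal m u"
  shows "smooth_signal m (\<lambda>t. - u t)"
  by (rule smooth_signal_cong[OF smooth_signal_mult[OF _ u, of "- 1\<^sub>m m"]])
    (use smooth_signal_carrier[OF u] in \<open>auto simp: uminus_mult_mat_vec\<close>)

lemma has_signal_deriv_uminus:
  assumes x: "has_signal_deriv m x x'"
  shows "has_signal_deriv m (\<lambda>t. - x t) (\<lambda>t. - x' t)"
  by (rule has_signal_deriv_cong[OF has_signal_deriv_mult[OF _ x, of "- 1\<^sub>m m"]])
    (use has_signal_deriv_carrier[OF x] in \<open>auto simp: uminus_mult_mat_vec\<close>)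

lemma smooth_signal_diff:
  assumes u: "smooth_signal m u" and v: "smooth_signal m v"
  shows "smooth_signal m (\<lambda>t. u t - v t)"
  by (rule smooth_signal_cong[OF smooth_signal_add[OF u smooth_signal_uminus[OF v]]])
    (use smooth_signal_dim[OF u] smooth_signal_dim[OF v] in \<open>simp add: minus_vec_eq_add_uminus\<close>)

lemma has_signal_deriv_diff:
  assumes x: "has_signal_deriv m x x'" and y: "has_signal_deriv m y y'"
  shows "has_signal_deriv m (\<lambda>t. x t - y t) (\<lambda>t. x' t - y' t)"
  by (rule has_signal_deriv_cong[OF has_signal_deriv_add[OF x has_signal_deriv_uminus[OF y]]])
    (use has_signal_deriv_dim[OF x] has_signal_deriv_dim[OF y] in \<open>simp_all add: minus_vec_eq_add_uminus\<close>)

lemma smooth_signal_append: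
  assumes "smooth_signal a u" "smooth_signal b v"
  shows "smooth_signal (a + b) (\<lambda>t. u t @\<^sub>v v t)"
  unfolding smooth_signal_iff
proof (intro conjI allI impI)
  fix i assume i: "i < a + b"
  have "smooth_fun (\<lambda>t. if i < a then u t $ i else v t $ (i - a))"
    using assms i by (cases "i < a") (auto simp: smooth_signal_iff)
  then show "smooth_fun (\<lambda>t. (u t @\<^sub>v v t) $ i)"
    by (rule smooth_fun_cong) (use assms[THEN smooth_signal_dim] i in simp)
qed (use assms in \<open>auto simp: smooth_signal_iff\<close>)

lemma has_signal_deriv_append_iff:
  assumes x: "\<And>t. t \<ge> 0 \<Longrightarrow> x1 t \<in> carrier_vec a" "\<And>t. t \<ge> 0 \<Longrightarrow> x1' t \<in> carrier_vec a"
    and y: "\<And>t. t \<ge> 0 \<Longrightarrow> x2 t \<in> carrier_vec b" "\<And>t. t \<ge> 0 \<Longrightarrow> x2' t \<in> carrier_vec b"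
  shows "has_signal_deriv (a + b) (\<lambda>t. x1 t @\<^sub>v x2 t) (\<lambda>t. x1' t @\<^sub>v x2' t) \<longleftrightarrow>
    has_signal_deriv a x1 x1' \<and> has_signal_deriv b x2 x2'" (is "?L \<longleftrightarrow> ?R")
proof
  note dims = x[THEN carrier_vecD] y[THEN carrier_vecD]
  assume L: ?L
  show ?R
    unfolding has_signal_deriv_iff
  proof (intro conjI allI impI)
    fix i assume i: "i < a"
    have "half_line_deriv (\<lambda>t. (x1 t @\<^sub>v x2 t) $ i) (\<lambda>t. (x1' t @\<^sub>v x2' t) $ i)"
      using L i by (simp add: has_signal_deriv_iff del: index_append_vec)
    then show "half_line_deriv (\<lambda>t. x1 t $ i) (\<lambda>t. x1' t $ i)"
      by (rule half_line_deriv_cong) (use i dims in simp_all)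
  next
    fix i assume i: "i < b"
    have "half_line_deriv (\<lambda>t. (x1 t @\<^sub>v x2 t) $ (a + i)) (\<lambda>t. (x1' t @\<^sub>v x2' t) $ (a + i))"
      using L i by (simp add: has_signal_deriv_iff del: index_append_vec)
    then show "half_line_deriv (\<lambda>t. x2 t $ i) (\<lambda>t. x2' t $ i)"
      by (rule half_line_deriv_cong) (use i dims in simp_all)
  qed (use x y in auto)
next
  note dims = x[THEN carrier_vecD] y[THEN carrier_vecD]
  assume R: ?R
  show ?L
    unfolding has_signal_deriv_iff
  proof (intro conjI allI impI)
    fix i assume i: "i < a + b"
    have "half_line_deriv (\<lambda>t. if i < a then x1 t $ i else x2 t $ (i - a))
       (\<lambda>t. if i < a then x1' t $ i else x2' t $ (i - a))"
      using R i by (cases "i < a") (auto simp: has_signal_deriv_iff)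
    then show "half_line_deriv (\<lambda>t. (x1 t @\<^sub>v x2 t) $ i) (\<lambda>t. (x1' t @\<^sub>v x2' t) $ i)"
      by (rule half_line_deriv_cong) (use dims i in simp_all)
  qed (use x y in auto)
qed

section \<open>Differential-algebraic equations with an injective pencil\<close>

abbreviation cvec :: "real vec \<Rightarrow> complex vec" where
  "cvec \<equiv> map_vec complex_of_real"

lemma cmat_dim [simp]: "dim_row (cmat M) = dim_row M" "dim_col (cmat M) = dim_col M"
  by (simp_all add: cmat_def)

lemma cmat_mult_cvec:
  assumes "dim_vec v = dim_col M"
  shows "cmat M *\<^sub>v cvec v = cvec (M *\<^sub>v v)"
  by (rule eq_vecI) (use assms in \<open>simp_all add: mult_vec_component cmat_def del: index_mult_mat_vec\<close>)

lemma cvec_add: "dim_vec v = dim_vec w \<Longrightarrow> cvec (v + w) = cvec v + cvec w"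
  by (rule eq_vecI) auto

lemma pencil_mult_vec:
  assumes "dim_row F = dim_row M" "dim_col F = dim_vec v" "dim_col M = dim_vec v"
  shows "(s \<cdot>\<^sub>m cmat F - cmat M) *\<^sub>v v = s \<cdot>\<^sub>v (cmat F *\<^sub>v v) - cmat M *\<^sub>v v"
  by (rule eq_vecI)
    (use assms in \<open>simp_all add: mult_vec_component sum_subtractf sum_distrib_left left_diff_distrib
      mult.assoc del: index_mult_mat_vec\<close>)

text \<open>
As \<open>s\<close> is not an eigenvalue, \<open>s F - M\<close> is injective and has a left inverse \<open>N\<close>; the matrices \<open>U, V, W\<close> are a Schur form of \<open>N F\<close>.
\<close>

lemma triangularized_pencil:
  fixes F M :: "real mat" and s :: complex
  assumes F: "F \<in> carrier_mat r m" and M: "M \<in> carrier_mat r m"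
    and inj: "\<not> gen_eigenvalue F M s"
  obtains U V W N where "U \<in> carrier_mat m m" "V \<in> carrier_mat m m" "W \<in> carrier_mat m m"
    "N \<in> carrier_mat m r" "upper_triangular U" "V * W = 1\<^sub>m m" "W * V = 1\<^sub>m m"
    "N * (s \<cdot>\<^sub>m cmat F - cmat M) = 1\<^sub>m m" "N * cmat F = V * U * W"
proof -
  let ?J = "s \<cdot>\<^sub>m cmat F - cmat M"
  have cF: "cmat F \<in> carrier_mat r m" and cM: "cmat M \<in> carrier_mat r m"
    using F M by (simp_all add: cmat_def)
  then have J: "?J \<in> carrier_mat r m" by (intro minus_carrier_mat)
  have "v = 0\<^sub>v m" if v: "v \<in> carrier_vec m" and Jv: "?J *\<^sub>v v = 0\<^sub>v r" for v
  proof -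
    have "?J *\<^sub>v v = s \<cdot>\<^sub>v (cmat F *\<^sub>v v) - cmat M *\<^sub>v v"
      using F M v by (intro pencil_mult_vec) auto
    then have "s \<cdot>\<^sub>v (cmat F *\<^sub>v v) = cmat M *\<^sub>v v"
      using Jv cF cM v vec_minus_eq_zero_iff[of "s \<cdot>\<^sub>v (cmat F *\<^sub>v v)" r "cmat M *\<^sub>v v"] by auto
    then show ?thesis using inj v F unfolding gen_eigenvalue_def by auto
  qed
  then obtain N where N: "N \<in> carrier_mat m r" "N * ?J = 1\<^sub>m m"
    using left_inverse_if_injective[OF J] by blast
  have T: "N * cmat F \<in> carrier_mat m m" using N cF by simp
  obtain es where "char_poly (N * cmat F) = (\<Prod>a\<leftarrow>es. [:- a, 1:])"
    using char_poly_factorized[OF T] by blast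
  then obtain U where U: "U \<in> carrier_mat m m" "upper_triangular U" "similar_mat (N * cmat F) U"
    using schur_decomposition_exists[OF T] by blast
  then obtain V W where "similar_mat_wit (N * cmat F) U V W" unfolding similar_mat_def by blast
  from similar_mat_witD2[OF T this] show thesis using that[of U V W N] U N by blast
qed

lemma sum_upper_triangular_row:
  fixes z :: "complex vec"
  assumes U: "U \<in> carrier_mat m m" "upper_triangular U" and z: "dim_vec z = m" and i: "i < m"
  shows "(U *\<^sub>v z) $ i = (\<Sum>j = i..<m. U $$ (i, j) * z $ j)"
proof -
  have "(U *\<^sub>v z) $ i = (\<Sum>j<m. U $$ (i, j) * z $ j)"
    using U z i by (simp add: mult_vec_component del: index_mult_mat_vec)
  also have "\<dots> = (\<Sum>j = i..<m. U $$ (i, j) * z $ j)"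
    using U i by (intro sum.mono_neutral_right) (auto simp: upper_triangular_def)
  finally show ?thesis .
qed

text \<open>
Multiplication of \<open>F x' = M x + f\<close> by \<open>N\<close> gives \<open>T x' = (s T - I) x + N f\<close> with \<open>T = N F\<close>, because
\<open>N M = s T - I\<close>; multiplication by \<open>W\<close> passes to triangular coordinates.
\<close>

lemma triangular_form_of_dae:
  fixes U V W N :: "complex mat"
  assumes F: "F \<in> carrier_mat r m" and M: "M \<in> carrier_mat r m"
    and U: "U \<in> carrier_mat m m" and V: "V \<in> carrier_mat m m" and W: "W \<in> carrier_mat m m"
    and N: "N \<in> carrier_mat m r" and WV: "W * V = 1\<^sub>m m"
    and NJ: "N * (s \<cdot>\<^sub>m cmat F - cmat M) = 1\<^sub>m m" and NF: "N * cmat F = V * U * W"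
    and x: "x \<in> carrier_vec m" and x': "x' \<in> carrier_vec m" and f: "f \<in> carrier_vec r"
    and eq: "F *\<^sub>v x' = M *\<^sub>v x + f"
  shows "U *\<^sub>v (W *\<^sub>v cvec x') = s \<cdot>\<^sub>v (U *\<^sub>v (W *\<^sub>v cvec x)) - W *\<^sub>v cvec x + (W * N) *\<^sub>v cvec f"
proof -
  note dims = F[THEN carrier_matD(1)] F[THEN carrier_matD(2)] M[THEN carrier_matD(1)] M[THEN carrier_matD(2)]
    U[THEN carrier_matD(1)] U[THEN carrier_matD(2)] V[THEN carrier_matD(1)] V[THEN carrier_matD(2)]
    W[THEN carrier_matD(1)] W[THEN carrier_matD(2)] N[THEN carrier_matD(1)] N[THEN carrier_matD(2)]
    x[THEN carrier_vecD] x'[THEN carrier_vecD] f[THEN carrier_vecD]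
  \<comment> \<open>\<open>U W = W T\<close> with \<open>T = N F\<close>\<close>
  have UW: "U *\<^sub>v (W *\<^sub>v z) = W *\<^sub>v (N *\<^sub>v (cmat F *\<^sub>v z))" if z: "dim_vec z = m" for z :: "complex vec"
  proof -
    have "W * (N * cmat F) = (W * V) * (U * W)"
      unfolding NF by (simp add: dims mat_assoc)
    also have "\<dots> = U * W" unfolding WV using U W by simp
    finally have "(W * (N * cmat F)) *\<^sub>v z = (U * W) *\<^sub>v z" by simp
    then show ?thesis using z by (simp add: dims mat_vec_assoc)
  qed
  have "N *\<^sub>v (s \<cdot>\<^sub>v (cmat F *\<^sub>v cvec x)) - N *\<^sub>v (cmat M *\<^sub>v cvec x) = cvec x"
  proof -
    have "(s \<cdot>\<^sub>m cmat F - cmat M) *\<^sub>v cvec x = s \<cdot>\<^sub>v (cmat F *\<^sub>v cvec x) - cmat M *\<^sub>v cvec x"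
      by (intro pencil_mult_vec) (simp_all add: dims)
    moreover have "(N * (s \<cdot>\<^sub>m cmat F - cmat M)) *\<^sub>v cvec x = cvec x"
      unfolding NJ using x by simp
    ultimately show ?thesis
      by (simp add: dims mat_vec_assoc flip: mult_vec_diff)
  qed
  then have Nx: "s \<cdot>\<^sub>v (N *\<^sub>v (cmat F *\<^sub>v cvec x)) - N *\<^sub>v (cmat M *\<^sub>v cvec x) = cvec x"
    by (simp add: dims mult_vec_smult)
  have "cmat F *\<^sub>v cvec x' = cmat M *\<^sub>v cvec x + cvec f"
    using eq by (simp add: dims cmat_mult_cvec cvec_add)
  then have "N *\<^sub>v (cmat F *\<^sub>v cvec x') = N *\<^sub>v (cmat M *\<^sub>v cvec x) + N *\<^sub>v cvec f"
    by (simp add: dims mult_vec_add)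
  also have "N *\<^sub>v (cmat M *\<^sub>v cvec x) = s \<cdot>\<^sub>v (N *\<^sub>v (cmat F *\<^sub>v cvec x)) - cvec x"
  proof (rule eq_vecI)
    fix i assume "i < dim_vec (s \<cdot>\<^sub>v (N *\<^sub>v (cmat F *\<^sub>v cvec x)) - cvec x)"
    then have i: "i < m" by (simp add: dims)
    show "(N *\<^sub>v (cmat M *\<^sub>v cvec x)) $ i = (s \<cdot>\<^sub>v (N *\<^sub>v (cmat F *\<^sub>v cvec x)) - cvec x) $ i"
      using arg_cong[OF Nx, of "\<lambda>v. v $ i"] i by (simp add: dims algebra_simps del: index_mult_mat_vec)
  qed (simp add: dims)
  finally have "N *\<^sub>v (cmat F *\<^sub>v cvec x') = s \<cdot>\<^sub>v (N *\<^sub>v (cmat F *\<^sub>v cvec x)) - cvec x + N *\<^sub>v cvec f" .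
  then show ?thesis
    by (simp add: dims UW mult_vec_add mult_vec_diff mult_vec_smult mat_vec_assoc)
qed

lemma complexified_signal_deriv:
  assumes W: "W \<in> carrier_mat q m" and x: "has_signal_deriv m x x'" and i: "i < q"
  shows "half_line_deriv (\<lambda>t. (W *\<^sub>v cvec (x t)) $ i) (\<lambda>t. (W *\<^sub>v cvec (x' t)) $ i)"
proof -
  have "half_line_deriv (\<lambda>t. \<Sum>j<m. W $$ (i, j) * complex_of_real (x t $ j))
      (\<lambda>t. \<Sum>j<m. W $$ (i, j) * complex_of_real (x' t $ j))"
    using x by (intro half_line_deriv_sum half_line_deriv_mult_left
        half_line_deriv_bounded_linear[OF bounded_linear_of_real]) (auto simp: has_signal_deriv_iff)
  then show ?thesis
    by (rule half_line_deriv_cong)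
      (use W i has_signal_deriv_dim[OF x] in \<open>simp_all add: mult_vec_component del: index_mult_mat_vec\<close>)
qed

lemma complexified_signal_smooth:
  assumes W: "W \<in> carrier_mat q m" and u: "smooth_signal m u" and i: "i < q"
  shows "smooth_fun (\<lambda>t. (W *\<^sub>v cvec (u t)) $ i)"
proof -
  have "smooth_fun (\<lambda>t. \<Sum>j<m. W $$ (i, j) * complex_of_real (u t $ j))"
    using u by (intro smooth_fun_sum smooth_fun_mult_left
        smooth_fun_bounded_linear[OF bounded_linear_of_real]) (auto simp: smooth_signal_iff)
  then show ?thesis
    by (rule smooth_fun_cong)
      (use W i smooth_signal_dim[OF u] in \<open>simp_all add: mult_vec_component del: index_mult_mat_vec\<close>)
qed

lemma dae_solution_smooth:
  assumes F: "F \<in> carrier_mat r m" and M: "M \<in> carrier_mat r m"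
    and inj: "\<not> gen_eigenvalue F M s"
    and x: "has_signal_deriv m x x'" and f: "smooth_signal r f"
    and eq: "\<And>t. t \<ge> 0 \<Longrightarrow> F *\<^sub>v x' t = M *\<^sub>v x t + f t"
  shows "smooth_signal m x"
proof -
  obtain U V W N where U: "U \<in> carrier_mat m m" and V: "V \<in> carrier_mat m m"
    and W: "W \<in> carrier_mat m m" and N: "N \<in> carrier_mat m r" and ut: "upper_triangular U"
    and VW: "V * W = 1\<^sub>m m" and WV: "W * V = 1\<^sub>m m"
    and NJ: "N * (s \<cdot>\<^sub>m cmat F - cmat M) = 1\<^sub>m m" and NF: "N * cmat F = V * U * W"
    by (rule triangularized_pencil[OF F M inj])
  have WN: "W * N \<in> carrier_mat m r" using W N by simp
  define z where "z = (\<lambda>i t. (W *\<^sub>v cvec (x t)) $ i)"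
  have z_smooth: "smooth_fun (z i)" if "i < m" for i
  proof (rule triangular_dae_solution_smooth[OF _ _ _ that])
    show "half_line_deriv (z i) (\<lambda>t. (W *\<^sub>v cvec (x' t)) $ i)" if "i < m" for i
      unfolding z_def by (rule complexified_signal_deriv[OF W x that])
    show "smooth_fun (\<lambda>t. ((W * N) *\<^sub>v cvec (f t)) $ i)" if "i < m" for i
      by (rule complexified_signal_smooth[OF WN f that])
    show "(\<Sum>j = i..<m. U $$ (i, j) * (W *\<^sub>v cvec (x' t)) $ j) =
        s * (\<Sum>j = i..<m. U $$ (i, j) * z j t) - z i t + ((W * N) *\<^sub>v cvec (f t)) $ i"
      if i: "i < m" and t: "t \<ge> 0" for i t
    proof -
      have "(U *\<^sub>v (W *\<^sub>v cvec (x' t))) $ i = (s \<cdot>\<^sub>v (U *\<^sub>v (W *\<^sub>v cvec (x t)))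
          - W *\<^sub>v cvec (x t) + (W * N) *\<^sub>v cvec (f t)) $ i"
        using triangular_form_of_dae[OF F M U V W N WV NJ NF has_signal_deriv_carrier[OF x t]
            smooth_signal_carrier[OF f t] eq[OF t]] by simp
      also have "\<dots> = s * (U *\<^sub>v (W *\<^sub>v cvec (x t))) $ i - (W *\<^sub>v cvec (x t)) $ i
          + ((W * N) *\<^sub>v cvec (f t)) $ i"
        using i U W WN by simp
      finally show ?thesis
        using W sum_upper_triangular_row[OF U ut _ i, of "W *\<^sub>v cvec (x t)"]
          sum_upper_triangular_row[OF U ut _ i, of "W *\<^sub>v cvec (x' t)"]
        by (simp add: z_def del: index_mult_mat_vec)
    qed
  qed
  show ?thesis
    unfolding smooth_signal_iff
  proof (intro conjI allI impI)
    fix i assume i: "i < m"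
    have "smooth_fun (\<lambda>t. Re (\<Sum>j<m. V $$ (i, j) * z j t))"
      by (intro smooth_fun_bounded_linear[OF bounded_linear_Re] smooth_fun_sum smooth_fun_mult_left)
        (simp add: z_smooth)
    moreover have "x t $ i = Re (\<Sum>j<m. V $$ (i, j) * z j t)" if t: "t \<ge> 0" for t
    proof -
      have xt: "dim_vec (x t) = m" by (rule has_signal_deriv_dim(1)[OF x t])
      have "V *\<^sub>v (W *\<^sub>v cvec (x t)) = cvec (x t)"
        using VW V W xt by (simp add: one_mat_mult_vec flip: mat_vec_assoc)
      then have "cvec (x t) $ i = (V *\<^sub>v (W *\<^sub>v cvec (x t))) $ i" by simp
      also have "\<dots> = (\<Sum>j<m. V $$ (i, j) * z j t)"
        using V W i by (simp add: mult_vec_component z_def del: index_mult_mat_vec)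
      finally show ?thesis using i xt by (metis Re_complex_of_real index_map_vec(1))
    qed
    ultimately show "smooth_fun (\<lambda>t. x t $ i)" by (rule smooth_fun_cong)
  qed (use has_signal_deriv_carrier[OF x] in blast)
qed

lemma dae_homogeneous_zero:
  assumes F: "F \<in> carrier_mat r m" and M: "M \<in> carrier_mat r m"
    and inj: "\<not> gen_eigenvalue F M s"
    and x: "has_signal_deriv m x x'" and x0: "x 0 = 0\<^sub>v m"
    and eq: "\<And>t. t \<ge> 0 \<Longrightarrow> F *\<^sub>v x' t = M *\<^sub>v x t"
    and t: "t \<ge> 0"
  shows "x t = 0\<^sub>v m"
proof -
  obtain U V W N where U: "U \<in> carrier_mat m m" and V: "V \<in> carrier_mat m m"
    and W: "W \<in> carrier_mat m m" and N: "N \<in> carrier_mat m r" and ut: "upper_triangular U"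
    and VW: "V * W = 1\<^sub>m m" and WV: "W * V = 1\<^sub>m m"
    and NJ: "N * (s \<cdot>\<^sub>m cmat F - cmat M) = 1\<^sub>m m" and NF: "N * cmat F = V * U * W"
    by (rule triangularized_pencil[OF F M inj])
  have WN: "W * N \<in> carrier_mat m r" using W N by simp
  define z where "z = (\<lambda>i t. (W *\<^sub>v cvec (x t)) $ i)"
  have z_zero: "z i t = 0" if "i < m" for i
  proof (rule triangular_dae_homogeneous_zero[OF _ _ _ that t])
    show "half_line_deriv (z i) (\<lambda>t. (W *\<^sub>v cvec (x' t)) $ i)" if "i < m" for i
      unfolding z_def by (rule complexified_signal_deriv[OF W x that])
    show "z i 0 = 0" if "i < m" for i
      unfolding z_def x0 using W that by (simp add: mult_vec_component del: index_mult_mat_vec)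
    show "(\<Sum>j = i..<m. U $$ (i, j) * (W *\<^sub>v cvec (x' t)) $ j) =
        s * (\<Sum>j = i..<m. U $$ (i, j) * z j t) - z i t"
      if i: "i < m" and t: "t \<ge> 0" for i t
    proof -
      have "F *\<^sub>v x' t = M *\<^sub>v x t + 0\<^sub>v r"
        unfolding eq[OF t] using M by (intro right_zero_vec[symmetric]) (auto intro: carrier_vecI)
      then have "(U *\<^sub>v (W *\<^sub>v cvec (x' t))) $ i = (s \<cdot>\<^sub>v (U *\<^sub>v (W *\<^sub>v cvec (x t)))
          - W *\<^sub>v cvec (x t) + (W * N) *\<^sub>v cvec (0\<^sub>v r)) $ i"
        using triangular_form_of_dae[OF F M U V W N WV NJ NF has_signal_deriv_carrier[OF x t], of "0\<^sub>v r"]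
        by simp
      also have "\<dots> = s * (U *\<^sub>v (W *\<^sub>v cvec (x t))) $ i - (W *\<^sub>v cvec (x t)) $ i"
      proof -
        have "((W * N) *\<^sub>v cvec (0\<^sub>v r)) $ i = 0"
          using i W N by (simp add: mult_vec_component del: index_mult_mat_vec)
        then show ?thesis using i U W WN by (simp del: index_mult_mat_vec)
      qed
      finally show ?thesis
        using W sum_upper_triangular_row[OF U ut _ i, of "W *\<^sub>v cvec (x t)"]
          sum_upper_triangular_row[OF U ut _ i, of "W *\<^sub>v cvec (x' t)"]
        by (simp add: z_def del: index_mult_mat_vec)
    qed
  qed
  have xt: "dim_vec (x t) = m" by (rule has_signal_deriv_dim(1)[OF x t])
  show ?thesis
  proof (rule eq_vecI)
    fix i assume "i < dim_vec (0\<^sub>v m :: real vec)"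
    then have i: "i < m" by simp
    have "V *\<^sub>v (W *\<^sub>v cvec (x t)) = cvec (x t)"
      using VW V W xt by (simp add: one_mat_mult_vec flip: mat_vec_assoc)
    then have "cvec (x t) $ i = (V *\<^sub>v (W *\<^sub>v cvec (x t))) $ i" by simp
    also have "\<dots> = (\<Sum>j<m. V $$ (i, j) * z j t)"
      using V W i by (simp add: mult_vec_component z_def del: index_mult_mat_vec)
    also have "\<dots> = 0" by (simp add: z_zero)
    finally show "x t $ i = 0\<^sub>v m $ i" using i xt by simp
  qed (use xt in simp)
qed

text \<open>
For a square pencil the left inverse \<open>N\<close> of \<open>s F - M\<close> is also a right inverse, which makes the passage to triangular
coordinates reversible.  The real part of a complex solution is a solution because the data are real.
\<close>

lemma dae_solution_exists:
  assumes F: "F \<in> carrier_mat n n" and M: "M \<in> carrier_mat n n" and reg: "regular_pencil F M"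
    and f: "smooth_signal n f"
  shows "\<exists>x x'. has_signal_deriv n x x' \<and> (\<forall>t \<ge> 0. F *\<^sub>v x' t = M *\<^sub>v x t + f t)"
proof -
  obtain s where det: "det (s \<cdot>\<^sub>m cmat F - cmat M) \<noteq> 0"
    using reg unfolding regular_pencil_def by blast
  let ?J = "s \<cdot>\<^sub>m cmat F - cmat M"
  have cF: "cmat F \<in> carrier_mat n n" and cM: "cmat M \<in> carrier_mat n n"
    using F M by (simp_all add: cmat_def)
  then have J: "?J \<in> carrier_mat n n" by (intro minus_carrier_mat)
  have Jmult: "?J *\<^sub>v v = s \<cdot>\<^sub>v (cmat F *\<^sub>v v) - cmat M *\<^sub>v v" if v: "v \<in> carrier_vec n" for v
    using F M v by (intro pencil_mult_vec) auto
  have inj: "\<not> gen_eigenvalue F M s"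
  proof
    assume "gen_eigenvalue F M s"
    then obtain v where v: "v \<in> carrier_vec n" and "v \<noteq> 0\<^sub>v n"
      and eq: "cmat M *\<^sub>v v = s \<cdot>\<^sub>v (cmat F *\<^sub>v v)"
      using F unfolding gen_eigenvalue_def by auto
    note this(2)
    moreover have "?J *\<^sub>v v = 0\<^sub>v n" unfolding Jmult[OF v] eq using cF v by simp
    ultimately have "det ?J = 0" using det_0_iff_vec_prod_zero[OF J] v by blast
    then show False using det by blast
  qed
  obtain U V W N where U: "U \<in> carrier_mat n n" and V: "V \<in> carrier_mat n n"
    and W: "W \<in> carrier_mat n n" and N: "N \<in> carrier_mat n n" and ut: "upper_triangular U"
    and VW: "V * W = 1\<^sub>m n" and WV: "W * V = 1\<^sub>m n"
    and NJ: "N * ?J = 1\<^sub>m n" and NF: "N * cmat F = V * U * W"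
    by (rule triangularized_pencil[OF F M inj])
  have JN: "?J * N = 1\<^sub>m n" by (rule mat_mult_left_right_inverse[OF N J NJ])
  have WN: "W * N \<in> carrier_mat n n" using W N by simp
  note dims = F[THEN carrier_matD(1)] F[THEN carrier_matD(2)] M[THEN carrier_matD(1)] M[THEN carrier_matD(2)]
    U[THEN carrier_matD(1)] U[THEN carrier_matD(2)] V[THEN carrier_matD(1)] V[THEN carrier_matD(2)]
    W[THEN carrier_matD(1)] W[THEN carrier_matD(2)] N[THEN carrier_matD(1)] N[THEN carrier_matD(2)]
  obtain z z' where z: "\<And>i. i < n \<Longrightarrow> half_line_deriv (z i) (z' i)"
    and row: "\<And>i t. i < n \<Longrightarrow> t \<ge> 0 \<Longrightarrow> (\<Sum>j = i..<n. U $$ (i, j) * z' j t) =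
        s * (\<Sum>j = i..<n. U $$ (i, j) * z j t) - z i t + ((W * N) *\<^sub>v cvec (f t)) $ i"
    using triangular_dae_solution_exists[of n "\<lambda>i t. ((W * N) *\<^sub>v cvec (f t)) $ i" "\<lambda>i j. U $$ (i, j)" s]
      complexified_signal_smooth[OF WN f] by blast
  define \<zeta> \<zeta>' where "\<zeta> = (\<lambda>t. vec n (\<lambda>i. z i t))" and "\<zeta>' = (\<lambda>t. vec n (\<lambda>i. z' i t))"
  have \<zeta>dim [simp]: "dim_vec (\<zeta> t) = n" "dim_vec (\<zeta>' t) = n" for t by (simp_all add: \<zeta>_def \<zeta>'_def)
  define \<xi> \<xi>' where "\<xi> = (\<lambda>t. V *\<^sub>v \<zeta> t)" and "\<xi>' = (\<lambda>t. V *\<^sub>v \<zeta>' t)"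
  have \<xi>dim [simp]: "dim_vec (\<xi> t) = n" "dim_vec (\<xi>' t) = n" for t by (simp_all add: \<xi>_def \<xi>'_def dims)
  have complex_eq: "cmat F *\<^sub>v \<xi>' t = cmat M *\<^sub>v \<xi> t + cvec (f t)" if t: "t \<ge> 0" for t
  proof -
    have ft: "dim_vec (f t) = n" by (rule smooth_signal_dim[OF f t])
    have "U *\<^sub>v \<zeta>' t = s \<cdot>\<^sub>v (U *\<^sub>v \<zeta> t) - \<zeta> t + (W * N) *\<^sub>v cvec (f t)"
    proof (rule eq_vecI)
      fix i assume "i < dim_vec (s \<cdot>\<^sub>v (U *\<^sub>v \<zeta> t) - \<zeta> t + (W * N) *\<^sub>v cvec (f t))"
      then have i: "i < n" using dims by simp
      have "(U *\<^sub>v \<zeta> t) $ i = (\<Sum>j = i..<n. U $$ (i, j) * z j t)"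
        "(U *\<^sub>v \<zeta>' t) $ i = (\<Sum>j = i..<n. U $$ (i, j) * z' j t)"
        unfolding sum_upper_triangular_row[OF U ut \<zeta>dim(1) i] sum_upper_triangular_row[OF U ut \<zeta>dim(2) i]
        by (auto intro!: sum.cong simp: \<zeta>_def \<zeta>'_def)
      then show "(U *\<^sub>v \<zeta>' t) $ i = (s \<cdot>\<^sub>v (U *\<^sub>v \<zeta> t) - \<zeta> t + (W * N) *\<^sub>v cvec (f t)) $ i"
        using row[OF i t] i by (simp add: dims \<zeta>_def del: index_mult_mat_vec)
    qed (simp add: dims)
    then have "V *\<^sub>v (U *\<^sub>v \<zeta>' t) = s \<cdot>\<^sub>v (V *\<^sub>v (U *\<^sub>v \<zeta> t)) - \<xi> t + V *\<^sub>v (W *\<^sub>v (N *\<^sub>v cvec (f t)))"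
      using ft by (simp add: dims mult_vec_add mult_vec_diff mult_vec_smult mat_vec_assoc \<xi>_def)
    moreover have "V *\<^sub>v (W *\<^sub>v v) = v" if "dim_vec v = n" for v :: "complex vec"
      using VW that by (simp add: dims one_mat_mult_vec flip: mat_vec_assoc)
    moreover have "V *\<^sub>v (U *\<^sub>v v) = N *\<^sub>v (cmat F *\<^sub>v (V *\<^sub>v v))" if v: "dim_vec v = n" for v
    proof -
      have "N * cmat F * V = V * U * (W * V)"
        unfolding NF by (simp add: dims mat_assoc)
      also have "\<dots> = V * U" unfolding WV using U V by simp
      finally have "(N * cmat F * V) *\<^sub>v v = (V * U) *\<^sub>v v" by simp
      then show ?thesis using v by (simp add: dims mat_vec_assoc)
    qed
    ultimately have eqN: "N *\<^sub>v (cmat F *\<^sub>v \<xi>' t) = s \<cdot>\<^sub>v (N *\<^sub>v (cmat F *\<^sub>v \<xi> t)) - \<xi> t + N *\<^sub>v cvec (f t)"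
      using ft by (simp add: dims \<xi>_def \<xi>'_def)
    have JNv: "?J *\<^sub>v (N *\<^sub>v v) = v" if "dim_vec v = n" for v
      using JN that by (simp add: dims one_mat_mult_vec flip: mat_vec_assoc)
    have "cmat F *\<^sub>v \<xi>' t = ?J *\<^sub>v (N *\<^sub>v (cmat F *\<^sub>v \<xi>' t))" by (simp add: JNv dims)
    also have "\<dots> = s \<cdot>\<^sub>v (cmat F *\<^sub>v \<xi> t) - ?J *\<^sub>v \<xi> t + cvec (f t)"
      unfolding eqN using ft by (simp add: dims mult_vec_add mult_vec_diff mult_vec_smult JNv)
    also have "?J *\<^sub>v \<xi> t = s \<cdot>\<^sub>v (cmat F *\<^sub>v \<xi> t) - cmat M *\<^sub>v \<xi> t"
      by (rule Jmult) (rule carrier_vecI, simp)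
    finally have *: "cmat F *\<^sub>v \<xi>' t = s \<cdot>\<^sub>v (cmat F *\<^sub>v \<xi> t) - (s \<cdot>\<^sub>v (cmat F *\<^sub>v \<xi> t) - cmat M *\<^sub>v \<xi> t)
        + cvec (f t)" .
    show ?thesis
      by (subst *, rule eq_vecI) (simp_all add: dims ft del: index_mult_mat_vec)
  qed
  let ?x = "\<lambda>t. vec n (\<lambda>i. Re (\<xi> t $ i))" and ?x' = "\<lambda>t. vec n (\<lambda>i. Re (\<xi>' t $ i))"
  have "has_signal_deriv n ?x ?x'"
    unfolding has_signal_deriv_iff
  proof (intro conjI allI impI)
    fix i assume i: "i < n"
    have "half_line_deriv (\<lambda>t. Re (\<Sum>j<n. V $$ (i, j) * z j t)) (\<lambda>t. Re (\<Sum>j<n. V $$ (i, j) * z' j t))"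
      by (intro half_line_deriv_bounded_linear[OF bounded_linear_Re] half_line_deriv_sum
          half_line_deriv_mult_left z) simp
    then show "half_line_deriv (\<lambda>t. ?x t $ i) (\<lambda>t. ?x' t $ i)"
      by (rule half_line_deriv_cong)
        (use i in \<open>simp_all add: \<xi>_def \<xi>'_def \<zeta>_def \<zeta>'_def dims mult_vec_component del: index_mult_mat_vec\<close>)
  qed auto
  moreover have "F *\<^sub>v ?x' t = M *\<^sub>v ?x t + f t" if t: "t \<ge> 0" for t
  proof (rule eq_vecI)
    have ft: "dim_vec (f t) = n" by (rule smooth_signal_dim[OF f t])
    fix i assume "i < dim_vec (M *\<^sub>v ?x t + f t)"
    then have i: "i < n" by (simp add: ft)
    have re: "Re ((cmat H *\<^sub>v v) $ i) = (H *\<^sub>v vec n (\<lambda>i. Re (v $ i))) $ i"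
      if "H \<in> carrier_mat n n" "dim_vec v = n" for H v
      using that i by (simp add: mult_vec_component cmat_def del: index_mult_mat_vec)
    have "Re ((cmat F *\<^sub>v \<xi>' t) $ i) = Re ((cmat M *\<^sub>v \<xi> t) $ i) + f t $ i"
      unfolding complex_eq[OF t] using i ft by (simp add: dims del: index_mult_mat_vec)
    then show "(F *\<^sub>v ?x' t) $ i = (M *\<^sub>v ?x t + f t) $ i"
      using re[OF F] re[OF M] i ft dims by (simp del: index_mult_mat_vec)
  qed (use smooth_signal_dim[OF f t] dims in simp)
  ultimately show ?thesis by blast
qed

section \<open>Subspaces and orthonormal bases\<close>

lemma is_subspaceI:
  assumes "S \<subseteq> carrier_vec n" "0\<^sub>v n \<in> S"
    and "\<And>v w. v \<in> S \<Longrightarrow> w \<in> S \<Longrightarrow> v + w \<in> S" "\<And>c v. v \<in> S \<Longrightarrow> c \<cdot>\<^sub>v v \<in> S"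
  shows "is_subspace n S"
proof -
  interpret vec_space "TYPE(real)" n .
  have "submodule class_ring S V"
    by (unfold_locales) (use assms in \<open>auto simp: module_vec_simps\<close>)
  then show ?thesis
    unfolding is_subspace_def subspace_def using vectorspace_axioms by blast
qed

lemma is_subspace_zero:
  assumes "is_subspace n S"
  shows "0\<^sub>v n \<in> S"
proof -
  interpret vec_space "TYPE(real)" n .
  have sub: "submodule class_ring S V" using assms by (simp add: is_subspace_def subspace_def)
  show "0\<^sub>v n \<in> S" using submodule.zero_closed[OF sub] by simp
qed

lemma orthonormal_basis_mem:
  assumes "orthonormal_basis n S bs" "b \<in> set bs"
  shows "b \<in> S"
proof -
  interpret vec_space "TYPE(real)" n .
  show ?thesis using assms in_own_span[of "set bs"] unfolding orthonormal_basis_def by auto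
qed

lemma scalar_prod_zero_on_orthonormal_basis:
  assumes S: "orthonormal_basis n S bs" and x: "x \<in> carrier_vec n"
    and orth: "\<And>b. b \<in> set bs \<Longrightarrow> x \<bullet> b = 0" and v: "v \<in> S"
  shows "x \<bullet> v = 0"
proof -
  interpret vec_space "TYPE(real)" n .
  let ?W = "{v \<in> carrier_vec n. x \<bullet> v = 0}"
  have "is_subspace n ?W"
    using x by (intro is_subspaceI) (auto simp: scalar_prod_add_distrib[of _ n])
  then have "submodule class_ring ?W V" by (simp add: is_subspace_def subspace_def)
  moreover have "set bs \<subseteq> ?W" using S orth by (auto simp: orthonormal_basis_def)
  ultimately have "span (set bs) \<subseteq> ?W" by (intro span_is_subset)
  then show ?thesis using S v by (auto simp: orthonormal_basis_def)
qed

text \<open>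
An orthonormal basis of the complement detects membership in \<open>S\<close>.  Since both spanning lists are given, the
decomposition of the space into \<open>S\<close> and its complement is obtained without counting dimensions.
\<close>

lemma orthonormal_expansion:
  assumes S: "orthonormal_basis n S bs" and Sc: "orthonormal_basis n (orth_compl n S) cs"
    and h: "h \<in> carrier_vec n" and orth: "\<And>c. c \<in> set cs \<Longrightarrow> c \<bullet> h = 0"
  shows "h = vec n (\<lambda>i. \<Sum>j<length bs. (bs ! j \<bullet> h) * bs ! j $ i)"
proof -
  define \<sigma> where "\<sigma> = vec n (\<lambda>i. \<Sum>j<length bs. (bs ! j \<bullet> h) * bs ! j $ i)"
  have \<sigma>: "\<sigma> \<in> carrier_vec n" by (simp add: \<sigma>_def)
  have bs: "bs ! j \<in> carrier_vec n" if "j < length bs" for j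
    using S that nth_mem by (fastforce simp: orthonormal_basis_def)
  have cs: "c \<in> carrier_vec n" if "c \<in> set cs" for c
    using Sc that by (auto simp: orthonormal_basis_def)
  have \<sigma>_prod: "x \<bullet> \<sigma> = (\<Sum>j<length bs. (bs ! j \<bullet> h) * (x \<bullet> bs ! j))" if "x \<in> carrier_vec n" for x
  proof -
    have "x \<bullet> \<sigma> = (\<Sum>i<n. \<Sum>j<length bs. x $ i * ((bs ! j \<bullet> h) * bs ! j $ i))"
      by (simp add: \<sigma>_def scalar_prod_def atLeast0LessThan sum_distrib_left)
    also have "\<dots> = (\<Sum>j<length bs. \<Sum>i<n. x $ i * ((bs ! j \<bullet> h) * bs ! j $ i))"
      by (rule sum.swap)
    also have "\<dots> = (\<Sum>j<length bs. (bs ! j \<bullet> h) * (x \<bullet> bs ! j))"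
    proof (rule sum.cong[OF refl])
      fix j assume "j \<in> {..<length bs}"
      then have "dim_vec (bs ! j) = n" using bs by auto
      then show "(\<Sum>i<n. x $ i * ((bs ! j \<bullet> h) * bs ! j $ i)) = (bs ! j \<bullet> h) * (x \<bullet> bs ! j)"
        by (simp only: scalar_prod_def[of x] atLeast0LessThan sum_distrib_left mult.left_commute)
    qed
    finally show ?thesis .
  qed
  have sub: "h - \<sigma> \<in> carrier_vec n" using h \<sigma> by simp
  \<comment> \<open>\<open>h - \<sigma>\<close> is orthogonal to \<open>S\<close>, hence in its complement, and also to that complement\<close>
  have b_orth: "(h - \<sigma>) \<bullet> b = 0" if b: "b \<in> set bs" for b
  proof -
    obtain i where i: "i < length bs" "b = bs ! i" using b by (metis in_set_conv_nth)
    have "b \<bullet> \<sigma> = (\<Sum>j<length bs. (bs ! j \<bullet> h) * (if i = j then 1 else 0))"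
      using \<sigma>_prod[OF bs[OF i(1)]] S i by (simp add: orthonormal_basis_def)
    also have "\<dots> = b \<bullet> h" using i by (simp add: if_distrib sum.delta' cong: if_cong)
    finally have "b \<bullet> (h - \<sigma>) = 0"
      using scalar_prod_minus_distrib[OF bs[OF i(1)] h \<sigma>] i by simp
    then show ?thesis using comm_scalar_prod[OF sub bs[OF i(1)]] i by simp
  qed
  have "h - \<sigma> \<in> orth_compl n S"
    using scalar_prod_zero_on_orthonormal_basis[OF S sub b_orth] sub by (simp add: orth_compl_def)
  moreover have "(h - \<sigma>) \<bullet> c = 0" if c: "c \<in> set cs" for c
  proof -
    have "c \<bullet> bs ! j = 0" if "j < length bs" for j
      using orthonormal_basis_mem[OF Sc c] orthonormal_basis_mem[OF S nth_mem[OF that]]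
      by (simp add: orth_compl_def)
    then have "c \<bullet> \<sigma> = 0" using \<sigma>_prod[OF cs[OF c]] by simp
    then have "c \<bullet> (h - \<sigma>) = 0"
      using scalar_prod_minus_distrib[OF cs[OF c] h \<sigma>] orth[OF c] by simp
    then show ?thesis using comm_scalar_prod[OF sub cs[OF c]] by simp
  qed
  ultimately have "(h - \<sigma>) \<bullet> (h - \<sigma>) = 0"
    using scalar_prod_zero_on_orthonormal_basis[OF Sc sub] by blast
  then have "(\<Sum>i<n. (h - \<sigma>) $ i * (h - \<sigma>) $ i) = 0"
    using \<sigma> by (simp add: scalar_prod_def atLeast0LessThan)
  then have "\<forall>i\<in>{..<n}. (h - \<sigma>) $ i * (h - \<sigma>) $ i = 0"
    by (subst (asm) sum_nonneg_eq_0_iff) auto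
  then have "h - \<sigma> = 0\<^sub>v n" using \<sigma> by (intro eq_vecI) auto
  then show ?thesis using vec_minus_eq_zero_iff[OF h \<sigma>] by (simp add: \<sigma>_def)
qed

section \<open>The minimal conditioned invariant subspace as a reachable set\<close>

text \<open>
The inductive definition replaces the limit of the increasing sequence \<open>S\<^sub>0 = 0\<close>,
\<open>S\<^sub>i\<^sub>+\<^sub>1 = [A B] ((E\<^sup>-\<^sup>1 S\<^sub>i \<times> \<real>\<^sup>q) \<inter> Ker [C 0])\<close>; rule induction follows the steps of
this sequence.
\<close>

inductive_set impulse_reachable :: "real mat \<Rightarrow> real mat \<Rightarrow> real mat \<Rightarrow> real mat \<Rightarrow> real vec set"
  for E A B C where
  zero: "0\<^sub>v (dim_row A) \<in> impulse_reachable E A B C"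
| step: "x \<in> carrier_vec (dim_col A) \<Longrightarrow> v \<in> carrier_vec (dim_col B) \<Longrightarrow> C *\<^sub>v x = 0\<^sub>v (dim_row C) \<Longrightarrow>
    E *\<^sub>v x \<in> impulse_reachable E A B C \<Longrightarrow> A *\<^sub>v x + B *\<^sub>v v \<in> impulse_reachable E A B C"

context
  fixes n p q :: nat and E A B C :: "real mat"
  assumes E: "E \<in> carrier_mat n n" and A: "A \<in> carrier_mat n n"
    and B: "B \<in> carrier_mat n q" and C: "C \<in> carrier_mat p n"
begin

lemma impulse_reachable_carrier: "s \<in> impulse_reachable E A B C \<Longrightarrow> s \<in> carrier_vec n"
  by (induct rule: impulse_reachable.induct) (use A B in auto)

lemma impulse_reachable_step:
  assumes "x \<in> carrier_vec n" "v \<in> carrier_vec q" "C *\<^sub>v x = 0\<^sub>v p" "E *\<^sub>v x \<in> impulse_reachable E A B C"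
  shows "A *\<^sub>v x + B *\<^sub>v v \<in> impulse_reachable E A B C"
  by (rule impulse_reachable.step) (use assms A B C in auto)

lemma impulse_reachable_add:
  assumes "s \<in> impulse_reachable E A B C" "s' \<in> impulse_reachable E A B C"
  shows "s + s' \<in> impulse_reachable E A B C"
  using assms
proof (induct arbitrary: s' rule: impulse_reachable.induct)
  case zero
  then show ?case using impulse_reachable_carrier[OF zero] A by simp
next
  case (step x v)
  from step.prems show ?case
  proof (cases rule: impulse_reachable.cases)
    case zero
    then show ?thesis
      using impulse_reachable.step[OF step.hyps(1-4)] impulse_reachable_carrier A
      by (metis carrier_matD(1) right_zero_vec)
  next
    case (step y w)
    note 1 = \<open>x \<in> carrier_vec (dim_col A)\<close> \<open>v \<in> carrier_vec (dim_col B)\<close> \<open>C *\<^sub>v x = 0\<^sub>v (dim_row C)\<close>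
    have xy: "x \<in> carrier_vec n" "y \<in> carrier_vec n" "v \<in> carrier_vec q" "w \<in> carrier_vec q"
      using 1 step A B by auto
    note d = xy[THEN carrier_vecD]
    have "A *\<^sub>v (x + y) + B *\<^sub>v (v + w) \<in> impulse_reachable E A B C"
    proof (rule impulse_reachable_step)
      show "C *\<^sub>v (x + y) = 0\<^sub>v p" using C 1(3) step(4) d by (simp add: mult_vec_add)
      show "E *\<^sub>v (x + y) \<in> impulse_reachable E A B C"
        using \<open>\<And>s'. s' \<in> impulse_reachable E A B C \<Longrightarrow> E *\<^sub>v x + s' \<in> impulse_reachable E A B C\<close>[OF step(5)]
          E d by (simp add: mult_vec_add)
    qed (use xy in auto)
    moreover have "A *\<^sub>v (x + y) + B *\<^sub>v (v + w) = (A *\<^sub>v x + B *\<^sub>v v) + s'"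
      unfolding step(1) using A B d
      by (intro eq_vecI) (simp_all add: mult_vec_add del: index_mult_mat_vec)
    ultimately show ?thesis by simp
  qed
qed

lemma impulse_reachable_smult:
  assumes "s \<in> impulse_reachable E A B C"
  shows "c \<cdot>\<^sub>v s \<in> impulse_reachable E A B C"
  using assms
proof (induct rule: impulse_reachable.induct)
  case zero
  show ?case using impulse_reachable.zero[of A E B C] by (simp add: smult_zero_vec_eq)
next
  case (step x v)
  then have xv: "x \<in> carrier_vec n" "v \<in> carrier_vec q" using A B by auto
  note d = xv[THEN carrier_vecD]
  have "A *\<^sub>v (c \<cdot>\<^sub>v x) + B *\<^sub>v (c \<cdot>\<^sub>v v) \<in> impulse_reachable E A B C"
  proof (rule impulse_reachable_step)
    show "C *\<^sub>v (c \<cdot>\<^sub>v x) = 0\<^sub>v p" using C step(3) d by (simp add: mult_vec_smult smult_zero_vec_eq)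
    show "E *\<^sub>v (c \<cdot>\<^sub>v x) \<in> impulse_reachable E A B C" using E step(5) d by (simp add: mult_vec_smult)
  qed (use xv in auto)
  moreover have "A *\<^sub>v (c \<cdot>\<^sub>v x) + B *\<^sub>v (c \<cdot>\<^sub>v v) = c \<cdot>\<^sub>v (A *\<^sub>v x + B *\<^sub>v v)"
    using A B d by (intro eq_vecI) (simp_all add: mult_vec_smult distrib_left del: index_mult_mat_vec)
  ultimately show ?case by simp
qed

lemma impulse_reachable_subspace: "is_subspace n (impulse_reachable E A B C)"
proof (rule is_subspaceI)
  show "0\<^sub>v n \<in> impulse_reachable E A B C" using impulse_reachable.zero[of A E B C] A by simp
qed (auto simp: impulse_reachable_carrier impulse_reachable_add impulse_reachable_smult)

text \<open>
Together with being a subspace, this makes the set a competitor in the minimality of \<open>S\<close>.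
\<close>

lemma impulse_reachable_fixed_point:
  "impulse_reachable E A B C = {A *\<^sub>v x + B *\<^sub>v v | x v. x \<in> carrier_vec n \<and> v \<in> carrier_vec q \<and>
     C *\<^sub>v x = 0\<^sub>v p \<and> E *\<^sub>v x \<in> impulse_reachable E A B C}" (is "?R = ?T")
proof
  show "?R \<subseteq> ?T"
  proof
    fix s assume "s \<in> ?R"
    then show "s \<in> ?T"
    proof (cases rule: impulse_reachable.cases)
      case zero
      have "E *\<^sub>v 0\<^sub>v n \<in> ?R" using impulse_reachable.zero[of A E B C] A E by (simp add: mult_zero_vec_eq)
      moreover have "s = A *\<^sub>v 0\<^sub>v n + B *\<^sub>v 0\<^sub>v q" using zero A B by (simp add: mult_zero_vec_eq)
      moreover have "C *\<^sub>v 0\<^sub>v n = 0\<^sub>v p" using C by (simp add: mult_zero_vec_eq)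
      ultimately show ?thesis by (metis (mono_tags, lifting) mem_Collect_eq zero_carrier_vec)
    next
      case (step x v)
      then show ?thesis using A B C by auto
    qed
  qed
  show "?T \<subseteq> ?R" using impulse_reachable_step by auto
qed

text \<open>
The forcing \<open>g s\<close> can be compensated by a state that does not show in the output \<open>C z\<close>.  By induction: for
\<open>s = A x + B v\<close> the state \<open>- g x\<close> and the input \<open>- g v\<close> turn the forcing \<open>g s\<close> into
\<open>g' (E x)\<close>, and \<open>E x\<close> has been reached before \<open>s\<close>.  Each step costs one derivative of \<open>g\<close>, which is
why smoothness is required.
\<close>

lemma impulse_reachable_absorbs_scalar:
  assumes "s \<in> impulse_reachable E A B C" "smooth_fun g"
  shows "\<exists>z z' v. smooth_signal n z \<and> has_signal_deriv n z z' \<and> smooth_signal q v \<and>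
    (\<forall>t \<ge> 0. C *\<^sub>v z t = 0\<^sub>v p \<and> E *\<^sub>v z' t = A *\<^sub>v z t + B *\<^sub>v v t + g t \<cdot>\<^sub>v s)"
  using assms
proof (induct arbitrary: g rule: impulse_reachable.induct)
  case zero
  have z: "smooth_signal m (\<lambda>t. 0\<^sub>v m)" for m
    by (auto simp: smooth_signal_iff smooth_fun_zero)
  have z': "has_signal_deriv n (\<lambda>t. 0\<^sub>v n) (\<lambda>t. 0\<^sub>v n)"
    by (auto simp: has_signal_deriv_iff half_line_deriv_const)
  have "C *\<^sub>v 0\<^sub>v n = 0\<^sub>v p \<and> E *\<^sub>v 0\<^sub>v n = A *\<^sub>v 0\<^sub>v n + B *\<^sub>v 0\<^sub>v q + g t \<cdot>\<^sub>v 0\<^sub>v (dim_row A)" for t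
    using A B C E by (simp add: mult_zero_vec_eq smult_zero_vec_eq)
  then show ?case using z[of n] z[of q] z' by blast
next
  case (step x v)
  then have xv: "x \<in> carrier_vec n" "v \<in> carrier_vec q" using A B by auto
  note d = xv[THEN carrier_vecD]
  obtain g' where g': "smooth_fun g'" "half_line_deriv g g'"
    using smooth_fun_imp_deriv[OF step.prems] by blast
  obtain z z' w where z: "smooth_signal n z" and z': "has_signal_deriv n z z'" and w: "smooth_signal q w"
    and eq: "\<And>t. t \<ge> 0 \<Longrightarrow> C *\<^sub>v z t = 0\<^sub>v p"
      "\<And>t. t \<ge> 0 \<Longrightarrow> E *\<^sub>v z' t = A *\<^sub>v z t + B *\<^sub>v w t + g' t \<cdot>\<^sub>v (E *\<^sub>v x)"
    using step(5)[OF g'(1)] by blast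
  show ?case
  proof (intro exI conjI allI impI)
    \<comment> \<open>\<open>z - g x\<close> and \<open>w - g v\<close> cancel the forcing \<open>g (A x + B v)\<close>; the derivative of \<open>- g x\<close> leaves the
      forcing \<open>g' (E x)\<close>, which \<open>z\<close> and \<open>w\<close> absorb\<close>
    show "smooth_signal n (\<lambda>t. z t - g t \<cdot>\<^sub>v x)"
      by (intro smooth_signal_diff z smooth_signal_scale step.prems xv)
    show "has_signal_deriv n (\<lambda>t. z t - g t \<cdot>\<^sub>v x) (\<lambda>t. z' t - g' t \<cdot>\<^sub>v x)"
      by (intro has_signal_deriv_diff z' has_signal_deriv_scale g' xv)
    show "smooth_signal q (\<lambda>t. w t - g t \<cdot>\<^sub>v v)"
      by (intro smooth_signal_diff w smooth_signal_scale step.prems xv)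
    fix t :: real assume t: "t \<ge> 0"
    note d = d smooth_signal_dim[OF z t] smooth_signal_dim[OF w t] has_signal_deriv_dim[OF z' t]
    note dims = d E[THEN carrier_matD(1)] E[THEN carrier_matD(2)] A[THEN carrier_matD(1)] A[THEN carrier_matD(2)]
      B[THEN carrier_matD(1)] B[THEN carrier_matD(2)] C[THEN carrier_matD(1)] C[THEN carrier_matD(2)]
    show "C *\<^sub>v (z t - g t \<cdot>\<^sub>v x) = 0\<^sub>v p"
      using eq(1)[OF t] step(3) by (simp add: dims mult_vec_diff mult_vec_smult smult_zero_vec_eq)
    show "E *\<^sub>v (z' t - g' t \<cdot>\<^sub>v x)
        = A *\<^sub>v (z t - g t \<cdot>\<^sub>v x) + B *\<^sub>v (w t - g t \<cdot>\<^sub>v v) + g t \<cdot>\<^sub>v (A *\<^sub>v x + B *\<^sub>v v)"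
      by (rule eq_vecI)
        (simp_all add: dims mult_vec_diff mult_vec_smult eq(2)[OF t] distrib_left del: index_mult_mat_vec)
  qed
qed

lemma impulse_reachable_absorbs:
  fixes k :: nat
  assumes b: "\<And>j. j < k \<Longrightarrow> b j \<in> impulse_reachable E A B C" and g: "\<And>j. j < k \<Longrightarrow> smooth_fun (g j)"
  shows "\<exists>z z' v. smooth_signal n z \<and> has_signal_deriv n z z' \<and> smooth_signal q v \<and>
    (\<forall>t \<ge> 0. C *\<^sub>v z t = 0\<^sub>v p \<and>
      E *\<^sub>v z' t = A *\<^sub>v z t + B *\<^sub>v v t + vec n (\<lambda>i. \<Sum>j<k. g j t * b j $ i))"
  using assms
proof (induct k)
  case 0
  have "0 \<cdot>\<^sub>v 0\<^sub>v (dim_row A) = vec n (\<lambda>i. \<Sum>j<0. g j t * b j $ i)" for t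
    using A by (intro eq_vecI) auto
  then show ?case
    using impulse_reachable_absorbs_scalar[OF impulse_reachable.zero smooth_fun_zero] by simp
next
  case (Suc k)
  obtain z1 z1' v1 where 1: "smooth_signal n z1" "has_signal_deriv n z1 z1'" "smooth_signal q v1"
    "\<And>t. t \<ge> 0 \<Longrightarrow> C *\<^sub>v z1 t = 0\<^sub>v p"
    "\<And>t. t \<ge> 0 \<Longrightarrow> E *\<^sub>v z1' t = A *\<^sub>v z1 t + B *\<^sub>v v1 t + vec n (\<lambda>i. \<Sum>j<k. g j t * b j $ i)"
    using Suc.hyps[OF Suc.prems(1)[OF less_SucI] Suc.prems(2)[OF less_SucI]] by blast
  obtain z2 z2' v2 where 2: "smooth_signal n z2" "has_signal_deriv n z2 z2'" "smooth_signal q v2"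
    "\<And>t. t \<ge> 0 \<Longrightarrow> C *\<^sub>v z2 t = 0\<^sub>v p"
    "\<And>t. t \<ge> 0 \<Longrightarrow> E *\<^sub>v z2' t = A *\<^sub>v z2 t + B *\<^sub>v v2 t + g k t \<cdot>\<^sub>v b k"
    using impulse_reachable_absorbs_scalar[of "b k" "g k"] Suc.prems by blast
  show ?case
  proof (intro exI conjI allI impI)
    show "smooth_signal n (\<lambda>t. z1 t + z2 t)" by (rule smooth_signal_add[OF 1(1) 2(1)])
    show "has_signal_deriv n (\<lambda>t. z1 t + z2 t) (\<lambda>t. z1' t + z2' t)" by (rule has_signal_deriv_add[OF 1(2) 2(2)])
    show "smooth_signal q (\<lambda>t. v1 t + v2 t)" by (rule smooth_signal_add[OF 1(3) 2(3)])
    fix t :: real assume t: "t \<ge> 0"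
    have bk: "dim_vec (b k) = n" using impulse_reachable_carrier Suc.prems(1) by auto
    note dims = smooth_signal_dim[OF 1(1) t] smooth_signal_dim[OF 1(3) t] has_signal_deriv_dim(2)[OF 1(2) t]
      smooth_signal_dim[OF 2(1) t] smooth_signal_dim[OF 2(3) t] has_signal_deriv_dim(2)[OF 2(2) t] bk
      E[THEN carrier_matD(1)] E[THEN carrier_matD(2)] A[THEN carrier_matD(1)] A[THEN carrier_matD(2)]
      B[THEN carrier_matD(1)] B[THEN carrier_matD(2)] C[THEN carrier_matD(1)] C[THEN carrier_matD(2)]
    show "C *\<^sub>v (z1 t + z2 t) = 0\<^sub>v p"
      using 1(4)[OF t] 2(4)[OF t] by (simp add: dims mult_vec_add)
    show "E *\<^sub>v (z1' t + z2' t) = A *\<^sub>v (z1 t + z2 t) + B *\<^sub>v (v1 t + v2 t) +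
        vec n (\<lambda>i. \<Sum>j<Suc k. g j t * b j $ i)"
      by (rule eq_vecI)
        (simp_all add: dims mult_vec_add 1(5)[OF t] 2(5)[OF t] del: index_mult_mat_vec)
  qed
qed

end

section \<open>Attack signatures\<close>

lemma hcat_carrier:
  assumes "M \<in> carrier_mat r a" "N \<in> carrier_mat r b"
  shows "hcat M N \<in> carrier_mat r (a + b)"
  using assms by (auto simp: hcat_def)

lemma hcat_mult_append:
  assumes M: "M \<in> carrier_mat r a" and N: "N \<in> carrier_mat r b"
    and x: "x \<in> carrier_vec a" and y: "y \<in> carrier_vec b"
  shows "hcat M N *\<^sub>v (x @\<^sub>v y) = M *\<^sub>v x + N *\<^sub>v y"
proof -
  have "hcat M N *\<^sub>v (x @\<^sub>v y) = (M *\<^sub>v x + N *\<^sub>v y) @\<^sub>v (0\<^sub>m 0 a *\<^sub>v x + 0\<^sub>m 0 b *\<^sub>v y)"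
    unfolding hcat_def using M N four_block_mat_mult_vec[OF M N zero_carrier_mat zero_carrier_mat x y]
    by simp
  then show ?thesis using M N by (auto intro!: eq_vecI)
qed

lemma B_mat_carrier: "B_mat n p \<in> carrier_mat n (n + p)"
  unfolding B_mat_def by (rule hcat_carrier) auto

lemma D_mat_carrier: "D_mat n p \<in> carrier_mat p (n + p)"
  unfolding D_mat_def by (rule hcat_carrier) auto

lemma card_restrict: "K \<subseteq> {..<m} \<Longrightarrow> card {j. j < m \<and> j \<in> K} = card K"
  by (rule arg_cong[of _ _ card]) auto

lemma col_sub_carrier:
  assumes "M \<in> carrier_mat r m" "K \<subseteq> {..<m}"
  shows "col_sub M K \<in> carrier_mat r (card K)"
  using assms card_restrict[of K m] by (auto simp: col_sub_def dim_submatrix)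

lemma pick_less: "K \<subseteq> {..<m} \<Longrightarrow> j < card K \<Longrightarrow> pick K j < m"
  using pick_in_set_le by blast

lemma col_sub_index:
  assumes "M \<in> carrier_mat r m" "K \<subseteq> {..<m}" "i < r" "j < card K"
  shows "col_sub M K $$ (i, j) = M $$ (i, pick K j)"
  using assms card_restrict[of K m] unfolding col_sub_def
  by (subst submatrix_index) (auto simp: pick_UNIV)

text \<open>
The selection matrix on the right-hand side also embeds attack modes into the space of full inputs
(\<open>embed_sub_vec\<close>).
\<close>

lemma col_sub_eq_mult:
  fixes M :: "real mat"
  assumes M: "M \<in> carrier_mat r m" and K: "K \<subseteq> {..<m}"
  shows "col_sub M K = M * col_sub (1\<^sub>m m) K"
proof (rule eq_matI)
  have c: "col_sub M K \<in> carrier_mat r (card K)" "col_sub (1\<^sub>m m) K \<in> carrier_mat m (card K)"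
    using col_sub_carrier[OF M K] col_sub_carrier[OF one_carrier_mat K] by blast+
  fix i j assume "i < dim_row (M * col_sub (1\<^sub>m m) K)" "j < dim_col (M * col_sub (1\<^sub>m m) K)"
  then have i: "i < r" and j: "j < card K" using M c by auto
  have "(M * col_sub (1\<^sub>m m) K) $$ (i, j) = (\<Sum>k<m. M $$ (i, k) * col_sub (1\<^sub>m m) K $$ (k, j))"
    using M c i j by (simp add: scalar_prod_def atLeast0LessThan)
  also have "\<dots> = (\<Sum>k<m. if k = pick K j then M $$ (i, k) else 0)"
    using pick_less[OF K j] by (intro sum.cong) (auto simp: col_sub_index[OF one_carrier_mat K _ j])
  also have "\<dots> = M $$ (i, pick K j)" using pick_less[OF K j] by simp
  finally show "col_sub M K $$ (i, j) = (M * col_sub (1\<^sub>m m) K) $$ (i, j)"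
    using col_sub_index[OF M K i j] by simp
qed (use col_sub_carrier[OF M K] col_sub_carrier[OF one_carrier_mat K] M in auto)

lemma sub_vec_carrier:
  assumes "dim_vec v = m" "K \<subseteq> {..<m}"
  shows "sub_vec v K \<in> carrier_vec (card K)"
  using assms card_restrict[of K m] by (auto simp: sub_vec_def intro: carrier_vecI)

lemma smooth_signal_sub_vec:
  assumes u: "smooth_signal m u" and K: "K \<subseteq> {..<m}"
  shows "smooth_signal (card K) (\<lambda>t. sub_vec (u t) K)"
  unfolding smooth_signal_iff
proof (intro conjI allI impI)
  fix j assume j: "j < card K"
  have "smooth_fun (\<lambda>t. u t $ pick K j)"
    using u pick_less[OF K j] by (simp add: smooth_signal_iff)
  then show "smooth_fun (\<lambda>t. sub_vec (u t) K $ j)"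
    by (rule smooth_fun_cong)
      (use j card_restrict[OF K] smooth_signal_dim[OF u] in \<open>simp add: sub_vec_def\<close>)
qed (use sub_vec_carrier[OF smooth_signal_dim[OF u] K] in blast)

lemma embed_index:
  fixes v :: "real vec"
  assumes K: "K \<subseteq> {..<m}" and v: "dim_vec v = card K" and i: "i < m"
  shows "(col_sub (1\<^sub>m m) K *\<^sub>v v) $ i = (\<Sum>j<card K. if i = pick K j then v $ j else 0)"
proof -
  have c: "col_sub (1\<^sub>m m) K \<in> carrier_mat m (card K)" by (rule col_sub_carrier[OF one_carrier_mat K])
  have "(col_sub (1\<^sub>m m) K *\<^sub>v v) $ i = (\<Sum>j<card K. col_sub (1\<^sub>m m) K $$ (i, j) * v $ j)"
    using c v i by (simp add: mult_vec_component del: index_mult_mat_vec)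
  also have "\<dots> = (\<Sum>j<card K. if i = pick K j then v $ j else 0)"
    using i pick_less[OF K] by (intro sum.cong) (auto simp: col_sub_index[OF one_carrier_mat K i])
  finally show ?thesis .
qed

lemma embed_sub_vec:
  fixes u :: "real vec"
  assumes K: "K \<subseteq> {..<m}" and u: "dim_vec u = m" and supp: "\<And>i. i < m \<Longrightarrow> i \<notin> K \<Longrightarrow> u $ i = 0"
  shows "col_sub (1\<^sub>m m) K *\<^sub>v sub_vec u K = u"
proof (rule eq_vecI)
  have sv: "dim_vec (sub_vec u K) = card K" using sub_vec_carrier[OF u K] by simp
  fix i assume "i < dim_vec u"
  then have i: "i < m" using u by simp
  have inj: "j = j'" if "j < card K" "j' < card K" "pick K j = pick K j'" for j j'
    using card_pick_le that by metis
  have "(col_sub (1\<^sub>m m) K *\<^sub>v sub_vec u K) $ i = (\<Sum>j<card K. if i = pick K j then u $ i else 0)"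
    unfolding embed_index[OF K sv i]
    by (intro sum.cong) (use card_restrict[OF K] u in \<open>auto simp: sub_vec_def\<close>)
  also have "\<dots> = u $ i"
  proof (cases "i \<in> K")
    case True
    have fin: "finite K" using K finite_subset by blast
    have "{a \<in> K. a < i} \<subset> K" using True by auto
    then have "card {a \<in> K. a < i} < card K" using fin by (rule psubset_card_mono[rotated])
    moreover have "pick K (card {a \<in> K. a < i}) = i" by (rule pick_card_in_set[OF True])
    ultimately obtain j0 where j0: "j0 < card K" "pick K j0 = i" by blast
    then have "(\<Sum>j<card K. if i = pick K j then u $ i else 0) = (\<Sum>j<card K. if j = j0 then u $ i else 0)"
      using inj by (intro sum.cong) auto
    then show ?thesis using j0 by simp
  next
    case False
    then have "i \<noteq> pick K j" if "j < card K" for j using pick_in_set_le[OF that] by auto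
    then show ?thesis using supp[OF i False] by simp
  qed
  finally show "(col_sub (1\<^sub>m m) K *\<^sub>v sub_vec u K) $ i = u $ i" .
qed (use u col_sub_carrier[OF one_carrier_mat K] in auto)

lemma mult_eq_col_sub_mult:
  fixes M :: "real mat"
  assumes M: "M \<in> carrier_mat r m" and K: "K \<subseteq> {..<m}"
    and u: "dim_vec u = m" and supp: "\<And>i. i < m \<Longrightarrow> i \<notin> K \<Longrightarrow> u $ i = 0"
  shows "M *\<^sub>v u = col_sub M K *\<^sub>v sub_vec u K"
  unfolding col_sub_eq_mult[OF M K]
  using embed_sub_vec[OF K u supp] M col_sub_carrier[OF one_carrier_mat K] sub_vec_carrier[OF u K]
  by (simp add: mat_vec_assoc)

text \<open>
If \<open>x\<close> is a trajectory of the plant under the attack \<open>u\<close>, then \<open>x + d\<close> is one under an attack supported in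
\<open>K\<close>, with the same output.  Equal cardinality and \<open>K \<noteq> R\<close> exclude that the support is \<open>R\<close>.
\<close>

lemma plant_difference_imp_unidentifiable:
  assumes E: "E \<in> carrier_mat n n" and A: "A \<in> carrier_mat n n" and C: "C \<in> carrier_mat p n"
    and K: "K \<subseteq> {..<n + p}" and R: "R \<subseteq> {..<n + p}" and card: "card K = card R" and neq: "K \<noteq> R"
    and u: "smooth_signal (n + p) u" and attack: "attacked_exactly_on (n + p) R u"
    and reg: "regular_pencil E A"
    and d: "has_signal_deriv n d d'" and v: "smooth_signal (card K) v"
    and state: "\<And>t. t \<ge> 0 \<Longrightarrow>
      E *\<^sub>v d' t = A *\<^sub>v d t + B_sig n p K *\<^sub>v v t - B_sig n p R *\<^sub>v sub_vec (u t) R"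
    and out_eq: "\<And>t. t \<ge> 0 \<Longrightarrow> C *\<^sub>v d t + D_sig n p K *\<^sub>v v t = D_sig n p R *\<^sub>v sub_vec (u t) R"
  shows "unidentifiable n p E A C R"
proof -
  let ?B = "B_mat n p" and ?D = "D_mat n p" and ?I = "col_sub (1\<^sub>m (n + p)) K"
  have I: "?I \<in> carrier_mat (n + p) (card K)" by (rule col_sub_carrier[OF one_carrier_mat K])
  define uK where "uK = (\<lambda>t. ?I *\<^sub>v v t)"
  have uK: "smooth_signal (n + p) uK" unfolding uK_def by (rule smooth_signal_mult[OF I v])
  have uK_zero: "uK t $ i = 0" if "i < n + p" "i \<notin> K" "t \<ge> 0" for i t
    unfolding uK_def embed_index[OF K smooth_signal_dim[OF v \<open>t \<ge> 0\<close>] that(1)]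
    using pick_in_set_le that(2) by (intro sum.neutral) auto
  \<comment> \<open>entries of \<open>v\<close> may vanish identically, so the attack set of \<open>uK\<close> can be smaller than \<open>K\<close>\<close>
  define R' where "R' = {i. i < n + p \<and> (\<exists>t \<ge> 0. uK t $ i \<noteq> 0)}"
  have R'K: "R' \<subseteq> K" using uK_zero by (auto simp: R'_def)
  have fin: "finite K" using K finite_subset by blast
  have R'R: "R' \<noteq> R" using R'K card neq card_subset_eq[OF fin, of R] by auto
  have card': "card R' \<le> card R" using card_mono[OF fin R'K] card by simp
  have attack': "attacked_exactly_on (n + p) R' uK"
    unfolding attacked_exactly_on_def R'_def by auto
  have u_zero: "u t $ i = 0" if "i < n + p" "i \<notin> R" "t \<ge> 0" for i t
    using attack that unfolding attacked_exactly_on_def by blast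
  have Mu: "M *\<^sub>v u t = col_sub M R *\<^sub>v sub_vec (u t) R" if "M \<in> carrier_mat r (n + p)" "t \<ge> 0" for M r t
    using mult_eq_col_sub_mult[OF that(1) R smooth_signal_dim[OF u that(2)]] u_zero that(2) by blast
  have MuK: "M *\<^sub>v uK t = col_sub M K *\<^sub>v v t" if "M \<in> carrier_mat r (n + p)" "t \<ge> 0" for M r t
    unfolding uK_def col_sub_eq_mult[OF that(1) K] using that I smooth_signal_dim[OF v that(2)]
    by (simp add: mat_vec_assoc)
  obtain x x' where x: "has_signal_deriv n x x'"
    and x_eq: "\<And>t. t \<ge> 0 \<Longrightarrow> E *\<^sub>v x' t = A *\<^sub>v x t + ?B *\<^sub>v u t"
    using dae_solution_exists[OF E A reg smooth_signal_mult[OF B_mat_carrier u]] by blast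
  let ?y = "\<lambda>t. C *\<^sub>v x t + ?D *\<^sub>v u t"
  let ?yK = "\<lambda>t. C *\<^sub>v (x t + d t) + ?D *\<^sub>v uK t"
  have sol: "generates_output n p E A C (x 0) u ?y"
    unfolding generates_output_def descriptor_solution_def
    by (rule exI[of _ x]) (use x x_eq E in auto)
  have xd: "has_signal_deriv n (\<lambda>t. x t + d t) (\<lambda>t. x' t + d' t)"
    by (rule has_signal_deriv_add[OF x d])
  have eqs: "E *\<^sub>v (x' t + d' t) = A *\<^sub>v (x t + d t) + ?B *\<^sub>v uK t \<and> ?y t = ?yK t" if t: "t \<ge> 0" for t
  proof -
    have cs: "B_sig n p K \<in> carrier_mat n (card K)" "D_sig n p K \<in> carrier_mat p (card K)"
      "B_sig n p R \<in> carrier_mat n (card R)" "D_sig n p R \<in> carrier_mat p (card R)"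
      using col_sub_carrier[OF B_mat_carrier K] col_sub_carrier[OF B_mat_carrier R]
        col_sub_carrier[OF D_mat_carrier K] col_sub_carrier[OF D_mat_carrier R] by auto
    note dims = has_signal_deriv_dim[OF x t] has_signal_deriv_dim[OF d t] smooth_signal_dim[OF v t]
      E[THEN carrier_matD(1)] E[THEN carrier_matD(2)] A[THEN carrier_matD(1)] A[THEN carrier_matD(2)]
      C[THEN carrier_matD(1)] C[THEN carrier_matD(2)] cs[THEN carrier_matD(1)] cs[THEN carrier_matD(2)]
    have 1: "E *\<^sub>v (x' t + d' t) = A *\<^sub>v (x t + d t) + ?B *\<^sub>v uK t"
      by (rule eq_vecI)
        (simp_all add: dims mult_vec_add x_eq[OF t] state[OF t] Mu[OF B_mat_carrier t]
          MuK[OF B_mat_carrier t] del: index_mult_mat_vec)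
    have "C *\<^sub>v x t + D_sig n p R *\<^sub>v sub_vec (u t) R = C *\<^sub>v (x t + d t) + D_sig n p K *\<^sub>v v t"
      unfolding out_eq[OF t, symmetric]
      by (rule eq_vecI) (simp_all add: dims mult_vec_add del: index_mult_mat_vec)
    then have "?y t = ?yK t" unfolding Mu[OF D_mat_carrier t] MuK[OF D_mat_carrier t] .
    then show ?thesis using 1 by simp
  qed
  have sol': "generates_output n p E A C (x 0 + d 0) uK ?yK"
    unfolding generates_output_def descriptor_solution_def
    by (rule exI[of _ "\<lambda>t. x t + d t"]) (use xd eqs E in auto)
  have "x 0 \<in> carrier_vec n" "x 0 + d 0 \<in> carrier_vec n"
    using has_signal_deriv_carrier(1)[OF x order_refl] has_signal_deriv_carrier(1)[OF xd order_refl] by auto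
  moreover have "\<exists>uK uR yK yR. smooth_signal (n + p) uK \<and> attacked_exactly_on (n + p) R uK \<and>
      smooth_signal (n + p) uR \<and> attacked_exactly_on (n + p) R' uR \<and>
      generates_output n p E A C (x 0) uK yK \<and> generates_output n p E A C (x 0 + d 0) uR yR \<and>
      (\<forall>t \<ge> 0. yK t = yR t)"
    by (rule exI[of _ u], rule exI[of _ uK], rule exI[of _ ?y], rule exI[of _ ?yK])
      (use u attack uK attack' sol sol' eqs in simp)
  moreover have "R' \<subseteq> {..<n + p}" by (auto simp: R'_def)
  ultimately show ?thesis
    unfolding unidentifiable_def using card' R'R by blast
qed

section \<open>The conditioned system\<close>

lemma sig_carrier:
  assumes "K \<subseteq> {..<n + p}"
  shows "B_sig n p K \<in> carrier_mat n (card K)" "D_sig n p K \<in> carrier_mat p (card K)"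
    "pinv (D_sig n p K) \<in> carrier_mat (card K) p"
  using col_sub_carrier[OF B_mat_carrier assms] col_sub_carrier[OF D_mat_carrier assms]
    pinv_carrier[OF col_sub_carrier[OF D_mat_carrier assms]] by auto

lemma hat_carrier:
  assumes "A \<in> carrier_mat n n" "C \<in> carrier_mat p n" "K \<subseteq> {..<n + p}"
  shows "A_hat n p A C K \<in> carrier_mat n n" "B_hat n p K \<in> carrier_mat n (card K)"
    "D_res n p K \<in> carrier_mat p p" "C_hat n p C K \<in> carrier_mat p n"
proof -
  note sig_carrier[OF assms(3)]
  then show "A_hat n p A C K \<in> carrier_mat n n" "B_hat n p K \<in> carrier_mat n (card K)"
    "D_res n p K \<in> carrier_mat p p" "C_hat n p C K \<in> carrier_mat p n"
    using assms by (auto simp: A_hat_def B_hat_def D_res_def C_hat_def)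
qed

lemma cond_input_carrier:
  assumes "L \<in> carrier_mat n p" "K \<subseteq> {..<n + p}" "R \<subseteq> {..<n + p}"
  shows "cond_input n p K L R \<in> carrier_mat n (card R)"
proof -
  have "D_res n p K \<in> carrier_mat p p"
    using sig_carrier[OF assms(2)] by (auto simp: D_res_def)
  then show ?thesis
    using sig_carrier[OF assms(2)] sig_carrier[OF assms(3)] assms(1) by (auto simp: cond_input_def)
qed

lemma D_res_mult_D_sig:
  assumes "K \<subseteq> {..<n + p}"
  shows "D_res n p K * D_sig n p K = 0\<^sub>m p (card K)"
proof -
  note c = sig_carrier[OF assms]
  have "D_res n p K * D_sig n p K = 1\<^sub>m p * D_sig n p K - D_sig n p K * pinv (D_sig n p K) * D_sig n p K"
    unfolding D_res_def by (rule minus_mult_distrib_mat) (use c in auto)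
  then show ?thesis using mult_pinv_mult[OF c(2)] c by simp
qed

text \<open>
The term with \<open>L\<close> vanishes because \<open>D\<^sub>K D\<^sub>K\<^sup>\<dagger> D\<^sub>K = D\<^sub>K\<close>.
\<close>

lemma cond_input_same:
  assumes "L \<in> carrier_mat n p" "K \<subseteq> {..<n + p}"
  shows "cond_input n p K L K = B_hat n p K"
proof -
  note c = sig_carrier[OF assms(2)]
  have r: "D_res n p K \<in> carrier_mat p p" using c by (auto simp: D_res_def)
  have "L * D_res n p K * D_sig n p K = 0\<^sub>m n (card K)"
    using D_res_mult_D_sig[OF assms(2)] assms(1) c r by (simp add: mat_assoc)
  moreover have "B_hat n p K = B_sig n p K * 1\<^sub>m (card K) - B_sig n p K * (pinv (D_sig n p K) * D_sig n p K)"
    unfolding B_hat_def by (rule mult_minus_distrib_mat) (use c in auto)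
  moreover have "B_sig n p K - B_sig n p K * (pinv (D_sig n p K) * D_sig n p K) + 0\<^sub>m n (card K)
      = B_sig n p K - B_sig n p K * (pinv (D_sig n p K) * D_sig n p K)"
    by (rule right_add_zero_mat, rule minus_carrier_mat) (use c in auto)
  ultimately show ?thesis using c unfolding cond_input_def by (simp add: mat_assoc)
qed

lemma S_star_subset_impulse_reachable:
  assumes E: "E \<in> carrier_mat n n" and A: "A \<in> carrier_mat n n" and C: "C \<in> carrier_mat p n"
    and K: "K \<subseteq> {..<n + p}" and S: "is_S_star n p E A C K S"
  shows "S \<subseteq> impulse_reachable E (A_hat n p A C K) (B_hat n p K) (C_hat n p C K)" (is "_ \<subseteq> ?R")
proof -
  note hat = hat_carrier[OF A C K]
  have "S_equation n p E A C K ?R"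
    unfolding S_equation_def
  proof
    show "?R \<subseteq> (\<lambda>z. hcat (A_hat n p A C K) (B_hat n p K) *\<^sub>v z) ` (stack (preimage E ?R) (carrier_vec (card K)) \<inter>
          mat_kernel (hcat (C_hat n p C K) (0\<^sub>m p (card K))))"
    proof
      fix s assume "s \<in> ?R"
      then obtain x v where s: "s = A_hat n p A C K *\<^sub>v x + B_hat n p K *\<^sub>v v"
        and x: "x \<in> carrier_vec n" and v: "v \<in> carrier_vec (card K)"
        and Cx: "C_hat n p C K *\<^sub>v x = 0\<^sub>v p" and Ex: "E *\<^sub>v x \<in> ?R"
        using impulse_reachable_fixed_point[OF E hat(1) hat(2) hat(4)] by blast
      have "hcat (C_hat n p C K) (0\<^sub>m p (card K)) *\<^sub>v (x @\<^sub>v v) = 0\<^sub>v p"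
        using hcat_mult_append[OF hat(4) zero_carrier_mat x v] Cx v by (simp add: zero_mat_mult_vec)
      then have "x @\<^sub>v v \<in> mat_kernel (hcat (C_hat n p C K) (0\<^sub>m p (card K)))"
        using mat_kernelI[OF hcat_carrier[OF hat(4) zero_carrier_mat]] x v by simp
      moreover have "x @\<^sub>v v \<in> stack (preimage E ?R) (carrier_vec (card K))"
        unfolding stack_def preimage_def using x v Ex E by auto
      moreover have "s = hcat (A_hat n p A C K) (B_hat n p K) *\<^sub>v (x @\<^sub>v v)"
        unfolding s using hcat_mult_append[OF hat(1) hat(2) x v] by simp
      ultimately show "s \<in> (\<lambda>z. hcat (A_hat n p A C K) (B_hat n p K) *\<^sub>v z) `
          (stack (preimage E ?R) (carrier_vec (card K)) \<inter>
          mat_kernel (hcat (C_hat n p C K) (0\<^sub>m p (card K))))" by blast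
    qed
    show "(\<lambda>z. hcat (A_hat n p A C K) (B_hat n p K) *\<^sub>v z) ` (stack (preimage E ?R) (carrier_vec (card K)) \<inter>
          mat_kernel (hcat (C_hat n p C K) (0\<^sub>m p (card K)))) \<subseteq> ?R"
    proof (rule image_subsetI, elim IntE)
      fix z assume "z \<in> stack (preimage E ?R) (carrier_vec (card K))"
        and ker: "z \<in> mat_kernel (hcat (C_hat n p C K) (0\<^sub>m p (card K)))"
      then obtain x v where z: "z = x @\<^sub>v v" and x: "x \<in> carrier_vec n" and Ex: "E *\<^sub>v x \<in> ?R"
        and v: "v \<in> carrier_vec (card K)"
        using E unfolding stack_def preimage_def by auto
      have "hcat (C_hat n p C K) (0\<^sub>m p (card K)) *\<^sub>v z = 0\<^sub>v p"
        using mat_kernelD(2)[OF hcat_carrier[OF hat(4) zero_carrier_mat] ker] .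
      then have "C_hat n p C K *\<^sub>v x = 0\<^sub>v p"
        using hcat_mult_append[OF hat(4) zero_carrier_mat x v] z hat(4) v x
        by (simp add: zero_mat_mult_vec right_zero_vec[of _ p] mult_mat_vec_carrier[OF hat(4) x])
      then show "hcat (A_hat n p A C K) (B_hat n p K) *\<^sub>v z \<in> ?R"
        unfolding z hcat_mult_append[OF hat(1) hat(2) x v]
        using impulse_reachable_step[OF E hat(1) hat(2) hat(4) x v] Ex by blast
    qed
  qed
  moreover have "is_subspace n ?R" by (rule impulse_reachable_subspace[OF E hat(1) hat(2) hat(4)])
  ultimately show ?thesis using S unfolding is_S_star_def by blast
qed

text \<open>
The zero state lies in the preimage of \<open>S\<close>, so the invariance that defines \<open>L\<close> applies to pure inputs.
\<close>

lemma B_hat_mem_S: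
  assumes E: "E \<in> carrier_mat n n" and A: "A \<in> carrier_mat n n" and C: "C \<in> carrier_mat p n"
    and K: "K \<subseteq> {..<n + p}" and S: "is_subspace n S"
    and L: "is_output_injection n p E A C K S L" and v: "v \<in> carrier_vec (card K)"
  shows "B_hat n p K *\<^sub>v v \<in> S"
proof -
  note hat = hat_carrier[OF A C K]
  let ?F = "A_hat n p A C K + L * C_hat n p C K"
  have F: "?F \<in> carrier_mat n n" using L hat by (auto simp: is_output_injection_def)
  have "0\<^sub>v n \<in> preimage E S"
    unfolding preimage_def using E is_subspace_zero[OF S] by (simp add: mult_zero_vec_eq)
  then have "0\<^sub>v n @\<^sub>v v \<in> stack (preimage E S) (carrier_vec (card K))"
    unfolding stack_def using v by blast
  then have "hcat ?F (B_hat n p K) *\<^sub>v (0\<^sub>v n @\<^sub>v v) \<in> S"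
    using L unfolding is_output_injection_def by blast
  moreover have "hcat ?F (B_hat n p K) *\<^sub>v (0\<^sub>v n @\<^sub>v v) = B_hat n p K *\<^sub>v v"
  proof -
    have "?F *\<^sub>v 0\<^sub>v n = 0\<^sub>v n" using F by (metis mult_zero_vec_eq carrier_matD)
    then show ?thesis using hcat_mult_append[OF F hat(2) zero_carrier_vec v] hat(2) v by simp
  qed
  ultimately show ?thesis by simp
qed

text \<open>
The converse of conditioning, at a fixed time, for the difference of a trajectory under \<open>K\<close> and one under \<open>R\<close>; here
\<open>e\<close> stands for \<open>E d'\<close>.  The input is recovered from its part \<open>(I - D\<^sub>K\<^sup>\<dagger> D\<^sub>K) v\<close>, which
survives conditioning, and from \<open>D\<^sub>K\<^sup>\<dagger>\<close> applied to the output.  The hypothesis on the output says that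
\<open>C d - D\<^sub>R w\<close> lies in the range of \<open>D\<^sub>K\<close>, and it makes the terms with \<open>L\<close> cancel.
\<close>

lemma conditioned_equation_imp_plant_equation:
  assumes A: "A \<in> carrier_mat n n" and C: "C \<in> carrier_mat p n"
    and K: "K \<subseteq> {..<n + p}" and R: "R \<subseteq> {..<n + p}" and L: "L \<in> carrier_mat n p"
    and d: "d \<in> carrier_vec n" and v: "v \<in> carrier_vec (card K)" and w: "w \<in> carrier_vec (card R)"
    and state: "e = A_hat n p A C K *\<^sub>v d + L *\<^sub>v (C_hat n p C K *\<^sub>v d) + B_hat n p K *\<^sub>v v
      - cond_input n p K L R *\<^sub>v w"
    and out_eq: "C_hat n p C K *\<^sub>v d = (D_res n p K * D_sig n p R) *\<^sub>v w"
  defines "v' \<equiv> v - pinv (D_sig n p K) *\<^sub>v (D_sig n p K *\<^sub>v v)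
      - pinv (D_sig n p K) *\<^sub>v (C *\<^sub>v d - D_sig n p R *\<^sub>v w)"
  shows "e = A *\<^sub>v d + B_sig n p K *\<^sub>v v' - B_sig n p R *\<^sub>v w" (is ?S)
    and "C *\<^sub>v d + D_sig n p K *\<^sub>v v' = D_sig n p R *\<^sub>v w" (is ?O)
proof -
  define B D X B' D' where "B = B_sig n p K" and "D = D_sig n p K" and "X = pinv D"
    and "B' = B_sig n p R" and "D' = D_sig n p R"
  have c: "B \<in> carrier_mat n (card K)" "D \<in> carrier_mat p (card K)" "X \<in> carrier_mat (card K) p"
    "B' \<in> carrier_mat n (card R)" "D' \<in> carrier_mat p (card R)"
    using sig_carrier[OF K] sig_carrier[OF R] by (simp_all add: B_def D_def X_def B'_def D'_def)
  note dims = A[THEN carrier_matD(1)] A[THEN carrier_matD(2)]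
      C[THEN carrier_matD(1)] C[THEN carrier_matD(2)] L[THEN carrier_matD(1)] L[THEN carrier_matD(2)]
      c[THEN carrier_matD(1)] c[THEN carrier_matD(2)] d[THEN carrier_vecD] v[THEN carrier_vecD] w[THEN carrier_vecD]
  have DXD: "D *\<^sub>v (X *\<^sub>v (D *\<^sub>v v)) = D *\<^sub>v v"
    using arg_cong[OF mult_pinv_mult[OF c(2)], of "\<lambda>M. M *\<^sub>v v"] by (simp add: dims mat_vec_assoc X_def[symmetric])
  have Dres: "D_res n p K *\<^sub>v y = y - D *\<^sub>v (X *\<^sub>v y)" if y: "dim_vec y = p" for y
    unfolding D_res_def D_def[symmetric] X_def[symmetric]
    using y by (simp add: dims mat_diff_mult_vec mat_vec_assoc one_mat_mult_vec)
  have Dres_dim: "dim_row (D_res n p K) = p" "dim_col (D_res n p K) = p"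
    using hat_carrier(3)[OF A C K] by auto
  have Chat: "C_hat n p C K *\<^sub>v d = C *\<^sub>v d - D *\<^sub>v (X *\<^sub>v (C *\<^sub>v d))"
    unfolding C_hat_def by (simp add: dims mat_vec_assoc Dres Dres_dim)
  have Dm: "(D_res n p K * D_sig n p R) *\<^sub>v w = D' *\<^sub>v w - D *\<^sub>v (X *\<^sub>v (D' *\<^sub>v w))"
    unfolding D'_def[symmetric] by (simp add: dims mat_vec_assoc Dres Dres_dim)
  have v': "v' = v - X *\<^sub>v (D *\<^sub>v v) - (X *\<^sub>v (C *\<^sub>v d) - X *\<^sub>v (D' *\<^sub>v w))"
    unfolding v'_def D_def[symmetric] X_def[symmetric] D'_def[symmetric]
    by (simp add: dims mult_vec_diff)
  have out: "C *\<^sub>v d - D *\<^sub>v (X *\<^sub>v (C *\<^sub>v d)) = D' *\<^sub>v w - D *\<^sub>v (X *\<^sub>v (D' *\<^sub>v w))"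
    using out_eq unfolding Chat Dm .
  show ?O
    unfolding v' D_def[symmetric] D'_def[symmetric]
  proof (rule eq_vecI)
    fix i assume "i < dim_vec (D' *\<^sub>v w)"
    then have i: "i < p" by (simp add: dims)
    show "(C *\<^sub>v d + D *\<^sub>v (v - X *\<^sub>v (D *\<^sub>v v) - (X *\<^sub>v (C *\<^sub>v d) - X *\<^sub>v (D' *\<^sub>v w)))) $ i = (D' *\<^sub>v w) $ i"
      using arg_cong[OF out, of "\<lambda>y. y $ i"] i
      by (simp add: dims mult_vec_diff DXD del: index_mult_mat_vec)
  qed (simp add: dims)
  have Ahat: "A_hat n p A C K *\<^sub>v d = A *\<^sub>v d - B *\<^sub>v (X *\<^sub>v (C *\<^sub>v d))"
    unfolding A_hat_def B_def[symmetric] D_def[symmetric] X_def[symmetric]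
    by (simp add: dims mat_diff_mult_vec mat_vec_assoc)
  have Bhat: "B_hat n p K *\<^sub>v v = B *\<^sub>v v - B *\<^sub>v (X *\<^sub>v (D *\<^sub>v v))"
    unfolding B_hat_def B_def[symmetric] D_def[symmetric] X_def[symmetric]
    by (simp add: dims mat_diff_mult_vec mat_vec_assoc one_mat_mult_vec mult_vec_diff)
  have M: "cond_input n p K L R *\<^sub>v w = B' *\<^sub>v w - B *\<^sub>v (X *\<^sub>v (D' *\<^sub>v w)) + L *\<^sub>v ((D_res n p K * D_sig n p R) *\<^sub>v w)"
    unfolding cond_input_def B_def[symmetric] D_def[symmetric] X_def[symmetric] B'_def[symmetric] D'_def[symmetric]
    by (simp add: dims Dres_dim mat_diff_mult_vec mat_add_mult_vec mat_vec_assoc)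
  have Dm_dim: "dim_vec ((D_res n p K * D_sig n p R) *\<^sub>v w) = p" by (simp add: Dres_dim)
  show ?S
    unfolding state Ahat Bhat M out_eq v' B_def[symmetric] B'_def[symmetric]
    by (rule eq_vecI) (simp_all add: dims mult_vec_diff Dm_dim del: index_mult_mat_vec)
qed

lemma S_valued_forcing_absorbed:
  assumes E: "E \<in> carrier_mat n n" and A: "A \<in> carrier_mat n n" and C: "C \<in> carrier_mat p n"
    and K: "K \<subseteq> {..<n + p}" and S: "is_S_star n p E A C K S"
    and bs: "orthonormal_basis n S bs" and cs: "orthonormal_basis n (orth_compl n S) cs"
    and h: "smooth_signal n h" and orth: "\<And>t c. t \<ge> 0 \<Longrightarrow> c \<in> set cs \<Longrightarrow> c \<bullet> h t = 0"
  shows "\<exists>z z' v. smooth_signal n z \<and> has_signal_deriv n z z' \<and> smooth_signal (card K) v \<and>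
    (\<forall>t \<ge> 0. C_hat n p C K *\<^sub>v z t = 0\<^sub>v p \<and>
      E *\<^sub>v z' t = A_hat n p A C K *\<^sub>v z t + B_hat n p K *\<^sub>v v t + h t)"
proof -
  note hat = hat_carrier[OF A C K]
  have b: "bs ! j \<in> impulse_reachable E (A_hat n p A C K) (B_hat n p K) (C_hat n p C K)"
    if "j < length bs" for j
    using S_star_subset_impulse_reachable[OF E A C K S] orthonormal_basis_mem[OF bs nth_mem[OF that]] by blast
  have g: "smooth_fun (\<lambda>t. bs ! j \<bullet> h t)" if "j < length bs" for j
  proof -
    have "smooth_fun (\<lambda>t. \<Sum>i<n. bs ! j $ i * h t $ i)"
      using h by (intro smooth_fun_sum smooth_fun_mult_left) (auto simp: smooth_signal_iff)
    then show ?thesis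
      by (rule smooth_fun_cong) (simp add: scalar_prod_def smooth_signal_dim[OF h] atLeast0LessThan)
  qed
  have "h t = vec n (\<lambda>i. \<Sum>j<length bs. (bs ! j \<bullet> h t) * bs ! j $ i)" if "t \<ge> 0" for t
    by (rule orthonormal_expansion[OF bs cs smooth_signal_carrier[OF h that] orth[OF that]])
  then show ?thesis
    using impulse_reachable_absorbs[OF E hat(1) hat(2) hat(4), of "length bs" "\<lambda>j. bs ! j" "\<lambda>j t. bs ! j \<bullet> h t", OF b g]
    by simp
qed

lemma transpose_mat_of_cols_append_mult:
  assumes "set bs \<subseteq> carrier_vec n" "set cs \<subseteq> carrier_vec n" "dim_vec v = n"
  shows "transpose_mat (mat_of_cols n (bs @ cs)) *\<^sub>v v = (mat_of_rows n bs *\<^sub>v v) @\<^sub>v (mat_of_rows n cs *\<^sub>v v)"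
proof (rule eq_vecI)
  fix i assume "i < dim_vec ((mat_of_rows n bs *\<^sub>v v) @\<^sub>v (mat_of_rows n cs *\<^sub>v v))"
  then have i: "i < length bs + length cs" by simp
  have "(bs @ cs) ! i \<in> set (bs @ cs)" using i by (intro nth_mem) simp
  then have "(bs @ cs) ! i \<in> carrier_vec n" using assms by auto
  then have "(transpose_mat (mat_of_cols n (bs @ cs)) *\<^sub>v v) $ i = (bs @ cs) ! i \<bullet> v"
    using i by simp
  moreover have "row (mat_of_rows n bs) i = bs ! i" if "i < length bs"
    using that assms nth_mem[OF that] by (intro mat_of_rows_row) auto
  moreover have "row (mat_of_rows n cs) (i - length bs) = cs ! (i - length bs)" if "\<not> i < length bs"
    using that assms i nth_mem[of "i - length bs" cs] by (intro mat_of_rows_row) auto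
  ultimately show "(transpose_mat (mat_of_cols n (bs @ cs)) *\<^sub>v v) $ i
      = ((mat_of_rows n bs *\<^sub>v v) @\<^sub>v (mat_of_rows n cs *\<^sub>v v)) $ i"
    using i by (auto simp: nth_append)
qed simp

text \<open>
The rows of \<open>P\<^sup>T\<close> that come from the basis of the complement extract the lower block, where \<open>a\<close> does not occur.
\<close>

lemma lower_block_mult:
  fixes X X11 X12 X22 :: "real mat"
  assumes X: "X \<in> carrier_mat n n" and Q: "Q \<in> carrier_mat n (l + q)"
    and bs: "set bs \<subseteq> carrier_vec n" "length bs = k" and cs: "set cs \<subseteq> carrier_vec n"
    and X11: "X11 \<in> carrier_mat k l" and X12: "X12 \<in> carrier_mat k q" and X22: "X22 \<in> carrier_mat m q"
    and blocks: "transpose_mat (mat_of_cols n (bs @ cs)) * X * Q = four_block_mat X11 X12 (0\<^sub>m m l) X22"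
    and a: "a \<in> carrier_vec l" and b: "b \<in> carrier_vec q"
  shows "mat_of_rows n cs *\<^sub>v (X *\<^sub>v (Q *\<^sub>v (a @\<^sub>v b))) = X22 *\<^sub>v b"
proof -
  let ?P = "mat_of_cols n (bs @ cs)"
  let ?v = "X *\<^sub>v (Q *\<^sub>v (a @\<^sub>v b))"
  have "four_block_mat X11 X12 (0\<^sub>m m l) X22 *\<^sub>v (a @\<^sub>v b) = transpose_mat ?P *\<^sub>v ?v"
    unfolding blocks[symmetric] using X Q a b by (simp add: mat_vec_assoc)
  also have "\<dots> = (mat_of_rows n bs *\<^sub>v ?v) @\<^sub>v (mat_of_rows n cs *\<^sub>v ?v)"
    using X by (intro transpose_mat_of_cols_append_mult bs cs) simp
  finally have "(X11 *\<^sub>v a + X12 *\<^sub>v b) @\<^sub>v (0\<^sub>m m l *\<^sub>v a + X22 *\<^sub>v b)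
      = (mat_of_rows n bs *\<^sub>v ?v) @\<^sub>v (mat_of_rows n cs *\<^sub>v ?v)"
    using four_block_mat_mult_vec[OF X11 X12 zero_carrier_mat X22 a b] by simp
  moreover have "X11 *\<^sub>v a + X12 *\<^sub>v b \<in> carrier_vec k" "mat_of_rows n bs *\<^sub>v ?v \<in> carrier_vec k"
    using X11 X12 a b bs(2) by (auto intro: carrier_vecI)
  ultimately have "0\<^sub>m m l *\<^sub>v a + X22 *\<^sub>v b = mat_of_rows n cs *\<^sub>v ?v"
    using append_vec_eq by blast
  moreover have "0\<^sub>m m l *\<^sub>v a + X22 *\<^sub>v b = X22 *\<^sub>v b"
    using X22 a by (simp add: zero_mat_mult_vec zero_vec_simps)
  ultimately show ?thesis by simp
qed

section \<open>The attack identification filter\<close>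

theorem theorem4p5:
  fixes n p k l :: nat
    and E A C L P Q G E11 E12 E22 A11 A12 A22 C1 C2 Pr :: "real mat"
    and K R :: "nat set"
    and S :: "real vec set"
    and x0 :: "real vec"
    and u x1 x2 y w2 ybar r :: "real \<Rightarrow> real vec"
  assumes E: "E \<in> carrier_mat n n" and A: "A \<in> carrier_mat n n" and C: "C \<in> carrier_mat p n"
    \<comment> \<open>candidate attack set K and actual attack set R\<close>
    and K: "K \<subseteq> {..<n + p}" and R: "R \<subseteq> {..<n + p}" and card: "card K = card R"
    and input_smooth: "smooth_signal (n + p) u"
    and attack_set: "attacked_exactly_on (n + p) R u"
    and ident: "identifiable n p E A C R"
    and reg: "regular_pencil E A"
    and x0: "x0 \<in> carrier_vec n" and consistent: "consistent_state n p E A x0 (u 0)"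
    \<comment> \<open>data of the conditioned system for K\<close>
    and S: "is_S_star n p E A C K S"
    and L: "is_output_injection n p E A C K S L"
    and P: "adapted_basis_mat n S k P"
    and Q: "adapted_basis_mat n (preimage E S) l Q"
    and blocks_E: "E11 \<in> carrier_mat k l" "E12 \<in> carrier_mat k (n - l)"
      "E22 \<in> carrier_mat (n - k) (n - l)"
      "transpose_mat P * E * Q = four_block_mat E11 E12 (0\<^sub>m (n - k) l) E22"
    and blocks_A: "A11 \<in> carrier_mat k l" "A12 \<in> carrier_mat k (n - l)"
      "A22 \<in> carrier_mat (n - k) (n - l)"
      "transpose_mat P * (A_hat n p A C K + L * C_hat n p C K) * Q
         = four_block_mat A11 A12 (0\<^sub>m (n - k) l) A22"
    and blocks_C: "C1 \<in> carrier_mat p l" "C2 \<in> carrier_mat p (n - l)"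
      "C_hat n p C K * Q = hcat C1 C2"
    \<comment> \<open>trajectory of the conditioned system under the attack set R, started at x0\<close>
    and x1: "\<And>t. t \<ge> 0 \<Longrightarrow> x1 t \<in> carrier_vec l"
    and x2: "\<And>t. t \<ge> 0 \<Longrightarrow> x2 t \<in> carrier_vec (n - l)"
    and conditioned: "descriptor_solution
      (four_block_mat E11 E12 (0\<^sub>m (n - k) l) E22)
      (four_block_mat A11 A12 (0\<^sub>m (n - k) l) A22)
      (\<lambda>t. transpose_mat P *\<^sub>v (cond_input n p K L R *\<^sub>v sub_vec (u t) R))
      (\<lambda>t. x1 t @\<^sub>v x2 t)"
    and initial: "Q *\<^sub>v (x1 0 @\<^sub>v x2 0) = x0"
    and output_eq: "\<And>t. t \<ge> 0 \<Longrightarrow>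
      y t = C1 *\<^sub>v x1 t + C2 *\<^sub>v x2 t + (D_res n p K * D_sig n p R) *\<^sub>v sub_vec (u t) R"
    \<comment> \<open>attack identification filter for the signature of K\<close>
    and Pr: "Pr = 1\<^sub>m p - C1 * pinv C1"
    and G: "G \<in> carrier_mat (n - k) p"
    and hurwitz: "hurwitz_pencil E22 (A22 + G * Pr * C2)"
    and ybar: "\<And>t. t \<ge> 0 \<Longrightarrow> ybar t = Pr *\<^sub>v y t"
    and filter_eq: "descriptor_solution E22 (A22 + G * Pr * C2) (\<lambda>t. - (G *\<^sub>v ybar t)) w2"
    and filter_init: "w2 0 = x2 0"
    and residual: "\<And>t. t \<ge> 0 \<Longrightarrow> r t = (Pr * C2) *\<^sub>v w2 t - ybar t"
  shows "(\<forall>t \<ge> 0. r t = 0\<^sub>v p) \<longleftrightarrow> K = R"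
proof -
  obtain bs cs where bs: "orthonormal_basis n S bs" and cs: "orthonormal_basis n (orth_compl n S) cs"
    and len_bs: "length bs = k" and P_eq: "P = mat_of_cols n (bs @ cs)"
    using P unfolding adapted_basis_mat_def by blast
  obtain bs' cs' where Q_eq: "Q = mat_of_cols n (bs' @ cs')"
    using Q unfolding adapted_basis_mat_def by blast
  \<comment> \<open>\<open>Z\<close> maps a state equation to its lower block, \<open>H\<close> and \<open>M\<close> are the state and input matrices of the
    conditioned system before the change of coordinates, and \<open>N\<close> is the state matrix of the filter\<close>
  define q where "q = n - l"
  define m where "m = n - k"
  define Z where "Z = mat_of_rows n cs"
  define M where "M = cond_input n p K L R"
  define H where "H = A_hat n p A C K + L * C_hat n p C K"
  define Dm where "Dm = D_res n p K * D_sig n p R"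
  define w where "w = (\<lambda>t. sub_vec (u t) R)"
  define N where "N = A22 + G * Pr * C2"
  have bs_carrier: "set bs \<subseteq> carrier_vec n" and cs_carrier: "set cs \<subseteq> carrier_vec n"
    using bs cs by (auto simp: orthonormal_basis_def)
  have subS: "is_subspace n S" using S by (simp add: is_S_star_def)
  have L_carrier: "L \<in> carrier_mat n p" using L by (simp add: is_output_injection_def)
  note hat = hat_carrier[OF A C K]
  have H: "H \<in> carrier_mat n n" using hat L_carrier by (simp add: H_def)
  have M: "M \<in> carrier_mat n (card R)" unfolding M_def by (rule cond_input_carrier[OF L_carrier K R])
  have Dm: "Dm \<in> carrier_mat p (card R)" using hat(3) sig_carrier[OF R] by (simp add: Dm_def)
  have w: "smooth_signal (card R) w" unfolding w_def by (rule smooth_signal_sub_vec[OF input_smooth R])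
  note E_blocks = blocks_E[folded q_def m_def] and A_blocks = blocks_A[folded q_def m_def H_def]
    and C_blocks = blocks_C[folded q_def]
  have "dim_row (transpose_mat P * E * Q) = k + m" "dim_col (transpose_mat P * E * Q) = l + q"
    using E_blocks by simp_all
  then have len_cs: "length cs = m" and Q_carrier: "Q \<in> carrier_mat n (l + q)"
    using len_bs by (auto simp: P_eq Q_eq)
  have Z: "Z \<in> carrier_mat m n" using len_cs by (auto simp: Z_def)
  have pC1: "pinv C1 \<in> carrier_mat l p" by (rule pinv_carrier[OF C_blocks(1)])
  have Pr_carrier: "Pr \<in> carrier_mat p p" using Pr C_blocks(1) pC1 by (auto intro: minus_carrier_mat)
  have G': "G \<in> carrier_mat m p" using G by (simp add: m_def)
  have N: "N \<in> carrier_mat m q" using A_blocks C_blocks Pr_carrier G' by (simp add: N_def)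
  note dims = carrier_matD[OF E] carrier_matD[OF H] carrier_matD[OF M] carrier_matD[OF Dm]
    carrier_matD[OF Z] carrier_matD[OF Pr_carrier] carrier_matD[OF G'] carrier_matD[OF N]
    carrier_matD[OF pC1] carrier_matD[OF E_blocks(1)] carrier_matD[OF E_blocks(3)]
    carrier_matD[OF A_blocks(1)] carrier_matD[OF A_blocks(3)] carrier_matD[OF C_blocks(1)]
    carrier_matD[OF C_blocks(2)] carrier_matD[OF Q_carrier] carrier_matD[OF hat(1)] carrier_matD[OF hat(2)]
    carrier_matD[OF hat(4)] carrier_matD[OF L_carrier] carrier_matD[OF E_blocks(2)] carrier_matD[OF A_blocks(2)]
  have N_mult: "N *\<^sub>v v = A22 *\<^sub>v v + G *\<^sub>v (Pr *\<^sub>v (C2 *\<^sub>v v))" if "dim_vec v = q" for v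
    unfolding N_def using that by (simp add: dims mat_add_mult_vec mat_vec_assoc)
  have Pr_mult: "Pr *\<^sub>v v = v - C1 *\<^sub>v (pinv C1 *\<^sub>v v)" if "dim_vec v = p" for v
    unfolding Pr using that by (simp add: dims mat_diff_mult_vec mat_vec_assoc one_mat_mult_vec)
  have PrC1: "Pr *\<^sub>v (C1 *\<^sub>v v) = 0\<^sub>v p" if v: "dim_vec v = l" for v
  proof -
    have "C1 *\<^sub>v (pinv C1 *\<^sub>v (C1 *\<^sub>v v)) = C1 *\<^sub>v v"
      using arg_cong[OF mult_pinv_mult[OF C_blocks(1)], of "\<lambda>M. M *\<^sub>v v"] v
      by (simp add: dims mat_vec_assoc)
    then have "Pr *\<^sub>v (C1 *\<^sub>v v) = C1 *\<^sub>v v - C1 *\<^sub>v v"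
      using Pr_mult[of "C1 *\<^sub>v v"] by (simp add: dims)
    then show ?thesis by (simp add: dims zero_vec_simps)
  qed
  \<comment> \<open>1 does not lie in the open left half plane\<close>
  have no_eigenvalue: "\<not> gen_eigenvalue E22 N 1"
    using hurwitz unfolding hurwitz_pencil_def N_def by (metis less_le_not_le one_complex.simps(1) zero_le_one)
  have lower: "Z *\<^sub>v (X *\<^sub>v (Q *\<^sub>v (a @\<^sub>v b))) = X22 *\<^sub>v b"
    if "X \<in> carrier_mat n n" "X11 \<in> carrier_mat k l" "X12 \<in> carrier_mat k q" "X22 \<in> carrier_mat m q"
      "transpose_mat P * X * Q = four_block_mat X11 X12 (0\<^sub>m m l) X22"
      "a \<in> carrier_vec l" "b \<in> carrier_vec q" for X X11 X12 X22 a b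
    unfolding Z_def
    by (rule lower_block_mult[OF that(1) Q_carrier bs_carrier len_bs cs_carrier that(2-4) _ that(6,7)])
      (use that(5) P_eq in simp)
  have x1_dim: "dim_vec (x1 t) = l" if "t \<ge> 0" for t using x1[OF that] by simp
  have x2_dim: "dim_vec (x2 t) = q" if "t \<ge> 0" for t using x2[OF that] by (simp add: q_def)
  obtain x' where x': "has_signal_deriv (l + q) (\<lambda>t. x1 t @\<^sub>v x2 t) x'"
    and x'_eq: "\<And>t. t \<ge> 0 \<Longrightarrow> four_block_mat E11 E12 (0\<^sub>m m l) E22 *\<^sub>v x' t
      = four_block_mat A11 A12 (0\<^sub>m m l) A22 *\<^sub>v (x1 t @\<^sub>v x2 t) + transpose_mat P *\<^sub>v (M *\<^sub>v w t)"
  proof -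
    have dim: "dim_col (four_block_mat E11 E12 (0\<^sub>m m l) E22) = l + q" using E_blocks by simp
    obtain x' where "has_signal_deriv (l + q) (\<lambda>t. x1 t @\<^sub>v x2 t) x'"
      "\<forall>t \<ge> 0. four_block_mat E11 E12 (0\<^sub>m m l) E22 *\<^sub>v x' t
      = four_block_mat A11 A12 (0\<^sub>m m l) A22 *\<^sub>v (x1 t @\<^sub>v x2 t) + transpose_mat P *\<^sub>v (M *\<^sub>v sub_vec (u t) R)"
      using conditioned unfolding descriptor_solution_def m_def[symmetric] M_def[symmetric] dim by blast
    then show ?thesis using that unfolding w_def by blast
  qed
  define x1' x2' where "x1' = (\<lambda>t. vec_first (x' t) l)" and "x2' = (\<lambda>t. vec_last (x' t) q)"
  have x'_split: "x' t = x1' t @\<^sub>v x2' t" if "t \<ge> 0" for t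
    unfolding x1'_def x2'_def
    using vec_first_last_append[OF has_signal_deriv_carrier(2)[OF x' that]] by simp
  have x2_deriv: "has_signal_deriv q x2 x2'"
  proof -
    have "has_signal_deriv (l + q) (\<lambda>t. x1 t @\<^sub>v x2 t) (\<lambda>t. x1' t @\<^sub>v x2' t)"
      by (rule has_signal_deriv_cong[OF x']) (simp_all add: x'_split)
    moreover have "x1' t \<in> carrier_vec l" "x2' t \<in> carrier_vec q" for t
      by (simp_all add: x1'_def x2'_def)
    ultimately show ?thesis
      using has_signal_deriv_append_iff[of x1 l x1' x2 q x2'] x1 x2 by (simp add: q_def)
  qed
  have x2_eq: "E22 *\<^sub>v x2' t = A22 *\<^sub>v x2 t + Z *\<^sub>v (M *\<^sub>v w t)" if t: "t \<ge> 0" for t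
  proof -
    have c: "x1' t \<in> carrier_vec l" "x2' t \<in> carrier_vec q" "x1 t \<in> carrier_vec l" "x2 t \<in> carrier_vec q"
      using x1[OF t] x2[OF t] by (simp_all add: x1'_def x2'_def q_def)
    have Mw: "transpose_mat P *\<^sub>v (M *\<^sub>v w t) = (mat_of_rows n bs *\<^sub>v (M *\<^sub>v w t)) @\<^sub>v (Z *\<^sub>v (M *\<^sub>v w t))"
      unfolding P_eq Z_def by (rule transpose_mat_of_cols_append_mult[OF bs_carrier cs_carrier]) (simp add: dims)
    have "(E11 *\<^sub>v x1' t + E12 *\<^sub>v x2' t) @\<^sub>v (0\<^sub>m m l *\<^sub>v x1' t + E22 *\<^sub>v x2' t)
        = ((A11 *\<^sub>v x1 t + A12 *\<^sub>v x2 t) @\<^sub>v (0\<^sub>m m l *\<^sub>v x1 t + A22 *\<^sub>v x2 t)) + transpose_mat P *\<^sub>v (M *\<^sub>v w t)"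
      using x'_eq[OF t] unfolding x'_split[OF t]
        four_block_mat_mult_vec[OF E_blocks(1,2) zero_carrier_mat E_blocks(3) c(1,2)]
        four_block_mat_mult_vec[OF A_blocks(1,2) zero_carrier_mat A_blocks(3) c(3,4)] .
    also have "\<dots> = (A11 *\<^sub>v x1 t + A12 *\<^sub>v x2 t + mat_of_rows n bs *\<^sub>v (M *\<^sub>v w t))
        @\<^sub>v (0\<^sub>m m l *\<^sub>v x1 t + A22 *\<^sub>v x2 t + Z *\<^sub>v (M *\<^sub>v w t))"
      unfolding Mw by (rule append_vec_add[of _ k _ _ m]) (auto simp: dims len_bs intro!: carrier_vecI)
    finally have "0\<^sub>m m l *\<^sub>v x1' t + E22 *\<^sub>v x2' t = 0\<^sub>m m l *\<^sub>v x1 t + A22 *\<^sub>v x2 t + Z *\<^sub>v (M *\<^sub>v w t)"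
      by (subst (asm) append_vec_eq[of _ k]) (auto simp: dims len_bs intro!: carrier_vecI)
    moreover have "0\<^sub>m m l *\<^sub>v x1' t + E22 *\<^sub>v x2' t = E22 *\<^sub>v x2' t"
      "0\<^sub>m m l *\<^sub>v x1 t + A22 *\<^sub>v x2 t = A22 *\<^sub>v x2 t"
      using c by (simp_all add: dims zero_mat_mult_vec zero_vec_simps)
    ultimately show ?thesis by simp
  qed
  obtain w2' where w2_deriv: "has_signal_deriv q w2 w2'"
    and w2_eq: "\<And>t. t \<ge> 0 \<Longrightarrow> E22 *\<^sub>v w2' t = N *\<^sub>v w2 t - G *\<^sub>v ybar t"
  proof -
    obtain w2' where 1: "has_signal_deriv q w2 w2'"
      "\<And>t. t \<ge> 0 \<Longrightarrow> E22 *\<^sub>v w2' t = N *\<^sub>v w2 t + - (G *\<^sub>v ybar t)"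
      using filter_eq E_blocks(3) unfolding descriptor_solution_def N_def by auto
    have "N *\<^sub>v w2 t + - (G *\<^sub>v ybar t) = N *\<^sub>v w2 t - G *\<^sub>v ybar t" for t
      by (rule minus_vec_eq_add_uminus[symmetric]) (simp add: dims)
    then show ?thesis using that[OF 1(1)] 1(2) by simp
  qed
  have y_eq: "y t = C1 *\<^sub>v x1 t + C2 *\<^sub>v x2 t + Dm *\<^sub>v w t" if "t \<ge> 0" for t
    using output_eq[OF that] by (simp add: Dm_def w_def)
  have ybar_eq: "ybar t = Pr *\<^sub>v (C2 *\<^sub>v x2 t) + Pr *\<^sub>v (Dm *\<^sub>v w t)" if t: "t \<ge> 0" for t
  proof -
    have "ybar t = 0\<^sub>v p + Pr *\<^sub>v (C2 *\<^sub>v x2 t) + Pr *\<^sub>v (Dm *\<^sub>v w t)"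
      unfolding ybar[OF t] y_eq[OF t] using x1_dim[OF t] x2_dim[OF t]
      by (simp add: dims mult_vec_add PrC1)
    then show ?thesis by (simp add: dims zero_vec_simps)
  qed
  have r_eq: "r t = Pr *\<^sub>v (C2 *\<^sub>v w2 t) - ybar t" if t: "t \<ge> 0" for t
    unfolding residual[OF t] using has_signal_deriv_dim(1)[OF w2_deriv t] by (simp add: dims mat_vec_assoc)
  define e e' where "e = (\<lambda>t. w2 t - x2 t)" and "e' = (\<lambda>t. w2' t - x2' t)"
  have e_deriv: "has_signal_deriv q e e'"
    unfolding e_def e'_def by (rule has_signal_deriv_diff[OF w2_deriv x2_deriv])
  note signal_dims = x1_dim x2_dim has_signal_deriv_dim[OF x2_deriv] has_signal_deriv_dim[OF w2_deriv]
    smooth_signal_dim[OF w]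
  show ?thesis
  proof
    assume KR: "K = R"
    have Dm0: "Dm = 0\<^sub>m p (card K)" unfolding Dm_def KR by (rule D_res_mult_D_sig[OF R])
    have MB: "M = B_hat n p K" unfolding M_def KR by (rule cond_input_same[OF L_carrier R])
    have ZM: "Z *\<^sub>v (M *\<^sub>v w t) = 0\<^sub>v m" if t: "t \<ge> 0" for t
    proof -
      have "w t \<in> carrier_vec (card K)" using smooth_signal_carrier[OF w t] card by simp
      then have "M *\<^sub>v w t \<in> S" unfolding MB by (rule B_hat_mem_S[OF E A C K subS L])
      then have orth: "c \<bullet> (M *\<^sub>v w t) = 0" if "c \<in> set cs" for c
        using orthonormal_basis_mem[OF cs that] by (auto simp: orth_compl_def)
      show ?thesis
      proof (rule eq_vecI)
        fix i assume "i < dim_vec (0\<^sub>v m :: real vec)"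
        then have i: "i < length cs" using len_cs by simp
        then have "row Z i = cs ! i" unfolding Z_def using cs_carrier nth_mem by (intro mat_of_rows_row) auto
        then show "(Z *\<^sub>v (M *\<^sub>v w t)) $ i = 0\<^sub>v m $ i" using orth[OF nth_mem[OF i]] i Z len_cs by simp
      qed (simp add: dims)
    qed
    have yb: "ybar t = Pr *\<^sub>v (C2 *\<^sub>v x2 t)" if t: "t \<ge> 0" for t
    proof -
      have "Pr *\<^sub>v (Dm *\<^sub>v w t) = 0\<^sub>v p"
        unfolding Dm0 using smooth_signal_dim[OF w t] card by (simp add: zero_mat_mult_vec mult_zero_vec_eq dims)
      then show ?thesis unfolding ybar_eq[OF t] by (simp add: dims zero_vec_simps)
    qed
    have e_eq: "E22 *\<^sub>v e' t = N *\<^sub>v e t" if t: "t \<ge> 0" for t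
    proof -
      have "E22 *\<^sub>v e' t = N *\<^sub>v w2 t - G *\<^sub>v ybar t - (A22 *\<^sub>v x2 t + 0\<^sub>v m)"
        using w2_eq[OF t] x2_eq[OF t] ZM[OF t] signal_dims t by (simp add: e'_def dims mult_vec_diff)
      also have "\<dots> = N *\<^sub>v w2 t - N *\<^sub>v x2 t"
        unfolding yb[OF t] N_mult[OF x2_dim[OF t]]
        by (rule eq_vecI) (simp_all add: dims del: index_mult_mat_vec)
      also have "\<dots> = N *\<^sub>v e t" using signal_dims t by (simp add: e_def dims mult_vec_diff)
      finally show ?thesis .
    qed
    have e0: "e 0 = 0\<^sub>v q" unfolding e_def filter_init using x2_dim[of 0] by (simp add: zero_vec_simps)
    show "\<forall>t \<ge> 0. r t = 0\<^sub>v p"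
    proof (intro allI impI)
      fix t :: real assume t: "t \<ge> 0"
      have "e t = 0\<^sub>v q"
        by (rule dae_homogeneous_zero[OF E_blocks(3) N no_eigenvalue e_deriv e0 e_eq t])
      then have "w2 t = x2 t"
        unfolding e_def using has_signal_deriv_carrier(1)[OF w2_deriv t] has_signal_deriv_carrier(1)[OF x2_deriv t]
        by (subst (asm) vec_minus_eq_zero_iff) auto
      then show "r t = 0\<^sub>v p" unfolding r_eq[OF t] yb[OF t] by (simp add: dims zero_vec_simps)
    qed
  next
    assume r0: "\<forall>t \<ge> 0. r t = 0\<^sub>v p"
    show "K = R"
    proof (rule ccontr)
      assume neq: "K \<noteq> R"
      have ybar_w2: "ybar t = Pr *\<^sub>v (C2 *\<^sub>v w2 t)" if t: "t \<ge> 0" for t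
      proof -
        have "Pr *\<^sub>v (C2 *\<^sub>v w2 t) - ybar t = 0\<^sub>v p" using r0 r_eq[OF t] t by simp
        then show ?thesis
          by (subst (asm) vec_minus_eq_zero_iff) (auto simp: ybar_eq[OF t] dims intro!: carrier_vecI)
      qed
      have PrC2e: "Pr *\<^sub>v (C2 *\<^sub>v e t) = Pr *\<^sub>v (Dm *\<^sub>v w t)" if t: "t \<ge> 0" for t
      proof -
        have "Pr *\<^sub>v (C2 *\<^sub>v e t) = Pr *\<^sub>v (C2 *\<^sub>v w2 t) - Pr *\<^sub>v (C2 *\<^sub>v x2 t)"
          unfolding e_def using signal_dims t by (simp add: dims mult_vec_diff)
        then show ?thesis
          unfolding ybar_w2[OF t, symmetric] ybar_eq[OF t]
          by (simp, intro eq_vecI) (simp_all add: dims del: index_mult_mat_vec)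
      qed
      have e_eq: "E22 *\<^sub>v e' t = A22 *\<^sub>v e t - Z *\<^sub>v (M *\<^sub>v w t)" if t: "t \<ge> 0" for t
      proof -
        have "E22 *\<^sub>v e' t = N *\<^sub>v w2 t - G *\<^sub>v ybar t - (A22 *\<^sub>v x2 t + Z *\<^sub>v (M *\<^sub>v w t))"
          using w2_eq[OF t] x2_eq[OF t] signal_dims t by (simp add: e'_def dims mult_vec_diff)
        also have "\<dots> = A22 *\<^sub>v e t - Z *\<^sub>v (M *\<^sub>v w t)"
          unfolding ybar_w2[OF t] N_mult[OF has_signal_deriv_dim(1)[OF w2_deriv t]] e_def
          using signal_dims t
          by (intro eq_vecI) (simp_all add: dims mult_vec_diff del: index_mult_mat_vec)
        finally show ?thesis .
      qed
      \<comment> \<open>adding \<open>G Pr C2 e = G Pr Dm w\<close> to both sides exchanges the pencil \<open>(E22, A22)\<close> for the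
        one of the filter\<close>
      define f where "f = (\<lambda>t. - (G *\<^sub>v (Pr *\<^sub>v (Dm *\<^sub>v w t))) - Z *\<^sub>v (M *\<^sub>v w t))"
      have f: "smooth_signal m f"
        unfolding f_def by (intro smooth_signal_diff smooth_signal_uminus
            smooth_signal_mult[OF G' smooth_signal_mult[OF Pr_carrier smooth_signal_mult[OF Dm w]]]
            smooth_signal_mult[OF Z smooth_signal_mult[OF M w]])
      have "E22 *\<^sub>v e' t = N *\<^sub>v e t + f t" if t: "t \<ge> 0" for t
        unfolding e_eq[OF t] f_def N_mult[OF has_signal_deriv_dim(1)[OF e_deriv t]] PrC2e[OF t]
        by (rule eq_vecI) (simp_all add: dims del: index_mult_mat_vec)
      then have e_smooth: "smooth_signal q e"
        by (rule dae_solution_smooth[OF E_blocks(3) N no_eigenvalue e_deriv f])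
      \<comment> \<open>with first component \<open>v1\<close> and second component \<open>e\<close> the output matches that of the attack\<close>
      define v1 where "v1 = (\<lambda>t. pinv C1 *\<^sub>v (Dm *\<^sub>v w t - C2 *\<^sub>v e t))"
      have gap: "smooth_signal p (\<lambda>t. Dm *\<^sub>v w t - C2 *\<^sub>v e t)"
        by (intro smooth_signal_diff smooth_signal_mult[OF Dm w] smooth_signal_mult[OF C_blocks(2) e_smooth])
      have v1: "smooth_signal l v1" unfolding v1_def by (rule smooth_signal_mult[OF pC1 gap])
      obtain v1' where v1': "smooth_signal l v1'" "has_signal_deriv l v1 v1'"
        using smooth_signal_imp_deriv[OF v1] by blast
      obtain e'' where e'': "smooth_signal q e''" "has_signal_deriv q e e''"
        using smooth_signal_imp_deriv[OF e_smooth] by blast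
      have e''_eq: "e'' t = e' t" if t: "t \<ge> 0" for t
      proof (rule eq_vecI)
        fix i assume "i < dim_vec (e' t)"
        then have "i < q" using has_signal_deriv_dim[OF e_deriv t] by simp
        then show "e'' t $ i = e' t $ i"
          using half_line_deriv_unique[of "\<lambda>t. e t $ i" "\<lambda>t. e'' t $ i" "\<lambda>t. e' t $ i" t] e''(2) e_deriv t
          by (simp add: has_signal_deriv_iff)
      qed (use has_signal_deriv_dim(2)[OF e_deriv t] smooth_signal_dim[OF e''(1) t] in simp)
      have C1v1: "C1 *\<^sub>v v1 t + C2 *\<^sub>v e t = Dm *\<^sub>v w t" if t: "t \<ge> 0" for t
      proof -
        have ed: "dim_vec (e t) = q" by (rule has_signal_deriv_dim(1)[OF e_deriv t])
        have "Pr *\<^sub>v (Dm *\<^sub>v w t - C2 *\<^sub>v e t) = 0\<^sub>v p"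
          using PrC2e[OF t] by (simp add: dims mult_vec_diff zero_vec_simps)
        then have "(Dm *\<^sub>v w t - C2 *\<^sub>v e t) - C1 *\<^sub>v v1 t = 0\<^sub>v p"
          using Pr_mult[of "Dm *\<^sub>v w t - C2 *\<^sub>v e t"] by (simp add: v1_def dims)
        then have eq: "Dm *\<^sub>v w t - C2 *\<^sub>v e t = C1 *\<^sub>v v1 t"
          by (subst (asm) vec_minus_eq_zero_iff) (auto simp: dims intro!: carrier_vecI)
        show ?thesis unfolding eq[symmetric]
          by (rule eq_vecI) (simp_all add: dims del: index_mult_mat_vec)
      qed
      define \<delta> \<delta>' where "\<delta> = (\<lambda>t. Q *\<^sub>v (v1 t @\<^sub>v e t))" and "\<delta>' = (\<lambda>t. Q *\<^sub>v (v1' t @\<^sub>v e'' t))"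
      have \<delta>: "smooth_signal n \<delta>" "smooth_signal n \<delta>'"
        unfolding \<delta>_def \<delta>'_def
        by (intro smooth_signal_mult[OF Q_carrier] smooth_signal_append v1 v1' e_smooth e'')+
      have \<delta>_deriv: "has_signal_deriv n \<delta> \<delta>'"
        unfolding \<delta>_def \<delta>'_def
      proof (rule has_signal_deriv_mult[OF Q_carrier])
        show "has_signal_deriv (l + q) (\<lambda>t. v1 t @\<^sub>v e t) (\<lambda>t. v1' t @\<^sub>v e'' t)"
          by (subst has_signal_deriv_append_iff)
            (use v1'(2) e''(2) has_signal_deriv_carrier[OF v1'(2)] has_signal_deriv_carrier[OF e''(2)] in auto)
      qed
      have C\<delta>: "C_hat n p C K *\<^sub>v \<delta> t = Dm *\<^sub>v w t" if t: "t \<ge> 0" for t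
      proof -
        have c: "v1 t \<in> carrier_vec l" "e t \<in> carrier_vec q"
          using smooth_signal_carrier[OF v1 t] smooth_signal_carrier[OF e_smooth t] by auto
        have "C_hat n p C K *\<^sub>v \<delta> t = hcat C1 C2 *\<^sub>v (v1 t @\<^sub>v e t)"
          unfolding \<delta>_def C_blocks(3)[symmetric] using c by (simp add: dims mat_vec_assoc)
        also have "\<dots> = C1 *\<^sub>v v1 t + C2 *\<^sub>v e t" by (rule hcat_mult_append[OF C_blocks(1,2) c])
        finally show ?thesis using C1v1[OF t] by simp
      qed
      \<comment> \<open>the state equation that \<open>\<delta>\<close> ought to satisfy fails by \<open>h\<close>, whose lower block is zero\<close>
      define h where "h = (\<lambda>t. H *\<^sub>v \<delta> t - M *\<^sub>v w t - E *\<^sub>v \<delta>' t)"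
      have h: "smooth_signal n h"
        unfolding h_def by (intro smooth_signal_diff smooth_signal_mult[OF H] smooth_signal_mult[OF M w]
            smooth_signal_mult[OF E] \<delta>)
      have Zh: "Z *\<^sub>v h t = 0\<^sub>v m" if t: "t \<ge> 0" for t
      proof -
        have c: "v1 t \<in> carrier_vec l" "e t \<in> carrier_vec q" "v1' t \<in> carrier_vec l" "e'' t \<in> carrier_vec q"
          using smooth_signal_carrier[OF v1 t] smooth_signal_carrier[OF e_smooth t]
            smooth_signal_carrier[OF v1'(1) t] smooth_signal_carrier[OF e''(1) t] by auto
        have "Z *\<^sub>v h t = Z *\<^sub>v (H *\<^sub>v \<delta> t) - Z *\<^sub>v (M *\<^sub>v w t) - Z *\<^sub>v (E *\<^sub>v \<delta>' t)"
          unfolding h_def by (simp add: dims mult_vec_diff)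
        also have "Z *\<^sub>v (H *\<^sub>v \<delta> t) = A22 *\<^sub>v e t"
          unfolding \<delta>_def by (rule lower[OF H A_blocks c(1,2)])
        also have "Z *\<^sub>v (E *\<^sub>v \<delta>' t) = E22 *\<^sub>v e'' t"
          unfolding \<delta>'_def by (rule lower[OF E E_blocks c(3,4)])
        also have "E22 *\<^sub>v e'' t = A22 *\<^sub>v e t - Z *\<^sub>v (M *\<^sub>v w t)"
          using e_eq[OF t] e''_eq[OF t] by simp
        finally show ?thesis by (simp add: dims zero_vec_simps)
      qed
      have h_orth: "c \<bullet> h t = 0" if t: "t \<ge> 0" and c: "c \<in> set cs" for t c
      proof -
        obtain i where i: "i < length cs" "c = cs ! i" using c by (metis in_set_conv_nth)
        have "row Z i = c" unfolding Z_def i(2) using i(1) cs_carrier nth_mem by (intro mat_of_rows_row) auto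
        then have "c \<bullet> h t = (Z *\<^sub>v h t) $ i" using i Z len_cs by simp
        then show ?thesis using Zh[OF t] i len_cs by simp
      qed
      obtain z z' v where z: "smooth_signal n z" "has_signal_deriv n z z'" and v: "smooth_signal (card K) v"
        and Cz: "\<And>t. t \<ge> 0 \<Longrightarrow> C_hat n p C K *\<^sub>v z t = 0\<^sub>v p"
        and Ez: "\<And>t. t \<ge> 0 \<Longrightarrow> E *\<^sub>v z' t = A_hat n p A C K *\<^sub>v z t + B_hat n p K *\<^sub>v v t + h t"
        using S_valued_forcing_absorbed[OF E A C K S bs cs h h_orth] by blast
      define d d' where "d = (\<lambda>t. \<delta> t + z t)" and "d' = (\<lambda>t. \<delta>' t + z' t)"
      have d: "smooth_signal n d" "has_signal_deriv n d d'"
        unfolding d_def d'_def by (rule smooth_signal_add[OF \<delta>(1) z(1)], rule has_signal_deriv_add[OF \<delta>_deriv z(2)])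
      have out: "C_hat n p C K *\<^sub>v d t = Dm *\<^sub>v w t" if t: "t \<ge> 0" for t
        unfolding d_def using C\<delta>[OF t] Cz[OF t] smooth_signal_dim[OF \<delta>(1) t] smooth_signal_dim[OF z(1) t]
        by (simp add: dims mult_vec_add zero_vec_simps)
      have state: "E *\<^sub>v d' t = A_hat n p A C K *\<^sub>v d t + L *\<^sub>v (C_hat n p C K *\<^sub>v d t) + B_hat n p K *\<^sub>v v t - M *\<^sub>v w t"
        if t: "t \<ge> 0" for t
      proof -
        note sd = smooth_signal_dim[OF \<delta>(1) t] smooth_signal_dim[OF \<delta>(2) t] smooth_signal_dim[OF z(1) t]
          has_signal_deriv_dim(2)[OF z(2) t] smooth_signal_dim[OF v t] smooth_signal_dim[OF h t]
        have H\<delta>: "H *\<^sub>v \<delta> t = A_hat n p A C K *\<^sub>v \<delta> t + L *\<^sub>v (Dm *\<^sub>v w t)"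
          unfolding H_def by (simp add: dims sd mat_add_mult_vec mat_vec_assoc C\<delta>[OF t])
        have "E *\<^sub>v d' t = E *\<^sub>v \<delta>' t + (A_hat n p A C K *\<^sub>v z t + B_hat n p K *\<^sub>v v t + h t)"
          unfolding d'_def using Ez[OF t] by (simp add: dims sd mult_vec_add)
        then show ?thesis
          unfolding out[OF t] unfolding h_def H\<delta> d_def
          by (simp, intro eq_vecI) (simp_all add: dims sd mult_vec_add del: index_mult_mat_vec)
      qed
      define v' where "v' = (\<lambda>t. v t - pinv (D_sig n p K) *\<^sub>v (D_sig n p K *\<^sub>v v t)
          - pinv (D_sig n p K) *\<^sub>v (C *\<^sub>v d t - D_sig n p R *\<^sub>v w t))"
      note sigK = sig_carrier[OF K] and sigR = sig_carrier[OF R]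
      have v': "smooth_signal (card K) v'"
        unfolding v'_def
        by (intro smooth_signal_diff v smooth_signal_mult[OF sigK(3)] smooth_signal_mult[OF sigK(2) v]
            smooth_signal_mult[OF C d(1)] smooth_signal_mult[OF sigR(2) w])
      have plant: "E *\<^sub>v d' t = A *\<^sub>v d t + B_sig n p K *\<^sub>v v' t - B_sig n p R *\<^sub>v sub_vec (u t) R"
        "C *\<^sub>v d t + D_sig n p K *\<^sub>v v' t = D_sig n p R *\<^sub>v sub_vec (u t) R" if t: "t \<ge> 0" for t
        using conditioned_equation_imp_plant_equation[OF A C K R L_carrier smooth_signal_carrier[OF d(1) t]
            smooth_signal_carrier[OF v t] smooth_signal_carrier[OF w t] state[OF t, unfolded M_def]
            out[OF t, unfolded Dm_def]]
        unfolding v'_def w_def by blast+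
      have "unidentifiable n p E A C R"
        by (rule plant_difference_imp_unidentifiable[OF E A C K R card neq input_smooth attack_set reg d(2) v' plant])
      then show False using ident by (simp add: identifiable_def)
    qed
  qed
qed

end
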